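(* Consider the unknown-scale model with inverse-gamma prior described in the context. Suppose $k_n\sim n^a$ for some $a\in(0,1)$, and that for some $0<\delta<1-a$: (A1) for each $n$ there is $\theta_{0n}=(\theta_{10n},\dots,\theta_{K(n)0n})$ with $\|f_{\theta_{0n}}-f_0\|_2=o(n^{-\delta})$; (A2) $\sum_{i=1}^{K(n)}\theta_{i0n}^2=o(n^{1-\delta})$. Then for every $\epsilon>0$ (and every $\varepsilon>0$), $\pi^*(\mathcal V_\varepsilon^c)=o_{P_0^n}(n^{\epsilon-\delta})$.
   Context: Data: i.i.d. pairs $(y_i,\mathbf x_i)$, $i=1,\dots,n$, with $\mathbf x_i\sim\mathrm{Uniform}[0,1]^p$ ($p$ fixed), $y_i=f_0(\mathbf x_i)+\xi_i$, $\xi_i\sim N(0,\sigma_0^2)$ independent of $\mathbf x_i$, $f_0$ square integrable on $[0,1]^p$, $\sigma_0>0$ unknown. $P_0^n$ is the true data law; $Z_n=o_{P_0^n}(r_n)$ means $Z_n/r_n\to0$ in $P_0^n$-probability; $\|\cdot\|_2$ is the $L_2([0,1]^p)$ norm. $\psi(u)=1/(1+e^{-u})$, $f_{\theta_n}(\mathbf x)=\beta_0+\sum_{j=1}^{k_n}\beta_j\psi(\gamma_{j0}+\sum_{h=1}^p\gamma_{jh}x_h)$, $\theta_n=(\theta_{1n},\dots,\theta_{K(n)n})$ the vector of all parameters, $K(n)$ their number. Parameter $\omega_n=(\theta_n,\sigma^2)$, model density $l_{\omega_n}(y,\mathbf x)=(2\pi\sigma^2)^{-1/2}\exp(-(y-f_{\theta_n}(\mathbf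 x))^2/(2\sigma^2))$, true density $l_0$ the same with $f_0,\sigma_0^2$; $L(\omega_n)=\prod_{i=1}^nl_{\omega_n}(y_i,\mathbf x_i)$. Prior: $p(\omega_n)=\frac{\lambda^\alpha}{\Gamma(\alpha)}(\sigma^{-2})^{\alpha+1}e^{-\lambda/\sigma^2}\prod_{i=1}^{K(n)}(2\pi\zeta^2)^{-1/2}e^{-\theta_{in}^2/(2\zeta^2)}$ with fixed $\alpha,\lambda,\zeta>0$. Posterior $\pi(\omega_n|\mathbf y_n,\mathbf X_n)\propto L(\omega_n)p(\omega_n)$. $d_{KL}(q,p)=\int q\log(q/p)$. Variational family $\mathcal Q_n$: densities $q(\omega_n)=\frac{\tilde b_n^{\tilde a_n}}{\Gamma(\tilde a_n)}(\sigma^{-2})^{\tilde a_n+1}e^{-\tilde b_n/\sigma^2}\prod_{i=1}^{K(n)}N(\theta_{in};\tilde m_{in},\tilde s_{in}^2)$ (inverse-gamma on $\sigma^2$ times independent normals); $\pi^*=\arg\min_{q\in\mathcal Q_n}d_{KL}(q,\pi(\cdot|\mathbf y_n,\mathbf X_n))$. $d_H(l_0,l_{\omega_n})=\int\int(\sqrt{l_{\omega_n}}-\sqrt{l_0})^2dy\,d\mathbf x$, $\mathcal V_\varepsilon=\{\omega_n:d_H(l_0,l_{\omega_n})<\varepsilon\}$. *)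

theory Defs
  imports "HOL-Probability.Probability" "HOL-Library.Landau_Symbols"
begin

(* covariate vectors x = (x_1,...,x_p) are represented as nat => real, x_h stored at index h-1 *)
definition Xmeas :: "nat \<Rightarrow> (nat \<Rightarrow> real) measure" where
  "Xmeas p = PiM {..<p} (\<lambda>_. uniform_measure lborel {0..1::real})"

definition psi :: "real \<Rightarrow> real" where
  "psi u = 1 / (1 + exp (- u))"

(* number of parameters: beta_0, beta_1..beta_k, gamma_{j h} (j=1..k, h=0..p) *)
definition Knum :: "nat \<Rightarrow> nat \<Rightarrow> nat" where
  "Knum p k = 1 + k * (p + 2)"

(* coding: theta 0 = beta_0, theta j = beta_j (1<=j<=k),
   theta (gidx k j h) = gamma_{j h} (1<=j<=k, 0<=h<=p) *)
definition gidx :: "nat \<Rightarrow> nat \<Rightarrow> nat \<Rightarrow> nat \<Rightarrow> nat" where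
  "gidx p k j h = k + 1 + (j - 1) * (p + 1) + h"

definition fnet :: "nat \<Rightarrow> nat \<Rightarrow> (nat \<Rightarrow> real) \<Rightarrow> (nat \<Rightarrow> real) \<Rightarrow> real" where
  "fnet p k \<theta> x = \<theta> 0 + (\<Sum>j\<in>{1..k}. \<theta> j *
      psi (\<theta> (gidx p k j 0) + (\<Sum>h\<in>{1..p}. \<theta> (gidx p k j h) * x (h - 1))))"

definition ldens :: "((nat \<Rightarrow> real) \<Rightarrow> real) \<Rightarrow> real \<Rightarrow> real \<Rightarrow> (nat \<Rightarrow> real) \<Rightarrow> real" where
  "ldens f s2 y x = (2 * pi * s2) powr (-1/2) * exp (- ((y - f x) ^ 2) / (2 * s2))"

definition obs_meas :: "nat \<Rightarrow> ((nat \<Rightarrow> real) \<Rightarrow> real) \<Rightarrow> real \<Rightarrow> (real \<times> (nat \<Rightarrow> real)) measure" where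
  "obs_meas p f0 \<sigma>0 = density (lborel \<Otimes>\<^sub>M Xmeas p) (\<lambda>(y, x). ennreal (ldens f0 (\<sigma>0^2) y x))"

definition P0n :: "nat \<Rightarrow> ((nat \<Rightarrow> real) \<Rightarrow> real) \<Rightarrow> real \<Rightarrow> nat \<Rightarrow> (nat \<Rightarrow> real \<times> (nat \<Rightarrow> real)) measure" where
  "P0n p f0 \<sigma>0 n = PiM {..<n} (\<lambda>_. obs_meas p f0 \<sigma>0)"

definition L2norm :: "nat \<Rightarrow> ((nat \<Rightarrow> real) \<Rightarrow> real) \<Rightarrow> real" where
  "L2norm p g = sqrt (\<integral>x. (g x)^2 \<partial>Xmeas p)"

(* omega = (theta, sigma^2), theta indexed by {..<K} *)
definition param_meas :: "nat \<Rightarrow> ((nat \<Rightarrow> real) \<times> real) measure" where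
  "param_meas K = PiM {..<K} (\<lambda>_. lborel) \<Otimes>\<^sub>M lborel"

definition invgamma_dens :: "real \<Rightarrow> real \<Rightarrow> real \<Rightarrow> real" where
  "invgamma_dens a b s2 = (if s2 > 0 then b powr a / Gamma a * (1 / s2) powr (a + 1) * exp (- b / s2) else 0)"

definition gauss_dens :: "real \<Rightarrow> real \<Rightarrow> real \<Rightarrow> real" where
  "gauss_dens m v t = (2 * pi * v) powr (-1/2) * exp (- ((t - m) ^ 2) / (2 * v))"

definition prior_dens :: "real \<Rightarrow> real \<Rightarrow> real \<Rightarrow> nat \<Rightarrow> (nat \<Rightarrow> real) \<times> real \<Rightarrow> real" where
  "prior_dens \<alpha> lam \<zeta> K \<omega> = invgamma_dens \<alpha> lam (snd \<omega>) * (\<Prod>i<K. gauss_dens 0 (\<zeta>^2) (fst \<omega> i))"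

definition lik :: "nat \<Rightarrow> nat \<Rightarrow> nat \<Rightarrow> (nat \<Rightarrow> real \<times> (nat \<Rightarrow> real)) \<Rightarrow> (nat \<Rightarrow> real) \<times> real \<Rightarrow> real" where
  "lik p k n D \<omega> = (\<Prod>i<n. ldens (fnet p k (fst \<omega>)) (snd \<omega>) (fst (D i)) (snd (D i)))"

definition post_dens :: "nat \<Rightarrow> real \<Rightarrow> real \<Rightarrow> real \<Rightarrow> nat \<Rightarrow> nat \<Rightarrow> (nat \<Rightarrow> real \<times> (nat \<Rightarrow> real)) \<Rightarrow> (nat \<Rightarrow> real) \<times> real \<Rightarrow> real" where
  "post_dens p \<alpha> lam \<zeta> k n D \<omega> =
     lik p k n D \<omega> * prior_dens \<alpha> lam \<zeta> (Knum p k) \<omega> /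
     enn2real (\<integral>\<^sup>+ w. ennreal (lik p k n D w * prior_dens \<alpha> lam \<zeta> (Knum p k) w) \<partial>param_meas (Knum p k))"

(* variational parameters (a~, b~, m~, s~) *)
type_synonym vparam = "real \<times> real \<times> (nat \<Rightarrow> real) \<times> (nat \<Rightarrow> real)"

definition vvalid :: "nat \<Rightarrow> vparam \<Rightarrow> bool" where
  "vvalid K v = (case v of (a, b, m, s) \<Rightarrow> a > 0 \<and> b > 0 \<and> (\<forall>i<K. s i > 0))"

definition vdens :: "nat \<Rightarrow> vparam \<Rightarrow> (nat \<Rightarrow> real) \<times> real \<Rightarrow> real" where
  "vdens K v \<omega> = (case v of (a, b, m, s) \<Rightarrow>
      invgamma_dens a b (snd \<omega>) * (\<Prod>i<K. gauss_dens (m i) ((s i)^2) (fst \<omega> i)))"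

(* pointwise integrand of KL(q,pi) = int q log(q/pi); for probability densities q, pi
   int q log(q/pi) = int (q log(q/pi) - q + pi), and the latter integrand is >= 0,
   with conventions 0 log(0/b) = 0 and a log(a/0) = infinity for a > 0 *)
definition kl_integrand :: "real \<Rightarrow> real \<Rightarrow> ennreal" where
  "kl_integrand a b = (if a \<le> 0 then ennreal b
                       else if b \<le> 0 then \<infinity>
                       else ennreal (a * ln (a / b) - a + b))"

definition dKL :: "'a measure \<Rightarrow> ('a \<Rightarrow> real) \<Rightarrow> ('a \<Rightarrow> real) \<Rightarrow> ennreal" where
  "dKL M q \<pi> = (\<integral>\<^sup>+ w. kl_integrand (q w) (\<pi> w) \<partial>M)"

definition dH :: "nat \<Rightarrow> ((nat \<Rightarrow> real) \<Rightarrow> real) \<Rightarrow> real \<Rightarrow> nat \<Rightarrow> (nat \<Rightarrow> real) \<times> real \<Rightarrow> ennreal" where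
  "dH p f0 \<sigma>0 k \<omega> = (\<integral>\<^sup>+ (y, x). ennreal ((sqrt (ldens (fnet p k (fst \<omega>)) (snd \<omega>) y x)
        - sqrt (ldens f0 (\<sigma>0^2) y x))^2) \<partial>(lborel \<Otimes>\<^sub>M Xmeas p))"

definition Vnbhd :: "nat \<Rightarrow> ((nat \<Rightarrow> real) \<Rightarrow> real) \<Rightarrow> real \<Rightarrow> nat \<Rightarrow> real \<Rightarrow> ((nat \<Rightarrow> real) \<times> real) set" where
  "Vnbhd p f0 \<sigma>0 k \<epsilon> = {\<omega> \<in> space (param_meas (Knum p k)). dH p f0 \<sigma>0 k \<omega> < ennreal \<epsilon>}"

(* outer measure (avoids silently assigning measure 0 to non-measurable sets) *)
definition outer_meas :: "'a measure \<Rightarrow> 'a set \<Rightarrow> real" where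
  "outer_meas M A = Inf {measure M B | B. B \<in> sets M \<and> A \<subseteq> B}"

definition o_P :: "(nat \<Rightarrow> 'a measure) \<Rightarrow> (nat \<Rightarrow> 'a \<Rightarrow> real) \<Rightarrow> (nat \<Rightarrow> real) \<Rightarrow> bool" where
  "o_P P Z r = (\<forall>\<eta>>0. (\<lambda>n. outer_meas (P n) {D \<in> space (P n). \<bar>Z n D\<bar> > \<eta> * r n}) \<longlonglongrightarrow> 0)"

end

theory Submission
  imports Defs "HOL-Real_Asymp.Real_Asymp"
begin

text \<open>
  Let \<open>U\<close> be the complement of the Hellinger ball of radius \<open>\<epsilon>'\<close>. By the Gibbs variational inequality,
  \<open>T * \<pi>*(U) \<le> KL(\<pi>*, posterior) + exp T * posterior(U)\<close> for every \<open>T \<ge> 0\<close>, so it suffices that the posterior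
  mass of \<open>U\<close> is exponentially small in \<open>n\<close> while the divergence of the minimiser is of order at most
  \<open>n powr (1 - \<delta> + \<epsilon>)\<close>.

  The divergence is bounded by that of an explicit candidate centred at \<open>\<theta>0\<close> (Gaussian scale \<open>n powr -4\<close>,
  inverse gamma with shape \<open>n + 1\<close> and mean \<open>\<sigma>0\<^sup>2\<close>), for which the log ratio of candidate to posterior is
  dominated by an explicit function with computable mean. The log evidence ratio \<open>A\<close> enters this bound with a plus
  sign and is controlled from above by Markov's inequality, since the evidence ratio has mean one; from below it is
  controlled because the divergence is nonnegative.

  For the posterior, the parameters in a sieve are covered by \<open>exp (O(n powr a * ln n))\<close> upper brackets \<open>u\<close> whose
  affinity \<open>\<integral> sqrt (u * l0)\<close> with the true density is below \<open>exp (- min \<epsilon>' 2 / 4)\<close>; Markov's inequality for the square root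
  of the likelihood ratio, together with a union bound, replaces tests. One constant bracket handles all large
  scale parameters, and the complement of the sieve has prior mass of order \<open>exp (- c * n\<^sup>2)\<close>.
\<close>

section \<open>One-dimensional densities and the network function\<close>

text \<open>The tilt can be taken of order \<open>n\<close> because, off small exceptional events,
  the posterior mass of \<open>U\<close> is at most \<open>2 * exp (- \<kappa> - A)\<close> with
  \<open>\<kappa> = e / 4 * n\<close>. A divergence of order
  \<open>n powr (1 - \<delta> + \<epsilon>)\<close> divided by it gives the rate. The extra
  \<open>\<epsilon>\<close> is the price of Markov's inequality: the cost of the candidate is
  controlled through its mean alone. The obstacle is the noise. Since the scale is unknown, the log
  ratio contains the sum of squared errors with a coefficient that depends on the scale, and the
  cross term of noise and approximation error. The candidate is centred at the true scale, so that
  the parts of order \<open>n\<close> cancel in mean. The cross term is removed by Young's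
  inequality with weight \<open>\<tau> = n powr (- \<delta>)\<close>. This leaves
  \<open>n * \<tau>\<close> from the noise and \<open>n * L\<^sup>2 / \<tau>\<close> from the
  approximation error \<open>L\<close>; an error below \<open>n powr (- \<delta>)\<close> makes both
  at most \<open>n powr (1 - \<delta>)\<close>, which is why the hypothesis on the unsquared norm
  fits the rate.\<close>

lemma nn_integral_invgamma_dens:
  assumes a: "a > 0" and b: "b > 0"
  shows "(\<integral>\<^sup>+ s. ennreal (invgamma_dens a b s) \<partial>lborel) = 1"
proof -
  define f where "f = (\<lambda>t::real. t powr (a - 1) / exp t)"
  \<comment> \<open>Substitution \<open>t = b / s\<close> in Euler's integral for
    \<open>Gamma a\<close>, with the modulus of the Jacobian in front.\<close>
  define h where "h = (\<lambda>s::real. \<bar>- b / s^2\<bar> * f (b / s))"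
  have f0: "(f has_integral Gamma a) {0..}" unfolding f_def by (rule Gamma_integral_real[OF a])
  \<comment> \<open>The substitution maps the open half-line onto itself and is singular at
    \<open>0\<close>, so the endpoint is removed first.\<close>
  have "(f has_integral Gamma a) {0<..} = (f has_integral Gamma a) {0..}"
    by (rule has_integral_spike_set_eq) (auto intro: negligible_subset[of "{0}"])
  with f0 have fi: "(f has_integral Gamma a) {0<..}" by simp
  have fabs: "f absolutely_integrable_on {0<..}"
    by (rule nonnegative_absolutely_integrable_1) (use fi in \<open>auto simp: f_def intro: has_integral_integrable\<close>)
  have img: "(\<lambda>s. b / s) ` {0<..} = {0<..}"
  proof (intro equalityI subsetI)
    fix x :: real assume "x \<in> {0<..}"
    then show "x \<in> (\<lambda>s. b / s) ` {0<..}"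
      using b by (intro image_eqI[of _ _ "b / x"]) auto
  qed (use b in auto)
  have h: "h absolutely_integrable_on {0<..} \<and> integral {0<..} h = Gamma a"
    unfolding h_def
  proof (subst has_absolute_integral_change_of_variables_1'[where g = "\<lambda>s. b / s"])
    show "inj_on (\<lambda>s. b / s) {0<..}" using b by (auto simp: inj_on_def)
    fix x :: real assume "x \<in> {0<..}"
    then show "((\<lambda>s. b / s) has_real_derivative - b / x\<^sup>2) (at x within {0<..})"
      by (auto intro!: derivative_eq_intros simp: power2_eq_square)
  qed (use fabs fi img in \<open>auto simp: integral_unique\<close>)
  have "h integrable_on {0<..}"
    using h by (intro set_lebesgue_integral_eq_integral(1)) simp
  then have hi: "(h has_integral Gamma a) {0<..}"
    using h integrable_integral[of h "{0<..}"] by simp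
  have "(\<integral>\<^sup>+ s. ennreal (invgamma_dens a b s) \<partial>lborel)
     = (\<integral>\<^sup>+ s. ennreal (1 / Gamma a) * ennreal (indicator {0<..} s * h s) \<partial>lborel)"
  proof (intro nn_integral_cong, goal_cases)
    case (1 s)
    have "invgamma_dens a b s = 1 / Gamma a * (indicator {0<..} s * h s)"
    proof (cases "s > 0")
      case True
      have "b powr a * (1 / s) powr (a + 1) = b / s^2 * (b / s) powr (a - 1)"
      proof -
        have "b powr a = b powr (a - 1) * b"
          using b powr_add[of b "a - 1" 1] by simp
        moreover have "(1 / s) powr (a + 1) = (1 / s) powr (a - 1) * (1 / s)\<^sup>2"
          using True powr_add[of "1 / s" "a - 1" 2] by (simp add: add.commute)
        moreover have "(b / s) powr (a - 1) = b powr (a - 1) * (1 / s) powr (a - 1)"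
          using True b powr_mult[of b "1 / s" "a - 1"] by simp
        ultimately show ?thesis by (simp add: power_one_over)
      qed
      moreover have "exp (- b / s) = 1 / exp (b / s)" by (simp add: exp_minus inverse_eq_divide)
      moreover have "\<bar>- b / s\<^sup>2\<bar> = b / s\<^sup>2" using b by simp
      ultimately show ?thesis using True
        by (simp add: invgamma_dens_def h_def f_def)
    qed (simp add: invgamma_dens_def)
    then show ?case using a
      by (simp add: ennreal_mult'[symmetric] Gamma_real_pos less_imp_le)
  qed
  also have "\<dots> = ennreal (1 / Gamma a) * (\<integral>\<^sup>+ s. ennreal (indicator {0<..} s * h s) \<partial>lborel)"
    by (rule nn_integral_cmult) (simp add: h_def f_def)
  also have "(\<integral>\<^sup>+ s. ennreal (indicator {0<..} s * h s) \<partial>lborel) = ennreal (Gamma a)"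
    using nn_integral_has_integral_lebesgue[OF _ hi] by (simp add: h_def f_def)
  finally show ?thesis using Gamma_real_pos[OF a] by (simp add: ennreal_mult'[symmetric])
qed

lemma invgamma_dens_nonneg: "a > 0 \<Longrightarrow> 0 \<le> invgamma_dens a b s"
  by (simp add: invgamma_dens_def Gamma_real_pos less_imp_le)

lemma invgamma_dens_pos: "a > 0 \<Longrightarrow> b > 0 \<Longrightarrow> s > 0 \<Longrightarrow> 0 < invgamma_dens a b s"
  by (simp add: invgamma_dens_def Gamma_real_pos)

lemma invgamma_dens_measurable [measurable]: "invgamma_dens a b \<in> borel_measurable borel"
  unfolding invgamma_dens_def[abs_def] by measurable

text \<open>A factor \<open>1 / s\<close> only raises the shape by one. Both moments below follow
  from this and normalisation.\<close>

lemma invgamma_dens_divide: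
  assumes "a > 0" "b > 0"
  shows "invgamma_dens a b s / s = a / b * invgamma_dens (a + 1) b s"
proof (cases "s > 0")
  case True
  have "Gamma (a + 1) = a * Gamma a" using assms by (simp add: Gamma_plus1 nonpos_Ints_def)
  moreover have "Gamma a > 0" using assms by (simp add: Gamma_real_pos)
  ultimately show ?thesis using True assms
    by (simp add: invgamma_dens_def powr_add powr_divide field_simps power2_eq_square)
qed (simp add: invgamma_dens_def)

lemma nn_integral_invgamma_dens_inverse:
  assumes "a > 0" "b > 0"
  shows "(\<integral>\<^sup>+ s. ennreal (invgamma_dens a b s / s) \<partial>lborel) = ennreal (a / b)"
proof -
  have "(\<integral>\<^sup>+ s. ennreal (invgamma_dens a b s / s) \<partial>lborel)
      = (\<integral>\<^sup>+ s. ennreal (a / b) * ennreal (invgamma_dens (a + 1) b s) \<partial>lborel)"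
    using assms unfolding invgamma_dens_divide[OF assms]
    by (intro nn_integral_cong ennreal_mult) (auto intro: invgamma_dens_nonneg)
  also have "\<dots> = ennreal (a / b)"
    using assms by (subst nn_integral_cmult) (auto simp: nn_integral_invgamma_dens)
  finally show ?thesis .
qed

text \<open>Written for shape \<open>a + 1\<close> so that the mean is \<open>b / a\<close>; the
  candidate with shape \<open>n + 1\<close> and rate \<open>n * \<sigma>0\<^sup>2\<close> then has
  mean exactly \<open>\<sigma>0\<^sup>2\<close>.\<close>

lemma nn_integral_invgamma_dens_mean:
  assumes "a > 0" "b > 0"
  shows "(\<integral>\<^sup>+ s. ennreal (invgamma_dens (a + 1) b s * s) \<partial>lborel) = ennreal (b / a)"
proof -
  have eq: "invgamma_dens (a + 1) b s * s = b / a * invgamma_dens a b s" for s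
  proof (cases "s > 0")
    case True
    then show ?thesis using invgamma_dens_divide[OF assms, of s] assms by (simp add: field_simps)
  qed (simp add: invgamma_dens_def)
  have "(\<integral>\<^sup>+ s. ennreal (invgamma_dens (a + 1) b s * s) \<partial>lborel)
      = (\<integral>\<^sup>+ s. ennreal (b / a) * ennreal (invgamma_dens a b s) \<partial>lborel)"
    using assms unfolding eq by (intro nn_integral_cong ennreal_mult) (auto intro: invgamma_dens_nonneg)
  also have "\<dots> = ennreal (b / a)"
    using assms by (subst nn_integral_cmult) (auto simp: nn_integral_invgamma_dens)
  finally show ?thesis .
qed

lemma powr_minus_half: "0 \<le> x \<Longrightarrow> x powr (- 1 / 2) = 1 / sqrt (x::real)"
  using powr_minus_divide[of x "1 / 2"] powr_half_sqrt[of x] by simp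

lemma gauss_dens_eq_normal_density: "v > 0 \<Longrightarrow> gauss_dens m v = normal_density m (sqrt v)"
  using powr_minus_half[of "2 * pi * v"] by (intro ext) (simp add: gauss_dens_def normal_density_def)

lemma ldens_eq_normal_density: "s > 0 \<Longrightarrow> ldens f s y x = normal_density (f x) (sqrt s) y"
  using powr_minus_half[of "2 * pi * s"] by (simp add: ldens_def normal_density_def)

lemma gauss_dens_pos: "v > 0 \<Longrightarrow> 0 < gauss_dens m v t"
  by (simp add: gauss_dens_def)

lemma gauss_dens_nonneg: "0 \<le> gauss_dens m v t"
  by (simp add: gauss_dens_def)

lemma gauss_dens_measurable [measurable]: "gauss_dens m v \<in> borel_measurable borel"
  unfolding gauss_dens_def[abs_def] by measurable

lemma nn_integral_normal_density:
  assumes "\<sigma> > 0"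
  shows "(\<integral>\<^sup>+ t. ennreal (normal_density m \<sigma> t) \<partial>lborel) = 1"
  using integral_normal_density[OF assms] integrable_normal_density[OF assms]
  by (subst nn_integral_eq_integral) auto

lemma nn_integral_normal_density_variance:
  assumes "\<sigma> > 0"
  shows "(\<integral>\<^sup>+ t. ennreal (normal_density m \<sigma> t * (t - m)\<^sup>2) \<partial>lborel) = ennreal (\<sigma>\<^sup>2)"
  using normal_moment_even[OF assms, of m 1]
  by (subst nn_integral_eq_integral) (auto simp: has_bochner_integral_iff fact_2)

lemma nn_integral_gauss_dens:
  "v > 0 \<Longrightarrow> (\<integral>\<^sup>+ t. ennreal (gauss_dens m v t) \<partial>lborel) = 1"
  by (simp add: gauss_dens_eq_normal_density nn_integral_normal_density)

lemma nn_integral_gauss_dens_variance: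
  "v > 0 \<Longrightarrow> (\<integral>\<^sup>+ t. ennreal (gauss_dens m v t * (t - m)\<^sup>2) \<partial>lborel) = ennreal v"
  by (simp add: gauss_dens_eq_normal_density nn_integral_normal_density_variance)

lemma ldens_pos: "s \<noteq> 0 \<Longrightarrow> 0 < ldens f s y x"
  by (simp add: ldens_def)

lemma ldens_nonneg: "0 \<le> ldens f s y x"
  by (simp add: ldens_def)

lemma ldens_measurable [measurable (raw)]:
  assumes [measurable]: "(\<lambda>w. F w (X w)) \<in> borel_measurable M" "S \<in> borel_measurable M" "Y \<in> borel_measurable M"
  shows "(\<lambda>w. ldens (F w) (S w) (Y w) (X w)) \<in> borel_measurable M"
  unfolding ldens_def by measurable

lemma gidx_less: "1 \<le> j \<Longrightarrow> j \<le> k \<Longrightarrow> h \<le> p \<Longrightarrow> gidx p k j h < Knum p k"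
proof -
  assume "1 \<le> j" "j \<le> k" "h \<le> p"
  then obtain i where i: "j = Suc i" "Suc i \<le> k" by (cases j) auto
  have "Suc i * (p + 1) \<le> k * (p + 1)" using i(2) by (rule mult_le_mono1)
  then show ?thesis using i \<open>h \<le> p\<close> by (simp add: gidx_def Knum_def algebra_simps)
qed

lemma psi_measurable [measurable]: "psi \<in> borel_measurable borel"
  unfolding psi_def[abs_def] by measurable

lemma sets_Xmeas [measurable_cong]: "sets (Xmeas p) = sets (PiM {..<p} (\<lambda>_. borel))"
  unfolding Xmeas_def by (intro sets_PiM_cong) auto

text \<open>Joint measurability in weights and covariates, which the Tonelli arguments over data and
  parameters require.\<close>

lemma fnet_measurable [measurable (raw)]:
  assumes F: "F \<in> M \<rightarrow>\<^sub>M PiM {..<Knum p k} (\<lambda>_. lborel)" and G: "G \<in> M \<rightarrow>\<^sub>M Xmeas p"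
  shows "(\<lambda>w. fnet p k (F w) (G w)) \<in> borel_measurable M"
proof -
  have F': "(\<lambda>w. F w i) \<in> borel_measurable M" if "i < Knum p k" for i
    using measurable_compose[OF F measurable_component_singleton[of i]] that by simp
  have G': "(\<lambda>w. G w i) \<in> borel_measurable M" if "i < p" for i
  proof -
    have "G \<in> M \<rightarrow>\<^sub>M PiM {..<p} (\<lambda>_. borel)" using G by (simp cong: measurable_cong_sets add: sets_Xmeas)
    from measurable_compose[OF this measurable_component_singleton[of i]] that show ?thesis by simp
  qed
  have *: "j \<le> k \<Longrightarrow> j < Knum p k" for j by (simp add: Knum_def)
  have "(\<lambda>w. F w j * psi (F w (gidx p k j 0) + (\<Sum>h\<in>{1..p}. F w (gidx p k j h) * G w (h - 1)))) \<in> borel_measurable M"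
    if "j \<in> {1..k}" for j
  proof -
    have "(\<lambda>w. F w (gidx p k j 0) + (\<Sum>h\<in>{1..p}. F w (gidx p k j h) * G w (h - 1))) \<in> borel_measurable M"
      using that by (intro borel_measurable_add borel_measurable_sum borel_measurable_times F' G' gidx_less) auto
    from measurable_compose[OF this psi_measurable] show ?thesis
      using that * by (intro borel_measurable_times F') auto
  qed
  then show ?thesis unfolding fnet_def
    by (intro borel_measurable_add borel_measurable_sum F') (auto simp: Knum_def)
qed

section \<open>Parameter space and sampling model\<close>

lemma sigma_finite_PiM_lborel: "sigma_finite_measure (PiM {..<K::nat} (\<lambda>_. lborel :: real measure))"
proof -
  interpret finite_product_sigma_finite "\<lambda>_::nat. lborel :: real measure" "{..<K}" by standard simp
  show ?thesis by (rule sigma_finite_measure_axioms)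
qed

lemma sigma_finite_param_meas: "sigma_finite_measure (param_meas K)"
proof -
  interpret A: sigma_finite_measure "PiM {..<K} (\<lambda>_. lborel :: real measure)"
    by (rule sigma_finite_PiM_lborel)
  interpret pair_sigma_finite "PiM {..<K} (\<lambda>_. lborel :: real measure)" "lborel :: real measure" ..
  show ?thesis unfolding param_meas_def by (rule sigma_finite_measure_axioms)
qed

lemma fst_param_meas [measurable]: "fst \<in> param_meas K \<rightarrow>\<^sub>M PiM {..<K} (\<lambda>_. lborel)"
  and snd_param_meas [measurable]: "snd \<in> borel_measurable (param_meas K)"
  unfolding param_meas_def by simp_all

lemma param_coord_measurable [measurable (raw)]:
  assumes "F \<in> M \<rightarrow>\<^sub>M param_meas K" "i < K"
  shows "(\<lambda>w. fst (F w) i) \<in> borel_measurable M"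
  using measurable_compose[OF measurable_compose[OF assms(1) fst_param_meas] measurable_component_singleton[of i]] assms(2)
  by simp

lemma nn_integral_param_meas_prod:
  assumes [measurable]: "F \<in> borel_measurable borel" "\<And>i. i < K \<Longrightarrow> g i \<in> borel_measurable borel"
  shows "(\<integral>\<^sup>+ \<omega>. F (snd \<omega>) * (\<Prod>i<K. g i (fst \<omega> i)) \<partial>param_meas K)
    = (\<integral>\<^sup>+ s. F s \<partial>lborel) * (\<Prod>i<K. \<integral>\<^sup>+ t. g i t \<partial>lborel)"
proof -
  interpret P: product_sigma_finite "\<lambda>_::nat. lborel :: real measure" by standard
  interpret A: sigma_finite_measure "PiM {..<K} (\<lambda>_. lborel :: real measure)"
    by (rule sigma_finite_PiM_lborel)
  interpret pair_sigma_finite "PiM {..<K} (\<lambda>_. lborel :: real measure)" "lborel :: real measure" ..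
  have [measurable]: "(\<lambda>\<theta>. \<Prod>i<K. g i (\<theta> i)) \<in> borel_measurable (PiM {..<K} (\<lambda>_. lborel))"
    by (intro borel_measurable_prod_ennreal) (auto intro!: measurable_compose[OF measurable_component_singleton])
  have "(\<integral>\<^sup>+ \<omega>. F (snd \<omega>) * (\<Prod>i<K. g i (fst \<omega> i)) \<partial>param_meas K)
      = (\<integral>\<^sup>+ \<theta>. \<integral>\<^sup>+ s. F s * (\<Prod>i<K. g i (\<theta> i)) \<partial>lborel \<partial>PiM {..<K} (\<lambda>_. lborel))"
    unfolding param_meas_def by (subst lborel.nn_integral_fst[symmetric]) simp_all
  also have "\<dots> = (\<integral>\<^sup>+ \<theta>. (\<integral>\<^sup>+ s. F s \<partial>lborel) * (\<Prod>i<K. g i (\<theta> i)) \<partial>PiM {..<K} (\<lambda>_. lborel))"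
    by (intro nn_integral_cong) (subst nn_integral_multc, auto)
  also have "\<dots> = (\<integral>\<^sup>+ s. F s \<partial>lborel) * (\<integral>\<^sup>+ \<theta>. (\<Prod>i<K. g i (\<theta> i)) \<partial>PiM {..<K} (\<lambda>_. lborel))"
    by (subst nn_integral_cmult) auto
  also have "(\<integral>\<^sup>+ \<theta>. (\<Prod>i<K. g i (\<theta> i)) \<partial>PiM {..<K} (\<lambda>_. lborel)) = (\<Prod>i<K. \<integral>\<^sup>+ t. g i t \<partial>lborel)"
    using assms(2) by (subst P.product_nn_integral_prod) auto
  finally show ?thesis .
qed

lemma prob_space_Xmeas: "prob_space (Xmeas p)"
  unfolding Xmeas_def
  by (intro prob_space_PiM prob_space_uniform_measure) auto

text \<open>Each marginal is a uniform measure on the whole real line, so the unit cube has full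
  mass without being the space. The Lipschitz bound for networks holds only on the cube, hence the
  almost-everywhere statements here and below.\<close>

lemma AE_Xmeas: "AE x in Xmeas p. \<forall>h<p. 0 \<le> x h \<and> x h \<le> 1"
proof -
  have "AE x in Xmeas p. \<forall>h\<in>{..<p}. 0 \<le> x h \<and> x h \<le> 1"
    unfolding Xmeas_def
  proof (intro AE_finite_allI)
    fix h assume "h \<in> {..<p}"
    moreover have "AE x in uniform_measure lborel {0..1::real}. 0 \<le> x \<and> x \<le> 1"
      by (rule AE_uniform_measureI) auto
    ultimately show "AE x in PiM {..<p} (\<lambda>_. uniform_measure lborel {0..1::real}). 0 \<le> x h \<and> x h \<le> 1"
      by (intro AE_PiM_component[where P = "\<lambda>x. 0 \<le> x \<and> x \<le> 1"] prob_space_uniform_measure) auto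
  qed simp
  then show ?thesis by eventually_elim auto
qed

abbreviation "YX p \<equiv> (lborel :: real measure) \<Otimes>\<^sub>M Xmeas p"

lemma sigma_finite_YX: "sigma_finite_measure (YX p)"
proof -
  interpret X: prob_space "Xmeas p" by (rule prob_space_Xmeas)
  interpret pair_sigma_finite "lborel :: real measure" "Xmeas p" ..
  show ?thesis by (rule sigma_finite_measure_axioms)
qed

lemma nn_integral_YX_snd:
  assumes [measurable]: "h \<in> borel_measurable (YX p)"
  shows "(\<integral>\<^sup>+ z. h z \<partial>YX p) = (\<integral>\<^sup>+ x. \<integral>\<^sup>+ y. h (y, x) \<partial>lborel \<partial>Xmeas p)"
proof -
  interpret X: prob_space "Xmeas p" by (rule prob_space_Xmeas)
  interpret pair_sigma_finite "lborel :: real measure" "Xmeas p" ..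
  show ?thesis by (subst nn_integral_snd[symmetric]) auto
qed

lemma nn_integral_ldens:
  assumes [measurable]: "f \<in> borel_measurable (Xmeas p)" and s: "s > 0"
  shows "(\<integral>\<^sup>+ z. ennreal (ldens f s (fst z) (snd z)) \<partial>YX p) = 1"
proof -
  interpret X: prob_space "Xmeas p" by (rule prob_space_Xmeas)
  have "(\<integral>\<^sup>+ z. ennreal (ldens f s (fst z) (snd z)) \<partial>YX p)
      = (\<integral>\<^sup>+ x. \<integral>\<^sup>+ y. ennreal (ldens f s y x) \<partial>lborel \<partial>Xmeas p)"
    by (subst nn_integral_YX_snd) simp_all
  then show ?thesis using s
    by (simp add: ldens_eq_normal_density nn_integral_normal_density X.emeasure_space_1)
qed

lemma AE_YX: "AE z in YX p. \<forall>h<p. 0 \<le> snd z h \<and> snd z h \<le> 1"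
proof -
  interpret X: prob_space "Xmeas p" by (rule prob_space_Xmeas)
  interpret pair_sigma_finite "lborel :: real measure" "Xmeas p" ..
  have meas: "(\<lambda>z. snd z h) \<in> borel_measurable (YX p)" if "h < p" for h
  proof -
    have "snd \<in> YX p \<rightarrow>\<^sub>M PiM {..<p} (\<lambda>_. borel)"
      using measurable_snd[of lborel "Xmeas p"] by (simp cong: measurable_cong_sets add: sets_Xmeas)
    from measurable_compose[OF this measurable_component_singleton[of h]] that show ?thesis by simp
  qed
  have *: "{z \<in> space (YX p). \<forall>h\<in>{..<p}. 0 \<le> snd z h \<and> snd z h \<le> 1} \<in> sets (YX p)"
  proof (intro sets.sets_Collect_finite_All)
    fix h assume "h \<in> {..<p}"
    then have "(\<lambda>z. snd z h) -` {0..1} \<inter> space (YX p) \<in> sets (YX p)"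
      by (intro measurable_sets[OF meas]) auto
    also have "(\<lambda>z. snd z h) -` {0..1} \<inter> space (YX p) = {z \<in> space (YX p). 0 \<le> snd z h \<and> snd z h \<le> 1}"
      by auto
    finally show "{z \<in> space (YX p). 0 \<le> snd z h \<and> snd z h \<le> 1} \<in> sets (YX p)" .
  qed simp
  have "AE y in lborel. AE x in Xmeas p. \<forall>h<p. 0 \<le> x h \<and> x h \<le> 1"
    using AE_Xmeas by simp
  moreover have "{z \<in> space (YX p). \<forall>h<p. 0 \<le> snd z h \<and> snd z h \<le> 1} \<in> sets (YX p)"
    using * by (simp only: Ball_def lessThan_iff)
  ultimately show ?thesis
    by (intro AE_pair_measure) (simp_all only: snd_conv)
qed

section \<open>The true observation law and its n-fold product\<close>

locale regression =
  fixes p :: nat and f0 :: "(nat \<Rightarrow> real) \<Rightarrow> real" and \<sigma>0 :: real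
  assumes f0_measurable [measurable]: "f0 \<in> borel_measurable (Xmeas p)"
    and sigma0_pos: "\<sigma>0 > 0"
begin

definition l0 :: "real \<times> (nat \<Rightarrow> real) \<Rightarrow> real" where
  "l0 z = ldens f0 (\<sigma>0\<^sup>2) (fst z) (snd z)"

lemma l0_pos: "0 < l0 z"
  using sigma0_pos by (simp add: l0_def ldens_pos)

lemma l0_measurable [measurable]: "l0 \<in> borel_measurable (YX p)"
  unfolding l0_def by measurable

abbreviation "obs \<equiv> obs_meas p f0 \<sigma>0"

lemma obs_eq: "obs = density (YX p) (\<lambda>z. ennreal (l0 z))"
  unfolding obs_meas_def l0_def by (simp add: case_prod_unfold)

lemma sets_obs [measurable_cong]: "sets obs = sets (YX p)"
  by (simp add: obs_eq)

lemma nn_integral_l0: "(\<integral>\<^sup>+ z. ennreal (l0 z) \<partial>YX p) = 1"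
  unfolding l0_def using sigma0_pos by (intro nn_integral_ldens) auto

lemma prob_space_obs: "prob_space obs"
proof (rule prob_spaceI)
  have "emeasure obs (space obs) = (\<integral>\<^sup>+ z. 1 \<partial>density (YX p) (\<lambda>z. ennreal (l0 z)))"
    by (simp add: obs_eq)
  also have "\<dots> = (\<integral>\<^sup>+ z. ennreal (l0 z) * 1 \<partial>YX p)"
    by (rule nn_integral_density) measurable
  finally show "emeasure obs (space obs) = 1" by (simp add: nn_integral_l0)
qed

lemma nn_integral_obs:
  assumes [measurable]: "h \<in> borel_measurable (YX p)"
  shows "(\<integral>\<^sup>+ z. h z \<partial>obs) = (\<integral>\<^sup>+ z. ennreal (l0 z) * h z \<partial>YX p)"
  unfolding obs_eq by (rule nn_integral_density) auto

text \<open>Change of measure. Equality holds because \<open>l0\<close> is positive everywhere, so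
  no mass is lost where the true density vanishes.\<close>

lemma nn_integral_obs_ratio:
  assumes [measurable]: "h \<in> borel_measurable (YX p)" and h: "\<And>z. 0 \<le> h z"
  shows "(\<integral>\<^sup>+ z. ennreal (h z / l0 z) \<partial>obs) = (\<integral>\<^sup>+ z. ennreal (h z) \<partial>YX p)"
proof -
  have "ennreal (l0 z) * ennreal (h z / l0 z) = ennreal (h z)" for z
    using l0_pos[of z] h[of z] by (subst ennreal_mult[symmetric]) auto
  then show ?thesis by (simp add: nn_integral_obs)
qed

lemma AE_obs: "AE z in obs. \<forall>h<p. 0 \<le> snd z h \<and> snd z h \<le> 1"
  unfolding obs_eq by (subst AE_density) (use AE_YX[of p] in auto)

abbreviation "P0 n \<equiv> P0n p f0 \<sigma>0 n"

lemma sets_P0 [measurable_cong]: "sets (P0 n) = sets (PiM {..<n} (\<lambda>_. YX p))"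
  unfolding P0n_def by (intro sets_PiM_cong) (auto simp: sets_obs)

lemma prob_space_P0: "prob_space (P0 n)"
  unfolding P0n_def by (intro prob_space_PiM prob_space_obs)

lemma P0_coord_measurable [measurable (raw)]:
  assumes F: "F \<in> M \<rightarrow>\<^sub>M P0 n" and "i < n"
  shows "(\<lambda>w. F w i) \<in> M \<rightarrow>\<^sub>M YX p"
proof -
  have "F \<in> M \<rightarrow>\<^sub>M PiM {..<n} (\<lambda>_. YX p)" using F by (simp cong: measurable_cong_sets add: sets_P0)
  from measurable_compose[OF this measurable_component_singleton[of i]] \<open>i < n\<close> show ?thesis by simp
qed

lemma nn_integral_P0_prod:
  assumes "h \<in> borel_measurable (YX p)"
  shows "(\<integral>\<^sup>+ D. (\<Prod>i<n. h (D i)) \<partial>P0 n) = (\<integral>\<^sup>+ z. h z \<partial>obs) ^ n"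
proof -
  interpret O: prob_space obs by (rule prob_space_obs)
  interpret P: product_sigma_finite "\<lambda>_::nat. obs" by standard
  have "h \<in> borel_measurable obs" using assms by (simp cong: measurable_cong_sets add: sets_obs)
  then show ?thesis unfolding P0n_def by (subst P.product_nn_integral_prod) auto
qed

lemma nn_integral_P0_coord:
  assumes "h \<in> borel_measurable (YX p)" and "i < n"
  shows "(\<integral>\<^sup>+ D. h (D i) \<partial>P0 n) = (\<integral>\<^sup>+ z. h z \<partial>obs)"
proof -
  have h: "h \<in> borel_measurable obs" using assms by (simp cong: measurable_cong_sets add: sets_obs)
  have "distr (P0 n) obs (\<lambda>D. D i) = obs"
    unfolding P0n_def using assms(2) prob_space_obs by (intro distr_PiM_component) auto
  then have "(\<integral>\<^sup>+ z. h z \<partial>obs) = (\<integral>\<^sup>+ z. h z \<partial>distr (P0 n) obs (\<lambda>D. D i))" by simp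
  also have "\<dots> = (\<integral>\<^sup>+ D. h (D i) \<partial>P0 n)"
    by (rule nn_integral_distr) (use h assms(2) in \<open>auto simp: P0n_def\<close>)
  finally show ?thesis ..
qed

lemma AE_P0: "AE D in P0 n. \<forall>i<n. \<forall>h<p. 0 \<le> snd (D i) h \<and> snd (D i) h \<le> 1"
proof -
  have "AE D in P0 n. \<forall>i\<in>{..<n}. \<forall>h<p. 0 \<le> snd (D i) h \<and> snd (D i) h \<le> 1"
    unfolding P0n_def using AE_obs
    by (intro AE_finite_allI AE_PiM_component[where P = "\<lambda>z. \<forall>h<p. 0 \<le> snd z h \<and> snd z h \<le> 1"] prob_space_obs) auto
  then show ?thesis by eventually_elim auto
qed

end

section \<open>Outer measure and divergence inequalities\<close>

lemma outer_meas_le: "B \<in> sets M \<Longrightarrow> A \<subseteq> B \<Longrightarrow> outer_meas M A \<le> measure M B"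
  unfolding outer_meas_def by (intro cInf_lower) (auto intro!: bdd_belowI[of _ 0])

lemma outer_meas_nonneg: "A \<subseteq> space M \<Longrightarrow> 0 \<le> outer_meas M A"
  unfolding outer_meas_def by (intro cInf_greatest) auto

text \<open>The covering set is \<open>E\<close> enlarged by a null set. This bridges two features
  of the theorem: the minimiser is an arbitrary function of the data, not assumed measurable, and it
  is specified only almost surely.\<close>

lemma (in finite_measure) outer_meas_le_AE:
  assumes E: "E \<in> sets M" and A: "A \<subseteq> space M" and AE: "AE x in M. x \<in> A \<longrightarrow> x \<in> E"
  shows "outer_meas M A \<le> measure M E"
proof -
  obtain N where N: "{x \<in> space M. \<not> (x \<in> A \<longrightarrow> x \<in> E)} \<subseteq> N" "emeasure M N = 0" "N \<in> sets M"
    using AE by (rule AE_E)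
  have "outer_meas M A \<le> measure M (E \<union> N)"
    using N A E by (intro outer_meas_le) auto
  also have "\<dots> \<le> measure M E + measure M N"
    using N(3) E by (intro measure_Un_le) auto
  finally show ?thesis using N(2) by (simp add: measure_def)
qed

lemma (in finite_measure) measure_Markov_nn:
  assumes [measurable]: "X \<in> borel_measurable M" and le: "(\<integral>\<^sup>+ x. X x \<partial>M) \<le> ennreal c"
    and t: "t > 0" and c: "c \<ge> 0"
  shows "measure M {x \<in> space M. ennreal t \<le> X x} \<le> c / t"
proof -
  have "{x \<in> space M. ennreal t \<le> X x} \<subseteq> {x \<in> space M. 1 \<le> ennreal (1 / t) * X x}"
  proof safe
    fix x assume "ennreal t \<le> X x"
    then have "ennreal (1 / t) * ennreal t \<le> ennreal (1 / t) * X x" by (intro mult_left_mono) auto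
    then show "1 \<le> ennreal (1 / t) * X x" using t by (simp add: ennreal_mult[symmetric])
  qed
  then have "emeasure M {x \<in> space M. ennreal t \<le> X x} \<le> emeasure M {x \<in> space M. 1 \<le> ennreal (1 / t) * X x}"
    by (intro emeasure_mono) auto
  also have "\<dots> \<le> ennreal (1 / t) * (\<integral>\<^sup>+ x. X x * indicator (space M) x \<partial>M)"
    by (intro nn_integral_Markov_inequality) auto
  also have "(\<integral>\<^sup>+ x. X x * indicator (space M) x \<partial>M) = (\<integral>\<^sup>+ x. X x \<partial>M)"
    by (intro nn_integral_cong) auto
  also have "ennreal (1 / t) * (\<integral>\<^sup>+ x. X x \<partial>M) \<le> ennreal (1 / t) * ennreal c"
    by (intro mult_left_mono le) auto
  also have "\<dots> = ennreal (c / t)" using t c by (simp add: ennreal_mult[symmetric])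
  finally show ?thesis using t c by (simp add: emeasure_eq_measure)
qed

lemma kl_integrand_measurable [measurable (raw)]:
  assumes [measurable]: "f \<in> borel_measurable M" "g \<in> borel_measurable M"
  shows "(\<lambda>w. kl_integrand (f w) (g w)) \<in> borel_measurable M"
  unfolding kl_integrand_def by measurable

lemma kl_nonneg:
  fixes a b :: real assumes "a > 0" "b > 0"
  shows "0 \<le> a * ln (a / b) - a + b"
proof -
  have "ln (b / a) \<le> b / a - 1" using assms by (intro ln_le_minus_one) auto
  moreover have "ln (b / a) = - ln (a / b)" using assms by (simp add: ln_div)
  ultimately have "a * (1 - ln (a / b)) \<le> a * (b / a)" using assms by (intro mult_left_mono) auto
  then show ?thesis using assms by (simp add: algebra_simps)
qed

text \<open>\<open>kl_nonneg\<close> with \<open>b * exp T\<close> in place of \<open>b\<close>; a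
  term \<open>- b\<close> is dropped on the way. The correction \<open>- a + b\<close> inside
  \<open>kl_integrand\<close> is what makes this hold pointwise, without normalisation of either
  density.\<close>

lemma kl_integrand_Young:
  assumes "a \<ge> 0" "b \<ge> 0"
  shows "ennreal (a * T) \<le> kl_integrand a b + ennreal (b * exp T)"
proof (cases "a > 0 \<and> b > 0")
  case True
  have "0 \<le> a * ln (a / (b * exp T)) - a + b * exp T" using True by (intro kl_nonneg) auto
  moreover have "ln (a / (b * exp T)) = ln (a / b) - T" using True by (simp add: ln_div ln_mult)
  ultimately have "a * T \<le> (a * ln (a / b) - a + b) + b * exp T"
    using True by (simp add: algebra_simps)
  then have "ennreal (a * T) \<le> ennreal ((a * ln (a / b) - a + b) + b * exp T)" by (rule ennreal_leI)
  also have "\<dots> = kl_integrand a b + ennreal (b * exp T)"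
    using True kl_nonneg[of a b] by (simp add: kl_integrand_def ennreal_plus)
  finally show ?thesis .
next
  case False
  then show ?thesis
    using assms by (cases "a > 0") (auto simp: kl_integrand_def ennreal_neg mult_le_0_iff not_less)
qed

text \<open>Young's inequality is used on \<open>U\<close> only. Outside \<open>U\<close> the
  divergence integrand is nonnegative, so the exponential factor meets only the
  \<open>\<pi>\<close>-mass of \<open>U\<close>.\<close>

lemma dKL_Gibbs:
  assumes [measurable]: "q \<in> borel_measurable M" "\<pi> \<in> borel_measurable M" "U \<in> sets M"
    and pi: "\<And>w. 0 \<le> \<pi> w" and q: "\<And>w. 0 \<le> q w" and T: "T \<ge> 0"
  shows "ennreal T * emeasure (density M q) U
    \<le> dKL M q \<pi> + ennreal (exp T) * (\<integral>\<^sup>+ w. ennreal (\<pi> w) * indicator U w \<partial>M)"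
proof -
  have "ennreal T * emeasure (density M q) U = (\<integral>\<^sup>+ w. ennreal T * (ennreal (q w) * indicator U w) \<partial>M)"
    by (simp add: emeasure_density nn_integral_cmult)
  also have "\<dots> \<le> (\<integral>\<^sup>+ w. kl_integrand (q w) (\<pi> w) + ennreal (exp T) * (ennreal (\<pi> w) * indicator U w) \<partial>M)"
  proof (intro nn_integral_mono)
    fix w
    have "ennreal T * ennreal (q w) = ennreal (q w * T)"
      using q T by (simp add: ennreal_mult mult.commute)
    moreover have "ennreal (exp T) * ennreal (\<pi> w) = ennreal (\<pi> w * exp T)"
      using pi by (simp add: ennreal_mult mult.commute)
    ultimately show "ennreal T * (ennreal (q w) * indicator U w)
      \<le> kl_integrand (q w) (\<pi> w) + ennreal (exp T) * (ennreal (\<pi> w) * indicator U w)"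
      using kl_integrand_Young[OF q pi, of w T w] by (auto split: split_indicator)
  qed
  also have "\<dots> = dKL M q \<pi> + ennreal (exp T) * (\<integral>\<^sup>+ w. ennreal (\<pi> w) * indicator U w \<partial>M)"
    by (simp add: nn_integral_add nn_integral_cmult dKL_def)
  finally show ?thesis .
qed

text \<open>Replaces the log ratio by a majorant \<open>P\<close> with known mean. The by-product
  \<open>0 \<le> EP\<close> matters as much as the bound: it later limits how negative the log
  evidence can be.\<close>

lemma dKL_upper:
  assumes [measurable]: "q \<in> borel_measurable M" "\<pi> \<in> borel_measurable M"
    and pi: "\<And>w. 0 \<le> \<pi> w" "(\<integral>\<^sup>+ w. ennreal (\<pi> w) \<partial>M) \<le> 1"
    and q: "\<And>w. 0 \<le> q w" "has_bochner_integral M q 1"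
    and P: "has_bochner_integral M (\<lambda>w. q w * P w) EP"
    and bound: "\<And>w. w \<in> space M \<Longrightarrow> q w > 0 \<Longrightarrow> \<pi> w > 0 \<and> ln (q w / \<pi> w) \<le> P w"
  shows "0 \<le> EP \<and> dKL M q \<pi> \<le> ennreal EP"
proof -
  have pi_int: "integrable M \<pi>"
    using pi by (intro integrableI_nonneg) (auto simp: less_top[symmetric] top_unique)
  have "ennreal (integral\<^sup>L M \<pi>) \<le> 1"
    using pi pi_int by (subst nn_integral_eq_integral[symmetric]) auto
  then have pi_le: "integral\<^sup>L M \<pi> \<le> 1" by (simp flip: ennreal_1)
  \<comment> \<open>The corrections \<open>- q + \<pi>\<close> have integral at most zero, so they
    do not raise the bound above \<open>EP\<close>.\<close>
  define G where "G = (\<lambda>w. q w * P w - q w + \<pi> w)"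
  have G: "integrable M G" "integral\<^sup>L M G = EP - 1 + integral\<^sup>L M \<pi>"
    using P q pi_int unfolding G_def has_bochner_integral_iff by auto
  have kl: "kl_integrand (q w) (\<pi> w) \<le> ennreal (G w) \<and> 0 \<le> G w" if w: "w \<in> space M" for w
  proof (cases "q w > 0")
    case True
    then have b: "\<pi> w > 0" "ln (q w / \<pi> w) \<le> P w" using bound w by auto
    then have "q w * ln (q w / \<pi> w) \<le> q w * P w" using True by (intro mult_left_mono) auto
    then have "q w * ln (q w / \<pi> w) - q w + \<pi> w \<le> G w" by (simp add: G_def)
    then show ?thesis using True b kl_nonneg[of "q w" "\<pi> w"]
      by (auto simp: kl_integrand_def intro: ennreal_leI)
  next
    case False
    then have "q w = 0" using q(1)[of w] by simp
    then show ?thesis using pi(1)[of w] by (simp add: kl_integrand_def G_def)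
  qed
  have "dKL M q \<pi> \<le> (\<integral>\<^sup>+ w. ennreal (G w) \<partial>M)"
    unfolding dKL_def using kl by (intro nn_integral_mono) auto
  also have "\<dots> = ennreal (integral\<^sup>L M G)"
    using kl by (intro nn_integral_eq_integral G AE_I2) auto
  also have "\<dots> \<le> ennreal EP" unfolding G using pi_le by (intro ennreal_leI) auto
  finally have "dKL M q \<pi> \<le> ennreal EP" .
  moreover have "0 \<le> integral\<^sup>L M G" using kl by (intro integral_nonneg_AE AE_I2) auto
  then have "0 \<le> EP" unfolding G using pi_le by auto
  ultimately show ?thesis by simp
qed

section \<open>Lipschitz bound for networks and product densities\<close>

lemma psi_bounds: "0 \<le> psi u" "psi u \<le> 1"
  using add_pos_pos[OF zero_less_one exp_gt_zero[of "- u"]] by (simp_all add: psi_def)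

text \<open>The difference equals \<open>psi u * psi v * (exp (- v) - exp (- u))\<close>. The crude
  constant 1 is enough, since only the polynomial growth in \<open>n\<close> of the network's
  Lipschitz constant matters later.\<close>

lemma psi_Lipschitz: "\<bar>psi u - psi v\<bar> \<le> \<bar>u - v\<bar>"
proof -
  have *: "psi v \<le> psi u \<and> psi u - psi v \<le> u - v" if "v \<le> u" for u v
  proof -
    have "exp (- u) \<le> exp (- v)" using that by simp
    then have mono: "psi v \<le> psi u"
      unfolding psi_def by (intro frac_le) (auto intro: add_pos_pos)
    have "psi u - psi v = psi u * (psi v * (exp (- v) - exp (- u)))"
      using add_pos_pos[OF zero_less_one exp_gt_zero[of "- u"]] add_pos_pos[OF zero_less_one exp_gt_zero[of "- v"]]
      by (simp add: psi_def divide_simps)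
    also have "\<dots> \<le> 1 * (psi v * (exp (- v) - exp (- u)))"
      using psi_bounds[of u] psi_bounds[of v] that by (intro mult_right_mono) auto
    also have "\<dots> = (psi v * exp (- v)) * (1 - exp (v - u))"
      by (simp add: exp_diff exp_minus field_simps)
    also have "\<dots> \<le> 1 * (1 - exp (v - u))"
      using that by (intro mult_right_mono) (auto simp: psi_def divide_simps add_pos_pos)
    also have "\<dots> \<le> u - v" using exp_ge_add_one_self[of "v - u"] by (simp add: algebra_simps)
    finally show ?thesis using mono by simp
  qed
  show ?thesis using *[of u v] *[of v u] by (cases "v \<le> u") auto
qed

text \<open>Each product is split so that an outer weight of \<open>\<theta>'\<close>, never of
  \<open>\<theta>\<close>, multiplies a difference of activations. Hence only one endpoint has to be
  bounded: the centre \<open>\<theta>0\<close> in the divergence bound, where the other endpoint is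
  Gaussian and unbounded, and the sieve point in the covering.\<close>

lemma fnet_Lipschitz:
  assumes x: "\<And>h. h < p \<Longrightarrow> 0 \<le> x h \<and> x h \<le> 1"
    and d: "\<And>i. i < Knum p k \<Longrightarrow> \<bar>\<theta> i - \<theta>' i\<bar> \<le> \<Delta>"
    and R: "\<And>i. i < Knum p k \<Longrightarrow> \<bar>\<theta>' i\<bar> \<le> R"
  shows "\<bar>fnet p k \<theta> x - fnet p k \<theta>' x\<bar> \<le> \<Delta> * (1 + real k + real k * R * (real p + 1))"
proof -
  let ?d = "\<lambda>j h. \<theta> (gidx p k j h) - \<theta>' (gidx p k j h)"
  have K: "0 < Knum p k" "\<And>j. j \<le> k \<Longrightarrow> j < Knum p k" by (auto simp: Knum_def)
  have D0: "0 \<le> \<Delta>" using d[OF K(1)] by linarith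
  have R0: "0 \<le> R" using R[OF K(1)] by linarith
  define u where "u = (\<lambda>\<theta>::nat \<Rightarrow> real. \<lambda>j. \<theta> (gidx p k j 0) + (\<Sum>h\<in>{1..p}. \<theta> (gidx p k j h) * x (h - 1)))"
  have fnet_u: "fnet p k \<theta> x = \<theta> 0 + (\<Sum>j\<in>{1..k}. \<theta> j * psi (u \<theta> j))" for \<theta>
    by (simp add: fnet_def u_def)
  have u: "\<bar>u \<theta> j - u \<theta>' j\<bar> \<le> \<Delta> * (p + 1)" if j: "j \<in> {1..k}" for j
  proof -
    have "\<bar>u \<theta> j - u \<theta>' j\<bar> = \<bar>(?d j 0)
        + (\<Sum>h\<in>{1..p}. (?d j h) * x (h - 1))\<bar>"
      by (simp add: u_def sum_subtractf left_diff_distrib)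
    also have "\<dots> \<le> \<bar>?d j 0\<bar>
        + (\<Sum>h\<in>{1..p}. \<bar>(?d j h) * x (h - 1)\<bar>)"
      by (intro order_trans[OF abs_triangle_ineq] add_left_mono sum_abs)
    also have "\<dots> \<le> \<Delta> + (\<Sum>h\<in>{1..p}. \<Delta>)"
    proof (rule add_mono[OF _ sum_mono])
      show "\<bar>?d j 0\<bar> \<le> \<Delta>"
        by (rule d, rule gidx_less) (use j in auto)
      fix h assume h: "h \<in> {1..p}"
      have "\<bar>?d j h\<bar> \<le> \<Delta>"
        by (rule d, rule gidx_less) (use j h in auto)
      moreover have "\<bar>x (h - 1)\<bar> \<le> 1" using h x[of "h - 1"] by auto
      ultimately have "\<bar>?d j h\<bar> * \<bar>x (h - 1)\<bar> \<le> \<Delta> * 1"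
        using D0 by (rule mult_mono) simp
      then show "\<bar>(?d j h) * x (h - 1)\<bar> \<le> \<Delta>"
        by (simp add: abs_mult)
    qed
    finally show ?thesis by (simp add: algebra_simps)
  qed
  have "\<bar>fnet p k \<theta> x - fnet p k \<theta>' x\<bar>
    = \<bar>(\<theta> 0 - \<theta>' 0) + (\<Sum>j\<in>{1..k}. (\<theta> j - \<theta>' j) * psi (u \<theta> j) + \<theta>' j * (psi (u \<theta> j) - psi (u \<theta>' j)))\<bar>"
  proof -
    have "(\<theta> j - \<theta>' j) * psi (u \<theta> j) + \<theta>' j * (psi (u \<theta> j) - psi (u \<theta>' j))
        = \<theta> j * psi (u \<theta> j) - \<theta>' j * psi (u \<theta>' j)" for j
      by (simp add: algebra_simps)
    then show ?thesis unfolding fnet_u by (simp add: sum_subtractf)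
  qed
  also have "\<dots> \<le> \<bar>\<theta> 0 - \<theta>' 0\<bar>
    + (\<Sum>j\<in>{1..k}. \<bar>(\<theta> j - \<theta>' j) * psi (u \<theta> j) + \<theta>' j * (psi (u \<theta> j) - psi (u \<theta>' j))\<bar>)"
    by (intro order_trans[OF abs_triangle_ineq] add_left_mono sum_abs)
  also have "\<dots> \<le> \<Delta> + (\<Sum>j\<in>{1..k}. \<Delta> + R * (\<Delta> * (p + 1)))"
  proof (rule add_mono[OF _ sum_mono])
    show "\<bar>\<theta> 0 - \<theta>' 0\<bar> \<le> \<Delta>" by (rule d[OF K(1)])
    fix j assume j: "j \<in> {1..k}"
    then have jK: "j < Knum p k" using K(2) by simp
    have "\<bar>\<theta> j - \<theta>' j\<bar> * \<bar>psi (u \<theta> j)\<bar> \<le> \<Delta> * 1"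
      using psi_bounds[of "u \<theta> j"] by (intro mult_mono d[OF jK] D0) simp_all
    moreover have "\<bar>\<theta>' j\<bar> * \<bar>psi (u \<theta> j) - psi (u \<theta>' j)\<bar> \<le> R * (\<Delta> * (p + 1))"
      by (intro mult_mono R[OF jK] R0 order_trans[OF psi_Lipschitz u[OF j]]) simp
    ultimately show "\<bar>(\<theta> j - \<theta>' j) * psi (u \<theta> j) + \<theta>' j * (psi (u \<theta> j) - psi (u \<theta>' j))\<bar>
        \<le> \<Delta> + R * (\<Delta> * (p + 1))"
      by (intro order_trans[OF abs_triangle_ineq]) (simp add: abs_mult)
  qed
  also have "\<dots> = \<Delta> * (1 + real k + real k * R * (real p + 1))" by (simp add: algebra_simps)
  finally show ?thesis by simp
qed

text \<open>Networks with fixed weights are bounded, which makes the approximation error square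
  integrable.\<close>

lemma abs_fnet_le:
  "\<bar>fnet p k \<theta> x\<bar> \<le> \<bar>\<theta> 0\<bar> + (\<Sum>j\<in>{1..k}. \<bar>\<theta> j\<bar>)"
  unfolding fnet_def
proof (intro order_trans[OF abs_triangle_ineq] add_left_mono order_trans[OF sum_abs] sum_mono)
  fix j
  have "\<bar>\<theta> j\<bar> * \<bar>psi u\<bar> \<le> \<bar>\<theta> j\<bar> * 1" for u
    using psi_bounds[of u] by (intro mult_left_mono) auto
  then show "\<bar>\<theta> j * psi (\<theta> (gidx p k j 0) + (\<Sum>h = 1..p. \<theta> (gidx p k j h) * x (h - 1)))\<bar> \<le> \<bar>\<theta> j\<bar>"
    by (simp add: abs_mult)
qed

text \<open>The prior is itself a member of the variational family, so every fact about
  \<open>vdens\<close> also serves the prior.\<close>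

lemma prior_dens_eq_vdens: "prior_dens \<alpha> lam \<zeta> K = vdens K (\<alpha>, lam, (\<lambda>_. 0), (\<lambda>_. \<zeta>))"
  by (rule ext) (simp add: prior_dens_def vdens_def)

lemma vdens_measurable [measurable]: "vdens K v \<in> borel_measurable (param_meas K)"
proof (cases v)
  case (fields a b m s)
  have *: "(\<lambda>\<omega>. gauss_dens (m i) ((s i)\<^sup>2) (fst \<omega> i)) \<in> borel_measurable (param_meas K)" if "i < K" for i
    using that by (intro measurable_compose[OF _ gauss_dens_measurable] param_coord_measurable) auto
  moreover have "(\<lambda>\<omega>. invgamma_dens a b (snd \<omega>)) \<in> borel_measurable (param_meas K)"
    by (intro measurable_compose[OF _ invgamma_dens_measurable] snd_param_meas)
  ultimately show ?thesis unfolding fields vdens_def prod.case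
    by (intro borel_measurable_times borel_measurable_prod *) auto
qed

lemma vdens_nonneg: "vvalid K v \<Longrightarrow> 0 \<le> vdens K v \<omega>"
  by (cases v) (auto simp: vvalid_def vdens_def intro!: mult_nonneg_nonneg prod_nonneg invgamma_dens_nonneg gauss_dens_nonneg)

lemma vdens_pos_iff: "vvalid K v \<Longrightarrow> 0 < vdens K v \<omega> \<longleftrightarrow> 0 < snd \<omega>"
proof (cases v)
  case (fields a b m s)
  assume v: "vvalid K v"
  have "0 < (\<Prod>i<K. gauss_dens (m i) ((s i)\<^sup>2) (fst \<omega> i))"
    using v by (intro prod_pos) (auto simp: vvalid_def fields intro!: gauss_dens_pos)
  then show ?thesis using v invgamma_dens_pos[of a b "snd \<omega>"]
    by (cases "snd \<omega> > 0") (auto simp: vvalid_def vdens_def fields invgamma_dens_def)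
qed

lemma nn_integral_vdens_prod:
  assumes v: "vvalid K (a, b, m, s)"
    and [measurable]: "F \<in> borel_measurable borel" "\<And>i. i < K \<Longrightarrow> g i \<in> borel_measurable borel"
  shows "(\<integral>\<^sup>+ \<omega>. ennreal (vdens K (a, b, m, s) \<omega>) * (F (snd \<omega>) * (\<Prod>i<K. g i (fst \<omega> i))) \<partial>param_meas K)
    = (\<integral>\<^sup>+ x. ennreal (invgamma_dens a b x) * F x \<partial>lborel)
      * (\<Prod>i<K. \<integral>\<^sup>+ t. ennreal (gauss_dens (m i) ((s i)\<^sup>2) t) * g i t \<partial>lborel)"
proof -
  have "ennreal (vdens K (a, b, m, s) \<omega>) * (F (snd \<omega>) * (\<Prod>i<K. g i (fst \<omega> i)))
    = (ennreal (invgamma_dens a b (snd \<omega>)) * F (snd \<omega>))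
      * (\<Prod>i<K. ennreal (gauss_dens (m i) ((s i)\<^sup>2) (fst \<omega> i)) * g i (fst \<omega> i))" for \<omega>
  proof -
    have "ennreal (vdens K (a, b, m, s) \<omega>) = ennreal (invgamma_dens a b (snd \<omega>))
        * (\<Prod>i<K. ennreal (gauss_dens (m i) ((s i)\<^sup>2) (fst \<omega> i)))"
      using v unfolding vdens_def vvalid_def
      by (simp add: ennreal_mult invgamma_dens_nonneg prod_nonneg gauss_dens_nonneg prod_ennreal)
    then show ?thesis by (simp add: prod.distrib mult_ac)
  qed
  then show ?thesis
    by (simp, subst nn_integral_param_meas_prod) auto
qed

lemma nn_integral_vdens_coord:
  assumes v: "vvalid K (a, b, m, s)" and j: "j < K"
    and [measurable]: "F \<in> borel_measurable borel" "g \<in> borel_measurable borel"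
  shows "(\<integral>\<^sup>+ \<omega>. ennreal (vdens K (a, b, m, s) \<omega>) * (F (snd \<omega>) * g (fst \<omega> j)) \<partial>param_meas K)
    = (\<integral>\<^sup>+ x. ennreal (invgamma_dens a b x) * F x \<partial>lborel)
      * (\<integral>\<^sup>+ t. ennreal (gauss_dens (m j) ((s j)\<^sup>2) t) * g t \<partial>lborel)"
proof -
  have "(\<Prod>i<K. if i = j then g (fst \<omega> i) else 1) = g (fst \<omega> j)" for \<omega> :: "(nat \<Rightarrow> real) \<times> real"
    using j by (simp add: prod.delta)
  moreover have "(\<Prod>i<K. \<integral>\<^sup>+ t. ennreal (gauss_dens (m i) ((s i)\<^sup>2) t) * (if i = j then g t else 1) \<partial>lborel)
     = (\<Prod>i<K. if i = j then \<integral>\<^sup>+ t. ennreal (gauss_dens (m i) ((s i)\<^sup>2) t) * g t \<partial>lborel else 1)"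
    using v by (intro prod.cong refl) (auto simp: vvalid_def nn_integral_gauss_dens)
  ultimately show ?thesis
    using nn_integral_vdens_prod[OF v, of F "\<lambda>i t. if i = j then g t else 1"] j
    by (simp add: prod.delta cong: if_cong)
qed

lemma nn_integral_vdens_scale:
  assumes v: "vvalid K (a, b, m, s)"
    and [measurable]: "F \<in> borel_measurable borel"
  shows "(\<integral>\<^sup>+ \<omega>. ennreal (vdens K (a, b, m, s) \<omega>) * F (snd \<omega>) \<partial>param_meas K)
    = (\<integral>\<^sup>+ x. ennreal (invgamma_dens a b x) * F x \<partial>lborel)"
proof -
  have "(\<Prod>i<K. \<integral>\<^sup>+ t. ennreal (gauss_dens (m i) ((s i)\<^sup>2) t) \<partial>lborel) = 1"
    using v by (intro prod.neutral) (auto simp: vvalid_def nn_integral_gauss_dens)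
  then show ?thesis using nn_integral_vdens_prod[OF v, of F "\<lambda>_ _. 1"] by simp
qed

lemma nn_integral_vdens:
  "vvalid K v \<Longrightarrow> (\<integral>\<^sup>+ \<omega>. ennreal (vdens K v \<omega>) \<partial>param_meas K) = 1"
  using nn_integral_vdens_scale[of K _ _ _ _ "\<lambda>_. 1"]
  by (cases v) (auto simp: vvalid_def nn_integral_invgamma_dens)

section \<open>Moments and log ratios for the variational candidate\<close>

text \<open>A weight such as \<open>1 / s\<close> is negative at negative scales; its sign is
  constrained only where the density is positive.\<close>

lemma has_bochner_integral_vdens_weight:
  assumes v: "vvalid K v" and h: "h \<in> borel_measurable (param_meas K)" "\<And>\<omega>. 0 < snd \<omega> \<Longrightarrow> 0 \<le> h \<omega>"
    and int: "(\<integral>\<^sup>+ \<omega>. ennreal (vdens K v \<omega>) * ennreal (h \<omega>) \<partial>param_meas K) = ennreal c" "0 \<le> c"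
  shows "has_bochner_integral (param_meas K) (\<lambda>\<omega>. vdens K v \<omega> * h \<omega>) c"
proof (rule has_bochner_integral_nn_integral)
  have *: "0 \<le> vdens K v \<omega> * h \<omega> \<and> ennreal (vdens K v \<omega> * h \<omega>) = ennreal (vdens K v \<omega>) * ennreal (h \<omega>)" for \<omega>
    using vdens_nonneg[OF v, of \<omega>] vdens_pos_iff[OF v, of \<omega>] h(2)[of \<omega>]
    by (cases "snd \<omega> > 0") (simp_all add: ennreal_mult)
  show "(\<lambda>\<omega>. vdens K v \<omega> * h \<omega>) \<in> borel_measurable (param_meas K)"
    by (intro borel_measurable_times vdens_measurable h)
  show "AE \<omega> in param_meas K. 0 \<le> vdens K v \<omega> * h \<omega>" using * by simp
  show "(\<integral>\<^sup>+ \<omega>. ennreal (vdens K v \<omega> * h \<omega>) \<partial>param_meas K) = ennreal c" using * int by simp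
qed (rule int)

lemma ennreal_invgamma_mult:
  assumes "a > 0" "\<And>x. 0 < x \<Longrightarrow> 0 \<le> F x"
  shows "ennreal (invgamma_dens a b x) * ennreal (F x) = ennreal (invgamma_dens a b x * F x)"
proof (cases "x > 0")
  case True
  then show ?thesis using assms invgamma_dens_nonneg[of a b x] by (simp add: ennreal_mult)
qed (simp add: invgamma_dens_def)

lemma has_bochner_integral_vdens_coord:
  assumes v: "vvalid K (a, b, m, s)" and j: "j < K"
    and [measurable]: "F \<in> borel_measurable borel" "g \<in> borel_measurable borel"
    and F: "\<And>x. 0 < x \<Longrightarrow> 0 \<le> F x" "(\<integral>\<^sup>+ x. ennreal (invgamma_dens a b x * F x) \<partial>lborel) = ennreal c" "0 \<le> c"
    and g: "\<And>t. 0 \<le> g t" "(\<integral>\<^sup>+ t. ennreal (gauss_dens (m j) ((s j)\<^sup>2) t * g t) \<partial>lborel) = ennreal d" "0 \<le> d"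
  shows "has_bochner_integral (param_meas K) (\<lambda>\<omega>. vdens K (a, b, m, s) \<omega> * (F (snd \<omega>) * g (fst \<omega> j))) (c * d)"
proof (rule has_bochner_integral_vdens_weight[OF v])
  have a: "a > 0" using v by (simp add: vvalid_def)
  show "(\<lambda>\<omega>. F (snd \<omega>) * g (fst \<omega> j)) \<in> borel_measurable (param_meas K)"
    using j by measurable
  have "ennreal (gauss_dens (m j) ((s j)\<^sup>2) t) * ennreal (g t) = ennreal (gauss_dens (m j) ((s j)\<^sup>2) t * g t)" for t
    using g(1) gauss_dens_nonneg by (simp add: ennreal_mult)
  then show "(\<integral>\<^sup>+ \<omega>. ennreal (vdens K (a, b, m, s) \<omega>) * ennreal (F (snd \<omega>) * g (fst \<omega> j)) \<partial>param_meas K) = ennreal (c * d)"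
    using nn_integral_vdens_coord[OF v j, of "\<lambda>x. ennreal (F x)" "\<lambda>t. ennreal (g t)"] F g
    by (simp add: ennreal_mult'' ennreal_invgamma_mult[OF a])
qed (use F g in auto)

lemma has_bochner_integral_vdens_scale:
  assumes v: "vvalid K (a, b, m, s)"
    and [measurable]: "F \<in> borel_measurable borel"
    and F: "\<And>x. 0 < x \<Longrightarrow> 0 \<le> F x" "(\<integral>\<^sup>+ x. ennreal (invgamma_dens a b x * F x) \<partial>lborel) = ennreal c" "0 \<le> c"
  shows "has_bochner_integral (param_meas K) (\<lambda>\<omega>. vdens K (a, b, m, s) \<omega> * F (snd \<omega>)) c"
proof (rule has_bochner_integral_vdens_weight[OF v])
  have a: "a > 0" using v by (simp add: vvalid_def)
  show "(\<integral>\<^sup>+ \<omega>. ennreal (vdens K (a, b, m, s) \<omega>) * ennreal (F (snd \<omega>)) \<partial>param_meas K) = ennreal c"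
    using nn_integral_vdens_scale[OF v, of "\<lambda>x. ennreal (F x)"] F by (simp add: ennreal_invgamma_mult[OF a])
qed (use F in auto)

lemma has_bochner_integral_vdens:
  "vvalid K v \<Longrightarrow> has_bochner_integral (param_meas K) (vdens K v) 1"
  using nn_integral_vdens[of K v] vdens_nonneg[of K v]
  by (intro has_bochner_integral_nn_integral) auto

text \<open>The five functions \<open>1\<close>, \<open>s\<close>, \<open>1 / s\<close>,
  \<open>D2\<close> and \<open>D2 / s\<close> are all that occur in the majorant of the log ratio.
  Independence of scale and weights factorises the last mean.\<close>

lemma has_bochner_integral_vdens_poly:
  assumes v: "vvalid K (a + 1, b, m, \<lambda>_. t)" and a: "a > 0"
  defines "D2 \<equiv> \<lambda>\<omega>. \<Sum>i<K. (fst \<omega> i - m i)\<^sup>2"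
  shows "has_bochner_integral (param_meas K)
    (\<lambda>\<omega>. vdens K (a + 1, b, m, \<lambda>_. t) \<omega> *
       (c0 + c1 * snd \<omega> + c2 / snd \<omega> + c3 * D2 \<omega> + c4 * (D2 \<omega> / snd \<omega>)))
    (c0 + c1 * (b / a) + c2 * ((a + 1) / b) + c3 * (K * t\<^sup>2) + c4 * (K * t\<^sup>2 * ((a + 1) / b)))"
proof -
  let ?M = "param_meas K" and ?d = "\<lambda>\<omega> i. (fst \<omega> i - m i)\<^sup>2"
  let ?q = "vdens K (a + 1, b, m, \<lambda>_. t)"
  have b: "b > 0" using v by (simp add: vvalid_def)
  have t: "0 < t\<^sup>2" if "0 < K" using v that by (auto simp: vvalid_def)
  have ig: "(\<integral>\<^sup>+ x. ennreal (invgamma_dens (a + 1) b x * 1) \<partial>lborel) = ennreal 1"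
    "(\<integral>\<^sup>+ x. ennreal (invgamma_dens (a + 1) b x * x) \<partial>lborel) = ennreal (b / a)"
    "(\<integral>\<^sup>+ x. ennreal (invgamma_dens (a + 1) b x * (1 / x)) \<partial>lborel) = ennreal ((a + 1) / b)"
    using nn_integral_invgamma_dens[of "a + 1" b] nn_integral_invgamma_dens_mean[OF a b]
      nn_integral_invgamma_dens_inverse[of "a + 1" b] a b by simp_all
  have M0: "has_bochner_integral (?M) ?q 1"
    by (rule has_bochner_integral_vdens[OF v])
  have M1: "has_bochner_integral (?M) (\<lambda>\<omega>. ?q \<omega> * snd \<omega>) (b / a)"
    using a b by (intro has_bochner_integral_vdens_scale[OF v, of "\<lambda>x. x"] ig) auto
  have M2: "has_bochner_integral (?M) (\<lambda>\<omega>. ?q \<omega> * (1 / snd \<omega>)) ((a + 1) / b)"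
    using a b by (intro has_bochner_integral_vdens_scale[OF v, of "\<lambda>x. 1 / x"] ig) auto
  have M3: "has_bochner_integral (?M) (\<lambda>\<omega>. \<Sum>i<K. ?q \<omega> * (1 * ?d \<omega> i)) (\<Sum>i<K. 1 * t\<^sup>2)"
    using t by (intro has_bochner_integral_sum has_bochner_integral_vdens_coord[OF v, of _ "\<lambda>_. 1"] ig)
      (auto simp: nn_integral_gauss_dens_variance)
  have M4: "has_bochner_integral (?M) (\<lambda>\<omega>. \<Sum>i<K. ?q \<omega> * (1 / snd \<omega> * ?d \<omega> i))
      (\<Sum>i<K. (a + 1) / b * t\<^sup>2)"
    using t a b by (intro has_bochner_integral_sum has_bochner_integral_vdens_coord[OF v, of _ "\<lambda>x. 1 / x"] ig)
      (auto simp: nn_integral_gauss_dens_variance)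
  have "has_bochner_integral (?M)
    (\<lambda>\<omega>. c0 * ?q \<omega> + c1 * (?q \<omega> * snd \<omega>) + c2 * (?q \<omega> * (1 / snd \<omega>))
       + c3 * (\<Sum>i<K. ?q \<omega> * (1 * ?d \<omega> i)) + c4 * (\<Sum>i<K. ?q \<omega> * (1 / snd \<omega> * ?d \<omega> i)))
    (c0 * 1 + c1 * (b / a) + c2 * ((a + 1) / b) + c3 * (\<Sum>i<K. 1 * t\<^sup>2) + c4 * (\<Sum>i<K. (a + 1) / b * t\<^sup>2))"
    by (intro has_bochner_integral_add has_bochner_integral_mult_right M0 M1 M2 M3 M4)
  also have "(\<lambda>\<omega>. c0 * ?q \<omega> + c1 * (?q \<omega> * snd \<omega>) + c2 * (?q \<omega> * (1 / snd \<omega>))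
       + c3 * (\<Sum>i<K. ?q \<omega> * (1 * ?d \<omega> i)) + c4 * (\<Sum>i<K. ?q \<omega> * (1 / snd \<omega> * ?d \<omega> i)))
    = (\<lambda>\<omega>. ?q \<omega> * (c0 + c1 * snd \<omega> + c2 / snd \<omega> + c3 * D2 \<omega> + c4 * (D2 \<omega> / snd \<omega>)))"
  proof (rule ext)
    fix \<omega> :: "(nat \<Rightarrow> real) \<times> real"
    have "(\<Sum>i<K. ?q \<omega> * (1 * ?d \<omega> i)) = ?q \<omega> * D2 \<omega>"
      by (simp add: D2_def sum_distrib_left)
    moreover have "(\<Sum>i<K. ?q \<omega> * (1 / snd \<omega> * ?d \<omega> i)) = ?q \<omega> * (D2 \<omega> / snd \<omega>)"
      by (simp add: D2_def sum_distrib_left sum_divide_distrib)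
    ultimately show "c0 * ?q \<omega> + c1 * (?q \<omega> * snd \<omega>) + c2 * (?q \<omega> * (1 / snd \<omega>))
       + c3 * (\<Sum>i<K. ?q \<omega> * (1 * ?d \<omega> i)) + c4 * (\<Sum>i<K. ?q \<omega> * (1 / snd \<omega> * ?d \<omega> i))
      = ?q \<omega> * (c0 + c1 * snd \<omega> + c2 / snd \<omega> + c3 * D2 \<omega> + c4 * (D2 \<omega> / snd \<omega>))"
      by (simp only:) (simp add: algebra_simps)
  qed
  finally show ?thesis by (simp add: mult_ac)
qed

lemma ln_gauss_dens_ratio_le:
  assumes t: "t > 0" and \<zeta>: "\<zeta> > 0"
  shows "ln (gauss_dens m (t\<^sup>2) x / gauss_dens 0 (\<zeta>\<^sup>2) x) \<le> ln (\<zeta> / t) + (m\<^sup>2 + (x - m)\<^sup>2) / \<zeta>\<^sup>2"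
proof -
  have ln_gauss: "ln (gauss_dens m' (v\<^sup>2) x) = - ln (sqrt (2 * pi)) - ln v - (x - m')\<^sup>2 / (2 * v\<^sup>2)"
    if "v > 0" for v m' :: real
  proof -
    have "gauss_dens m' (v\<^sup>2) x = exp (- (x - m')\<^sup>2 / (2 * v\<^sup>2)) / (sqrt (2 * pi) * v)"
      using powr_minus_half[of "2 * pi * v\<^sup>2"] that by (simp add: gauss_dens_def real_sqrt_mult)
    then show ?thesis using that by (simp add: ln_div ln_mult)
  qed
  have "ln (gauss_dens m (t\<^sup>2) x / gauss_dens 0 (\<zeta>\<^sup>2) x) = ln (\<zeta> / t) + x\<^sup>2 / (2 * \<zeta>\<^sup>2) - (x - m)\<^sup>2 / (2 * t\<^sup>2)"
    using t \<zeta> gauss_dens_pos[of "t\<^sup>2" m x] gauss_dens_pos[of "\<zeta>\<^sup>2" 0 x]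
    by (simp add: ln_div ln_gauss)
  \<comment> \<open>Dropping the candidate's own quadratic costs only one half per coordinate in
    mean.\<close>
  also have "\<dots> \<le> ln (\<zeta> / t) + x\<^sup>2 / (2 * \<zeta>\<^sup>2)" by simp
  also have "x\<^sup>2 \<le> 2 * (m\<^sup>2 + (x - m)\<^sup>2)"
    using zero_le_power2[of "x - 2 * m"] by (simp add: power2_eq_square algebra_simps)
  then have "x\<^sup>2 / (2 * \<zeta>\<^sup>2) \<le> (m\<^sup>2 + (x - m)\<^sup>2) / \<zeta>\<^sup>2"
    using \<zeta> by (simp add: divide_simps)
  finally show ?thesis by simp
qed

text \<open>Weak Stirling bound: \<open>n ^ n / fact n\<close> is a single term of the exponential
  series at \<open>n\<close>.\<close>

lemma ln_fact_ge: "n > 0 \<Longrightarrow> real n * ln n - n \<le> ln (fact n)"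
proof -
  assume n: "n > 0"
  have "real n ^ n / fact n \<le> exp (real n)"
    using sum_le_suminf[of "\<lambda>i. inverse (fact i) * real n ^ i" "{n}"] summable_exp[of "real n"]
    by (simp add: exp_def divide_inverse mult.commute)
  then have "ln (real n ^ n / fact n) \<le> ln (exp (real n))" using n by (subst ln_le_cancel_iff) auto
  then show ?thesis using n by (simp add: ln_div ln_realpow)
qed

lemma ln_invgamma_dens:
  assumes "a > 0" "b > 0" "s > 0"
  shows "ln (invgamma_dens a b s) = a * ln b - ln (Gamma a) - (a + 1) * ln s - b / s"
proof -
  have G: "Gamma a > 0" "Gamma a \<noteq> 0" using Gamma_real_pos[OF assms(1)] by auto
  have "ln (b powr a / Gamma a * (1 / s) powr (a + 1) * exp (- b / s))
      = ln (b powr a / Gamma a) + ln ((1 / s) powr (a + 1)) + (- b / s)"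
  proof -
    have *: "ln (A * B * exp c) = ln A + ln B + c" if "A > 0" "B > 0" for A B c :: real
      using that by (simp add: ln_mult)
    show ?thesis using assms G by (intro *) auto
  qed
  also have "ln (b powr a / Gamma a) = a * ln b - ln (Gamma a)"
    using assms G by (simp add: ln_div ln_powr)
  also have "ln ((1 / s) powr (a + 1)) = - ((a + 1) * ln s)"
    using assms by (simp add: ln_powr ln_div algebra_simps)
  finally show ?thesis using assms by (simp add: invgamma_dens_def)
qed

text \<open>The contributions of order \<open>n\<close> cancel: Stirling's bound absorbs the
  normaliser \<open>(n * v) powr (n + 1) / fact n\<close>, and the tangent bound for the logarithm
  of \<open>s\<close> cancels \<open>n * v / s\<close>. Only \<open>ln n\<close> and constants
  survive. The condition \<open>\<alpha> \<le> n\<close> keeps the multiplier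
  \<open>n + 1 - \<alpha>\<close> nonnegative.\<close>

lemma ln_invgamma_dens_ratio_le:
  assumes n: "n > 0" "\<alpha> \<le> real n" and \<alpha>: "\<alpha> > 0" and lam: "lam > 0" and v: "v > 0" and s: "s > 0"
  shows "ln (invgamma_dens (real n + 1) (real n * v) s / invgamma_dens \<alpha> lam s)
    \<le> ln n + (\<alpha> * \<bar>ln v + 1\<bar> + ln (Gamma \<alpha>) - \<alpha> * ln lam) + (v + lam) / s"
proof -
  \<comment> \<open>Tangent at \<open>s = v\<close>, the mean of the candidate, so the bound is
    sharp where the mass sits.\<close>
  have "ln (v / s) \<le> v / s - 1" using v s by (intro ln_le_minus_one) auto
  then have "- ln s \<le> - ln v + v / s - 1" using v s by (simp add: ln_div)
  then have "(n + 1 - \<alpha>) * (- ln s) \<le> (n + 1 - \<alpha>) * (- ln v + v / s - 1)"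
    using n by (intro mult_left_mono) auto
  moreover have "Gamma (real n + 1) = fact n" using Gamma_fact[of n, where 'a = real] by (simp add: add.commute)
  ultimately have "ln (invgamma_dens (real n + 1) (real n * v) s / invgamma_dens \<alpha> lam s)
    \<le> (n + 1) * (ln n + ln v) - ln (fact n) + (n + 1 - \<alpha>) * (- ln v + v / s - 1) - (n * v - lam) / s
      + (ln (Gamma \<alpha>) - \<alpha> * ln lam)"
    using assms invgamma_dens_pos[of "real n + 1" "real n * v" s] invgamma_dens_pos[of \<alpha> lam s]
    by (simp add: ln_div ln_invgamma_dens ln_mult algebra_simps diff_divide_distrib)
  also have "\<dots> = (n + 1) * ln n - ln (fact n) - (n + 1) + \<alpha> * (ln v + 1) + ((1 - \<alpha>) * v + lam) / s
      + (ln (Gamma \<alpha>) - \<alpha> * ln lam)"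
    by (simp add: algebra_simps add_divide_distrib diff_divide_distrib)
  also have "\<dots> \<le> ln n + \<alpha> * \<bar>ln v + 1\<bar> + (v + lam) / s + (ln (Gamma \<alpha>) - \<alpha> * ln lam)"
  proof -
    have "\<alpha> * (ln v + 1) \<le> \<alpha> * \<bar>ln v + 1\<bar>" using \<alpha> by (intro mult_left_mono) auto
    moreover have "((1 - \<alpha>) * v + lam) / s \<le> (v + lam) / s"
      using \<alpha> v s by (intro divide_right_mono) (auto simp: algebra_simps)
    ultimately show ?thesis using ln_fact_ge[OF n(1)] by (simp add: algebra_simps)
  qed
  finally show ?thesis by simp
qed

text \<open>The weight \<open>\<tau>\<close> is kept free: small when the coefficient of the noise
  must stay near one, equal to 1 where a factor 2 is harmless.\<close>

lemma square_sum_le: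
  fixes u w \<tau> :: real assumes "\<tau> > 0"
  shows "(u + w)\<^sup>2 \<le> (1 + \<tau>) * u\<^sup>2 + (1 + 1 / \<tau>) * w\<^sup>2"
proof -
  have "0 \<le> (\<tau> * u - w)\<^sup>2 / \<tau>" using assms by simp
  also have "\<dots> = \<tau> * u\<^sup>2 - 2 * u * w + w\<^sup>2 / \<tau>"
    using assms by (simp add: power2_eq_square field_simps)
  finally show ?thesis by (simp add: power2_eq_square algebra_simps add_divide_distrib)
qed

text \<open>The cross term of noise and approximation error is absorbed by
  \<open>square_sum_le\<close>, at the price of a factor \<open>1 + \<tau>\<close> on the squared
  noise.\<close>

lemma ln_ldens_ratio_le:
  assumes v: "v > 0" and s: "s > 0" and \<tau>: "\<tau> > 0"
  shows "ln (ldens f0 v y x / ldens f s y x)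
    \<le> (s / v - 1) / 2 + ((1 + \<tau>) * (y - f0 x)\<^sup>2 + (1 + 1 / \<tau>) * (f0 x - f x)\<^sup>2) / (2 * s) - (y - f0 x)\<^sup>2 / (2 * v)"
proof -
  have ln_l: "ln (ldens f s y x) = - ln (2 * pi) / 2 - ln s / 2 - (y - f x)\<^sup>2 / (2 * s)" if "s > 0" for f s
    using that by (simp add: ldens_def ln_mult ln_powr algebra_simps add_divide_distrib)
  have "ln (s / v) \<le> s / v - 1" using v s by (intro ln_le_minus_one) auto
  then have "ln s - ln v \<le> s / v - 1" using v s by (simp add: ln_div)
  moreover have "(y - f x)\<^sup>2 / (2 * s) \<le> ((1 + \<tau>) * (y - f0 x)\<^sup>2 + (1 + 1 / \<tau>) * (f0 x - f x)\<^sup>2) / (2 * s)"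
    using square_sum_le[OF \<tau>, of "y - f0 x" "f0 x - f x"] s by (intro divide_right_mono) auto
  moreover have "ln (ldens f0 v y x / ldens f s y x) = ln (ldens f0 v y x) - ln (ldens f s y x)"
    using v s ldens_pos[of v f0 y x] ldens_pos[of s f y x] by (simp add: ln_div)
  ultimately show ?thesis using v s by (simp add: ln_l diff_divide_distrib)
qed

section \<open>Divergence of the candidate from the posterior\<close>

lemma lik_nonneg: "0 \<le> lik p k n D \<omega>"
  unfolding lik_def by (intro prod_nonneg) (auto simp: ldens_nonneg)

lemma lik_pos: "0 < snd \<omega> \<Longrightarrow> 0 < lik p k n D \<omega>"
  unfolding lik_def by (intro prod_pos) (auto simp: ldens_pos)

context regression
begin

abbreviation "params k \<equiv> param_meas (Knum p k)"

definition L0 :: "nat \<Rightarrow> (nat \<Rightarrow> real \<times> (nat \<Rightarrow> real)) \<Rightarrow> real" where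
  "L0 n D = (\<Prod>i<n. l0 (D i))"

lemma L0_pos: "0 < L0 n D"
  unfolding L0_def by (intro prod_pos) (auto simp: l0_pos)

lemma L0_measurable [measurable]: "L0 n \<in> borel_measurable (P0 n)"
  unfolding L0_def
  by (intro borel_measurable_prod measurable_compose[OF P0_coord_measurable[OF measurable_ident] l0_measurable]) auto

lemma fnet_dens_measurable:
  assumes F: "F \<in> M \<rightarrow>\<^sub>M params k" and G: "G \<in> M \<rightarrow>\<^sub>M YX p"
  shows "(\<lambda>w. ldens (fnet p k (fst (F w))) (snd (F w)) (fst (G w)) (snd (G w))) \<in> borel_measurable M"
proof (intro ldens_measurable)
  show "(\<lambda>w. fnet p k (fst (F w)) (snd (G w))) \<in> borel_measurable M"
    using F G by (intro fnet_measurable measurable_compose[OF F fst_param_meas] measurable_compose[OF G measurable_snd])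
  show "(\<lambda>w. snd (F w)) \<in> borel_measurable M" by (rule measurable_compose[OF F snd_param_meas])
  show "(\<lambda>w. fst (G w)) \<in> borel_measurable M"
    using measurable_compose[OF G measurable_fst] by simp
qed

lemma lik_measurable [measurable (raw)]:
  assumes F: "F \<in> M \<rightarrow>\<^sub>M params k" and D: "D \<in> M \<rightarrow>\<^sub>M P0 n"
  shows "(\<lambda>w. lik p k n (D w) (F w)) \<in> borel_measurable M"
  unfolding lik_def by (intro borel_measurable_prod fnet_dens_measurable[OF F] P0_coord_measurable[OF D]) auto

lemma lik_measurable_param:
  assumes "D \<in> space (P0 n)"
  shows "(\<lambda>\<omega>. lik p k n D \<omega>) \<in> borel_measurable (params k)"
  using lik_measurable[of "\<lambda>w. w" "params k" k "\<lambda>_. D" n] assms by simp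

lemma prior_dens_measurable [measurable]: "prior_dens \<alpha> lam \<zeta> K \<in> borel_measurable (param_meas K)"
  unfolding prior_dens_eq_vdens by simp

text \<open>The variational candidate is centred at \<open>\<theta>0\<close> for the weights, while its scale part has mean
  \<open>\<sigma>0\<^sup>2\<close>; the logarithm of \<open>s / \<sigma>0\<^sup>2\<close> is replaced throughout by \<open>s / \<sigma>0\<^sup>2 - 1\<close>, so that only first
  moments of \<open>s\<close> and \<open>1 / s\<close> enter.\<close>

lemma dKL_candidate_le:
  fixes n k :: nat and \<theta>0 :: "nat \<Rightarrow> real" and \<alpha> lam \<zeta> t \<tau> R m :: real
  defines "K \<equiv> Knum p k"
  defines "\<Xi> \<equiv> \<lambda>D. \<Sum>i<n. (fst (D i) - f0 (snd (D i)))\<^sup>2"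
    and "\<Gamma> \<equiv> \<lambda>D. \<Sum>i<n. (f0 (snd (D i)) - fnet p k \<theta>0 (snd (D i)))\<^sup>2"
    and "c \<equiv> (real n + 1) / (real n * \<sigma>0\<^sup>2)"
    and "C0 \<equiv> \<alpha> * \<bar>ln (\<sigma>0\<^sup>2) + 1\<bar> + ln (Gamma \<alpha>) - \<alpha> * ln lam"
    and "\<Lambda> \<equiv> 1 + real k + real k * R * (real p + 1)"
  assumes D: "D \<in> space (P0 n)" and cube: "\<And>i h. i < n \<Longrightarrow> h < p \<Longrightarrow> 0 \<le> snd (D i) h \<and> snd (D i) h \<le> 1"
    and n: "n > 0" "\<alpha> \<le> real n"
    and pos: "\<alpha> > 0" "lam > 0" "\<zeta> > 0" "t > 0" "\<tau> > 0"
    and R: "\<And>i. i < K \<Longrightarrow> \<bar>\<theta>0 i\<bar> \<le> R"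
    and M: "(\<integral>\<^sup>+ \<omega>. ennreal (lik p k n D \<omega> * prior_dens \<alpha> lam \<zeta> K \<omega>) \<partial>param_meas K) = ennreal m" "m > 0"
  defines "EP \<equiv> K * ln (\<zeta> / t) + (\<Sum>i<K. (\<theta>0 i)\<^sup>2) / \<zeta>\<^sup>2 + ln n + C0 + K * t\<^sup>2 / \<zeta>\<^sup>2
      + c * (\<sigma>0\<^sup>2 + lam + ((1 + \<tau>) * \<Xi> D + (1 + 1 / \<tau>) * (2 * \<Gamma> D)) / 2 + (1 + 1 / \<tau>) * n * \<Lambda>\<^sup>2 * (K * t\<^sup>2))
      - \<Xi> D / (2 * \<sigma>0\<^sup>2)"
  shows "0 \<le> EP + ln (m / L0 n D) \<and>
    dKL (param_meas K) (vdens K (real n + 1, real n * \<sigma>0\<^sup>2, \<theta>0, \<lambda>_. t)) (post_dens p \<alpha> lam \<zeta> k n D)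
      \<le> ennreal (EP + ln (m / L0 n D))"
proof -
  let ?post = "post_dens p \<alpha> lam \<zeta> k n D" and ?prior = "prior_dens \<alpha> lam \<zeta> K"
  let ?\<xi> = "\<lambda>i. fst (D i) - f0 (snd (D i))" and ?g = "\<lambda>i. f0 (snd (D i)) - fnet p k \<theta>0 (snd (D i))"
  define q where "q = vdens K (real n + 1, real n * \<sigma>0\<^sup>2, \<theta>0, \<lambda>_. t)"
  define D2 where "D2 = (\<lambda>\<omega>::(nat \<Rightarrow> real) \<times> real. \<Sum>i<K. (fst \<omega> i - \<theta>0 i)\<^sup>2)"
  \<comment> \<open>\<open>c0\<close> to \<open>c4\<close> collect the coefficients of
    \<open>1\<close>, \<open>s\<close>, \<open>1 / s\<close>, \<open>D2\<close> and
    \<open>D2 / s\<close> in the majorant \<open>P\<close>.\<close>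
  define c0 where "c0 = K * ln (\<zeta> / t) + (\<Sum>i<K. (\<theta>0 i)\<^sup>2) / \<zeta>\<^sup>2 + ln n + C0 - n / 2 - \<Xi> D / (2 * \<sigma>0\<^sup>2) + ln (m / L0 n D)"
  define c1 where "c1 = n / (2 * \<sigma>0\<^sup>2)"
  define c2 where "c2 = \<sigma>0\<^sup>2 + lam + ((1 + \<tau>) * \<Xi> D + (1 + 1 / \<tau>) * (2 * \<Gamma> D)) / 2"
  define c3 where "c3 = 1 / \<zeta>\<^sup>2"
  define c4 where "c4 = (1 + 1 / \<tau>) * n * \<Lambda>\<^sup>2"
  define P where "P = (\<lambda>\<omega>. c0 + c1 * snd \<omega> + c2 / snd \<omega> + c3 * D2 \<omega> + c4 * (D2 \<omega> / snd \<omega>))"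
  have s0: "\<sigma>0\<^sup>2 > 0" using sigma0_pos by simp
  have vq: "vvalid K (real n + 1, real n * \<sigma>0\<^sup>2, \<theta>0, \<lambda>_. t)" using n pos s0 by (simp add: vvalid_def)
  have vp: "vvalid K (\<alpha>, lam, (\<lambda>_. 0), (\<lambda>_. \<zeta>))" using pos by (simp add: vvalid_def)
  have post: "?post \<omega> = lik p k n D \<omega> * ?prior \<omega> / m" for \<omega>
    using M by (simp add: post_dens_def K_def)
  have post_meas: "?post \<in> borel_measurable (param_meas K)"
    unfolding post[abs_def] K_def
    by (intro borel_measurable_divide borel_measurable_times lik_measurable_param[OF D] prior_dens_measurable) simp
  have prior_nn: "0 \<le> ?prior \<omega>" for \<omega>
    unfolding prior_dens_eq_vdens by (rule vdens_nonneg[OF vp])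
  have EP: "has_bochner_integral (param_meas K) (\<lambda>\<omega>. q \<omega> * P \<omega>) (EP + ln (m / L0 n D))"
  proof -
    \<comment> \<open>The mean of \<open>c1 * s\<close> is \<open>n / 2\<close> and cancels the
      \<open>- n / 2\<close> in \<open>c0\<close>: this is where centring at the true scale
      pays.\<close>
    have "c0 + c1 * (n * \<sigma>0\<^sup>2 / n) + c2 * c + c3 * (K * t\<^sup>2) + c4 * (K * t\<^sup>2 * c) = EP + ln (m / L0 n D)"
    proof -
      have "c1 * (n * \<sigma>0\<^sup>2 / n) = n / 2" using n s0 by (simp add: c1_def)
      then show ?thesis by (simp add: c0_def c2_def c3_def c4_def EP_def algebra_simps)
    qed
    then show ?thesis
      using has_bochner_integral_vdens_poly[OF vq, of c0 c1 c2 c3 c4] n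
      by (simp add: q_def P_def D2_def c_def)
  qed
  have bound: "?post \<omega> > 0 \<and> ln (q \<omega> / ?post \<omega>) \<le> P \<omega>"
    if "q \<omega> > 0" for \<omega>
  proof
    define s where "s = snd \<omega>"
    define \<theta> where "\<theta> = fst \<omega>"
    let ?lr = "\<lambda>i. ldens f0 (\<sigma>0\<^sup>2) (fst (D i)) (snd (D i)) / ldens (fnet p k \<theta>) s (fst (D i)) (snd (D i))"
    let ?gr = "\<lambda>i. gauss_dens (\<theta>0 i) (t\<^sup>2) (\<theta> i) / gauss_dens 0 (\<zeta>\<^sup>2) (\<theta> i)"
    let ?ir = "invgamma_dens (real n + 1) (real n * \<sigma>0\<^sup>2) s / invgamma_dens \<alpha> lam s"
    have s: "s > 0" using that vdens_pos_iff[OF vq] by (simp add: q_def s_def)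
    have L: "0 < lik p k n D \<omega>" using s by (intro lik_pos) (simp add: s_def)
    have pr: "0 < ?prior \<omega>"
      unfolding prior_dens_eq_vdens using vdens_pos_iff[OF vp] s by (simp add: s_def)
    show "?post \<omega> > 0" using L pr M(2) by (simp add: post)
    have gq: "0 < gauss_dens (\<theta>0 i) (t\<^sup>2) (\<theta> i)" "0 < gauss_dens 0 (\<zeta>\<^sup>2) (\<theta> i)" for i
      using pos by (auto intro!: gauss_dens_pos)
    have ig: "0 < invgamma_dens (real n + 1) (real n * \<sigma>0\<^sup>2) s" "0 < invgamma_dens \<alpha> lam s"
      using n pos s s0 by (auto intro!: invgamma_dens_pos)
    have "q \<omega> / ?prior \<omega>
        = (?ir)
          * (\<Prod>i<K. ?gr i)"
      by (simp add: q_def vdens_def prior_dens_def s_def \<theta>_def prod_dividef)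
    moreover have "0 < (\<Prod>i<K. ?gr i)"
      using gq by (intro prod_pos) simp
    ultimately have "ln (q \<omega> / ?prior \<omega>)
        = ln (?ir)
          + ln (\<Prod>i<K. ?gr i)"
      using ig by (simp only:) (intro ln_mult_pos divide_pos_pos)
    then have 1: "ln (q \<omega> / ?prior \<omega>)
        = ln (?ir)
          + (\<Sum>i<K. ln (?gr i))"
      using gq by (subst (asm) ln_prod) (simp_all add: less_imp_neq[symmetric])
    have 2: "ln (?ir)
        \<le> ln n + C0 + (\<sigma>0\<^sup>2 + lam) / s"
      unfolding C0_def by (rule ln_invgamma_dens_ratio_le[OF n pos(1,2) s0 s])
    have "(\<Sum>i<K. ln (?gr i))
        \<le> (\<Sum>i<K. ln (\<zeta> / t) + ((\<theta>0 i)\<^sup>2 + (\<theta> i - \<theta>0 i)\<^sup>2) / \<zeta>\<^sup>2)"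
      using pos by (intro sum_mono ln_gauss_dens_ratio_le) auto
    also have "\<dots> = K * ln (\<zeta> / t) + (\<Sum>i<K. (\<theta>0 i)\<^sup>2) / \<zeta>\<^sup>2 + c3 * D2 \<omega>"
      by (simp add: sum.distrib sum_divide_distrib[symmetric] D2_def \<theta>_def c3_def add_divide_distrib)
    finally have 3: "(\<Sum>i<K. ln (?gr i))
        \<le> K * ln (\<zeta> / t) + (\<Sum>i<K. (\<theta>0 i)\<^sup>2) / \<zeta>\<^sup>2 + c3 * D2 \<omega>" .
    have D2: "0 \<le> D2 \<omega>" unfolding D2_def by (intro sum_nonneg) auto
    \<comment> \<open>Coordinatewise distance is bounded by the Euclidean one, so the random weights
      enter only through \<open>D2\<close>, whose mean is known.\<close>
    have net: "(f0 (snd (D i)) - fnet p k \<theta> (snd (D i)))\<^sup>2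
        \<le> 2 * (?g i)\<^sup>2 + 2 * (\<Lambda>\<^sup>2 * D2 \<omega>)" if i: "i < n" for i
    proof -
      have "\<bar>fnet p k \<theta> (snd (D i)) - fnet p k \<theta>0 (snd (D i))\<bar> \<le> sqrt (D2 \<omega>) * \<Lambda>"
        unfolding \<Lambda>_def
      proof (rule fnet_Lipschitz)
        fix j assume j: "j < Knum p k"
        then have "(\<theta> j - \<theta>0 j)\<^sup>2 \<le> D2 \<omega>"
          unfolding D2_def \<theta>_def by (intro member_le_sum[of j "{..<K}" "\<lambda>j. (fst \<omega> j - \<theta>0 j)\<^sup>2"]) (auto simp: K_def)
        then show "\<bar>\<theta> j - \<theta>0 j\<bar> \<le> sqrt (D2 \<omega>)" using real_le_rsqrt by (metis power2_abs)
        show "\<bar>\<theta>0 j\<bar> \<le> R" using R j by (simp add: K_def)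
      qed (use cube[OF i] in auto)
      then have "\<bar>fnet p k \<theta> (snd (D i)) - fnet p k \<theta>0 (snd (D i))\<bar>\<^sup>2 \<le> (sqrt (D2 \<omega>) * \<Lambda>)\<^sup>2"
        by (intro power_mono) auto
      then have "(fnet p k \<theta>0 (snd (D i)) - fnet p k \<theta> (snd (D i)))\<^sup>2 \<le> \<Lambda>\<^sup>2 * D2 \<omega>"
        using D2 by (simp add: power_mult_distrib mult.commute power2_commute)
      then show ?thesis
        using square_sum_le[of 1 "?g i"
            "fnet p k \<theta>0 (snd (D i)) - fnet p k \<theta> (snd (D i))"] by simp
    qed
    have "L0 n D / lik p k n D \<omega> = (\<Prod>i<n. ?lr i)"
      by (simp add: L0_def l0_def lik_def prod_dividef s_def \<theta>_def)
    then have "ln (L0 n D / lik p k n D \<omega>)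
       = (\<Sum>i<n. ln (?lr i))"
      using s s0 ldens_pos[THEN less_imp_neq, symmetric] by (simp only:) (rule ln_prod, auto)
    also have "\<dots> \<le> (\<Sum>i<n. (s / \<sigma>0\<^sup>2 - 1) / 2 + ((1 + \<tau>) * (?\<xi> i)\<^sup>2
         + (1 + 1 / \<tau>) * (2 * (?g i)\<^sup>2 + 2 * (\<Lambda>\<^sup>2 * D2 \<omega>))) / (2 * s)
         - (?\<xi> i)\<^sup>2 / (2 * \<sigma>0\<^sup>2))"
    proof (intro sum_mono)
      fix i assume i: "i \<in> {..<n}"
      have "(1 + 1 / \<tau>) * (f0 (snd (D i)) - fnet p k \<theta> (snd (D i)))\<^sup>2
        \<le> (1 + 1 / \<tau>) * (2 * (?g i)\<^sup>2 + 2 * (\<Lambda>\<^sup>2 * D2 \<omega>))"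
        using pos net i by (intro mult_left_mono) auto
      then have "((1 + \<tau>) * (?\<xi> i)\<^sup>2
           + (1 + 1 / \<tau>) * (f0 (snd (D i)) - fnet p k \<theta> (snd (D i)))\<^sup>2) / (2 * s)
        \<le> ((1 + \<tau>) * (?\<xi> i)\<^sup>2
           + (1 + 1 / \<tau>) * (2 * (?g i)\<^sup>2 + 2 * (\<Lambda>\<^sup>2 * D2 \<omega>))) / (2 * s)"
        using s by (intro divide_right_mono) auto
      with ln_ldens_ratio_le[OF s0 s pos(5), of f0 "fst (D i)" "snd (D i)" "fnet p k \<theta>"]
      show "ln (?lr i)
        \<le> (s / \<sigma>0\<^sup>2 - 1) / 2 + ((1 + \<tau>) * (?\<xi> i)\<^sup>2
         + (1 + 1 / \<tau>) * (2 * (?g i)\<^sup>2 + 2 * (\<Lambda>\<^sup>2 * D2 \<omega>))) / (2 * s)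
         - (?\<xi> i)\<^sup>2 / (2 * \<sigma>0\<^sup>2)"
        by linarith
    qed
    also have "\<dots> = n * ((s / \<sigma>0\<^sup>2 - 1) / 2) + ((1 + \<tau>) * \<Xi> D
         + (1 + 1 / \<tau>) * (2 * \<Gamma> D + 2 * (n * (\<Lambda>\<^sup>2 * D2 \<omega>)))) / (2 * s) - \<Xi> D / (2 * \<sigma>0\<^sup>2)"
      unfolding \<Xi>_def \<Gamma>_def
      by (simp only: sum.distrib sum_subtractf sum_divide_distrib[symmetric] sum_distrib_left[symmetric]
          sum_constant card_lessThan)
        (simp add: algebra_simps)
    also have "\<dots> = - n / 2 + c1 * s + (c2 - \<sigma>0\<^sup>2 - lam) / s + c4 * (D2 \<omega> / s) - \<Xi> D / (2 * \<sigma>0\<^sup>2)"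
      using s by (simp add: c1_def c2_def c4_def add_divide_distrib diff_divide_distrib algebra_simps)
    finally have 4: "ln (L0 n D / lik p k n D \<omega>)
      \<le> - n / 2 + c1 * s + (c2 - \<sigma>0\<^sup>2 - lam) / s + c4 * (D2 \<omega> / s) - \<Xi> D / (2 * \<sigma>0\<^sup>2)" .
    have "ln (q \<omega> / ?post \<omega>)
      = ln (q \<omega> / ?prior \<omega>) + ln (L0 n D / lik p k n D \<omega>) + ln (m / L0 n D)"
      using that L pr M(2) L0_pos[of n D] by (simp add: post ln_div ln_mult)
    also have "\<dots> \<le> P \<omega>"
      using 1 2 3 4 by (simp add: P_def c0_def s_def diff_divide_distrib add_divide_distrib)
    finally show "ln (q \<omega> / ?post \<omega>) \<le> P \<omega>" .
  qed
  have "(\<integral>\<^sup>+ \<omega>. ennreal (?post \<omega>) \<partial>param_meas K)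
      = (\<integral>\<^sup>+ \<omega>. ennreal (1 / m) * ennreal (lik p k n D \<omega> * ?prior \<omega>) \<partial>param_meas K)"
    using M(2) prior_nn lik_nonneg by (intro nn_integral_cong) (simp add: post ennreal_mult[symmetric])
  also have "\<dots> = ennreal (1 / m) * ennreal m"
    unfolding M(1)[symmetric] K_def
    by (intro nn_integral_cmult measurable_compose[OF _ measurable_ennreal] borel_measurable_times
        lik_measurable_param[OF D] prior_dens_measurable)
  also have "\<dots> = 1" using M(2) by (simp add: ennreal_mult[symmetric])
  finally have "(\<integral>\<^sup>+ \<omega>. ennreal (?post \<omega>) \<partial>param_meas K) \<le> 1" by simp
  then show ?thesis
    unfolding q_def[symmetric]
    using post_meas EP bound prior_nn lik_nonneg M(2) vdens_nonneg[OF vq] has_bochner_integral_vdens[OF vq]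
    by (intro dKL_upper[where P = P]) (auto simp: q_def post)
qed

end

section \<open>Bracketing of likelihood ratios\<close>

text \<open>From \<open>sqrt u \<le> sqrt l + sqrt (u - l)\<close> and the arithmetic-geometric mean
  inequality with weight \<open>\<kappa>\<close>. The terms are arranged so that no subtraction
  occurs outside the square and the inequality can be integrated in \<open>ennreal\<close>.\<close>

lemma bracket_affinity_pointwise:
  fixes l u l0 \<kappa> :: real
  assumes "0 \<le> l" "l \<le> u" "0 \<le> l0" "\<kappa> > 0"
  shows "2 * sqrt (u * l0) + (sqrt l - sqrt l0)\<^sup>2 + l / \<kappa> \<le> l + l0 + u / \<kappa> + \<kappa> * l0"
proof -
  have "sqrt u \<le> sqrt l + sqrt (u - l)"
    using assms sqrt_add_le_add_sqrt[of l "u - l"] by simp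
  then have "sqrt u * sqrt l0 \<le> (sqrt l + sqrt (u - l)) * sqrt l0"
    using assms by (intro mult_right_mono) auto
  moreover have "2 * (sqrt (u - l) * sqrt l0) \<le> (u - l) / \<kappa> + \<kappa> * l0"
  proof -
    have "0 \<le> (sqrt (u - l) - \<kappa> * sqrt l0)\<^sup>2 / \<kappa>" using assms by simp
    also have "\<dots> = ((sqrt (u - l))\<^sup>2 - 2 * \<kappa> * (sqrt (u - l) * sqrt l0) + \<kappa>\<^sup>2 * (sqrt l0)\<^sup>2) / \<kappa>"
      by (simp add: power2_eq_square algebra_simps)
    also have "\<dots> = (u - l) / \<kappa> - 2 * (sqrt (u - l) * sqrt l0) + \<kappa> * l0"
      using assms by (simp add: field_simps power2_eq_square)
    finally show ?thesis by simp
  qed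
  moreover have "(sqrt l - sqrt l0)\<^sup>2 = l + l0 - 2 * (sqrt l * sqrt l0)"
    using assms by (simp add: power2_diff)
  ultimately show ?thesis
    by (simp add: real_sqrt_mult algebra_simps diff_divide_distrib)
qed

text \<open>Inflating the variance by \<open>1 + \<tau>\<close> absorbs a small change of the mean function, so an upper bracket for
  a cell of parameters can be taken to be a multiple of a single model density.\<close>

lemma ldens_le_perturbed:
  assumes s: "s > 0" "s \<le> s'" "s' \<le> s * (1 + \<rho>)" and \<tau>: "\<tau> > 0"
    and d: "\<bar>f x - f' x\<bar> \<le> d"
  shows "ldens f s y x \<le> sqrt ((1 + \<rho>) * (1 + \<tau>)) * exp (d\<^sup>2 / (2 * \<tau> * s)) * ldens f' (s' * (1 + \<tau>)) y x"
proof -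
  have s': "s' > 0" using s by simp
  have l: "ldens f s y x = 1 / sqrt (2 * pi * s) * exp (- (y - f x)\<^sup>2 / (2 * s))" if "s > 0" for f s
    using powr_minus_half[of "2 * pi * s"] that by (simp add: ldens_def)
  have "1 / sqrt (2 * pi * s) \<le> sqrt ((1 + \<rho>) * (1 + \<tau>)) / sqrt (2 * pi * (s' * (1 + \<tau>)))"
  proof -
    have "2 * pi * (s' * (1 + \<tau>)) \<le> (1 + \<rho>) * (1 + \<tau>) * (2 * pi * s)"
      using s(3) \<tau> by (simp add: mult_ac)
    then have "sqrt (2 * pi * (s' * (1 + \<tau>))) \<le> sqrt ((1 + \<rho>) * (1 + \<tau>)) * sqrt (2 * pi * s)"
      by (simp flip: real_sqrt_mult)
    then show ?thesis using s s' \<tau> by (simp add: divide_simps mult.commute)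
  qed
  moreover have "exp (- (y - f x)\<^sup>2 / (2 * s)) \<le> exp (d\<^sup>2 / (2 * \<tau> * s)) * exp (- (y - f' x)\<^sup>2 / (2 * (s' * (1 + \<tau>))))"
  proof -
    \<comment> \<open>The factor \<open>1 + \<tau>\<close> produced by Young's inequality cancels
      against the inflated variance; only \<open>d\<^sup>2 / \<tau>\<close> is left over.\<close>
    have "(y - f' x)\<^sup>2 \<le> (1 + \<tau>) * (y - f x)\<^sup>2 + (1 + 1 / \<tau>) * (f x - f' x)\<^sup>2"
      using square_sum_le[OF \<tau>, of "y - f x" "f x - f' x"] by simp
    also have "\<dots> = (1 + \<tau>) * ((y - f x)\<^sup>2 + (f x - f' x)\<^sup>2 / \<tau>)"
      using \<tau> by (simp add: field_simps)
    finally have "(y - f' x)\<^sup>2 / (2 * (s' * (1 + \<tau>))) \<le> (1 + \<tau>) * ((y - f x)\<^sup>2 + (f x - f' x)\<^sup>2 / \<tau>) / (2 * (s' * (1 + \<tau>)))"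
      using s' \<tau> by (intro divide_right_mono) auto
    also have "\<dots> = ((y - f x)\<^sup>2 + (f x - f' x)\<^sup>2 / \<tau>) / (2 * s')"
      using s' \<tau> by simp
    also have "\<dots> \<le> ((y - f x)\<^sup>2 + d\<^sup>2 / \<tau>) / (2 * s)"
    proof (intro frac_le add_mono divide_right_mono)
      show "(f x - f' x)\<^sup>2 \<le> d\<^sup>2" using d by (intro abs_le_square_iff[THEN iffD1]) auto
    qed (use s s' \<tau> in auto)
    also have "\<dots> = (y - f x)\<^sup>2 / (2 * s) + d\<^sup>2 / (2 * \<tau> * s)"
      by (simp add: add_divide_distrib)
    finally have "- (y - f x)\<^sup>2 / (2 * s) \<le> d\<^sup>2 / (2 * \<tau> * s) + - (y - f' x)\<^sup>2 / (2 * (s' * (1 + \<tau>)))"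
      by simp
    then show ?thesis by (subst exp_add[symmetric]) (simp only: exp_le_cancel_iff)
  qed
  ultimately have "1 / sqrt (2 * pi * s) * exp (- (y - f x)\<^sup>2 / (2 * s))
    \<le> sqrt ((1 + \<rho>) * (1 + \<tau>)) / sqrt (2 * pi * (s' * (1 + \<tau>)))
      * (exp (d\<^sup>2 / (2 * \<tau> * s)) * exp (- (y - f' x)\<^sup>2 / (2 * (s' * (1 + \<tau>)))))"
  proof (intro mult_mono)
    have "0 < s * (1 + \<rho>)" using s by linarith
    then have "0 < 1 + \<rho>" using s(1) by (rule zero_less_mult_pos)
    then show "0 \<le> sqrt ((1 + \<rho>) * (1 + \<tau>)) / sqrt (2 * pi * (s' * (1 + \<tau>)))" using s' \<tau> by simp
  qed auto
  then show ?thesis using s s' \<tau> by (simp add: l mult_ac)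
qed

context regression
begin

lemma P0_coord: "i < n \<Longrightarrow> (\<lambda>D. D i) \<in> P0 n \<rightarrow>\<^sub>M YX p"
  by (rule P0_coord_measurable[OF measurable_ident_sets[OF refl]])

text \<open>As \<open>dH\<close> carries no factor one half, the affinity of \<open>l\<close> itself
  is at most \<open>1 - e / 2\<close>. Passing to the bracket costs half of
  \<open>\<tau> / \<kappa> + \<kappa>\<close>, since \<open>u - l\<close> has mass at most
  \<open>\<tau>\<close>; the choice \<open>\<kappa> = sqrt \<tau>\<close> balances the two.\<close>

lemma nn_integral_bracket_affinity:
  assumes [measurable]: "l \<in> borel_measurable (YX p)" "u \<in> borel_measurable (YX p)"
    and l: "\<And>z. 0 \<le> l z" "(\<integral>\<^sup>+ z. ennreal (l z) \<partial>YX p) = 1" and lu: "AE z in YX p. l z \<le> u z"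
    and u: "\<And>z. 0 \<le> u z" "(\<integral>\<^sup>+ z. ennreal (u z) \<partial>YX p) \<le> ennreal (1 + \<tau>)" and \<tau>: "\<tau> > 0"
    and e: "ennreal e \<le> (\<integral>\<^sup>+ z. ennreal ((sqrt (l z) - sqrt (l0 z))\<^sup>2) \<partial>YX p)" "0 \<le> e"
  shows "(\<integral>\<^sup>+ z. ennreal (sqrt (u z * l0 z)) \<partial>YX p) \<le> ennreal (1 - e / 2 + sqrt \<tau>)"
proof -
  let ?h = "\<lambda>z. (sqrt (l z) - sqrt (l0 z))\<^sup>2" and ?a = "\<lambda>z. sqrt (u z * l0 z)"
  define \<kappa> where "\<kappa> = sqrt \<tau>"
  have \<kappa>: "\<kappa> > 0" "\<kappa> * \<kappa> = \<tau>" using \<tau> by (auto simp: \<kappa>_def)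
  define A where "A = (\<integral>\<^sup>+ z. ennreal (?a z) \<partial>YX p)"
  have l0: "0 \<le> l0 z" for z using l0_pos[of z] by simp
  have "2 * A + ennreal e + ennreal (1 / \<kappa>)
      \<le> 2 * A + (\<integral>\<^sup>+ z. ennreal (?h z) \<partial>YX p) + ennreal (1 / \<kappa>) * (\<integral>\<^sup>+ z. ennreal (l z) \<partial>YX p)"
    using e l by (intro add_mono order_refl) auto
  also have "\<dots> = (\<integral>\<^sup>+ z. 2 * ennreal (?a z) + ennreal (?h z) + ennreal (1 / \<kappa>) * ennreal (l z) \<partial>YX p)"
    unfolding A_def by (simp add: nn_integral_add nn_integral_cmult)
  also have "\<dots> \<le> (\<integral>\<^sup>+ z. ennreal (l z) + ennreal (l0 z) + ennreal (1 / \<kappa>) * ennreal (u z) + ennreal \<kappa> * ennreal (l0 z) \<partial>YX p)"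
  proof (rule nn_integral_mono_AE)
    show "AE z in YX p. 2 * ennreal (?a z) + ennreal (?h z) + ennreal (1 / \<kappa>) * ennreal (l z)
      \<le> ennreal (l z) + ennreal (l0 z) + ennreal (1 / \<kappa>) * ennreal (u z) + ennreal \<kappa> * ennreal (l0 z)"
      using lu
    proof eventually_elim
      case (elim z)
      have "ennreal (2 * ?a z + ?h z + l z / \<kappa>)
          \<le> ennreal (l z + l0 z + u z / \<kappa> + \<kappa> * l0 z)"
        using elim l(1) l0 \<kappa> by (intro ennreal_leI bracket_affinity_pointwise) auto
      moreover have "2 * ennreal (?a z) = ennreal (2 * ?a z)"
        "ennreal (1 / \<kappa>) * ennreal (l z) = ennreal (l z / \<kappa>)"
        "ennreal (1 / \<kappa>) * ennreal (u z) = ennreal (u z / \<kappa>)"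
        "ennreal \<kappa> * ennreal (l0 z) = ennreal (\<kappa> * l0 z)"
        using \<kappa> ennreal_mult'[of 2 "?a z"] ennreal_mult'[of "1 / \<kappa>" "l z"]
          ennreal_mult'[of "1 / \<kappa>" "u z"] ennreal_mult'[of \<kappa> "l0 z"]
        by simp_all
      moreover have "0 \<le> l z / \<kappa>" "0 \<le> u z / \<kappa>" "0 \<le> \<kappa> * l0 z" "0 \<le> ?a z"
        using \<kappa> l(1)[of z] l0[of z] u(1)[of z] by simp_all
      ultimately show ?case using l(1)[of z] l0[of z] by (simp only: ennreal_plus add_nonneg_nonneg
          zero_le_power2 mult_nonneg_nonneg zero_le_numeral)
    qed
  qed
  also have "\<dots> = 1 + 1 + ennreal (1 / \<kappa>) * (\<integral>\<^sup>+ z. ennreal (u z) \<partial>YX p) + ennreal \<kappa> * 1"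
    using l by (simp add: nn_integral_add nn_integral_cmult nn_integral_l0)
  also have "\<dots> \<le> 1 + 1 + ennreal (1 / \<kappa>) * ennreal (1 + \<tau>) + ennreal \<kappa> * 1"
    using u by (intro add_mono mult_left_mono order_refl) auto
  also have "\<dots> = ennreal (2 + (1 + \<tau>) / \<kappa> + \<kappa>)"
  proof -
    have "ennreal (1 / \<kappa>) * ennreal (1 + \<tau>) = ennreal ((1 + \<tau>) / \<kappa>)"
      using \<kappa> ennreal_mult'[of "1 / \<kappa>" "1 + \<tau>"] by simp
    moreover have "0 \<le> (1 + \<tau>) / \<kappa>" using \<kappa> \<tau> by simp
    ultimately show ?thesis using \<kappa> by simp
  qed
  finally have main: "2 * A + ennreal e + ennreal (1 / \<kappa>) \<le> ennreal (2 + (1 + \<tau>) / \<kappa> + \<kappa>)" .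
  have "A \<noteq> \<top>" using main by (auto simp: ennreal_mult_eq_top_iff top_unique)
  then obtain A' where A': "A = ennreal A'" "A' \<ge> 0" by (cases A) auto
  have "ennreal (2 * A' + e + 1 / \<kappa>) \<le> ennreal (2 + (1 + \<tau>) / \<kappa> + \<kappa>)"
    using main A' e \<kappa> by (simp add: ennreal_plus ennreal_mult)
  then have "2 * A' + e + 1 / \<kappa> \<le> 2 + (1 + \<tau>) / \<kappa> + \<kappa>"
    using \<kappa> \<tau> by (subst (asm) ennreal_le_iff) auto
  moreover have "(1 + \<tau>) / \<kappa> = 1 / \<kappa> + \<kappa>" using \<kappa> by (simp add: add_divide_distrib flip: \<kappa>(2))
  ultimately have "A' \<le> 1 - e / 2 + sqrt \<tau>" by (simp add: \<kappa>_def)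
  then show ?thesis unfolding A_def[symmetric] A' by (rule ennreal_leI)
qed

text \<open>The square root of the likelihood ratio has mean equal to the n-th power of the
  affinity, and Markov's inequality is applied at half the exponent. The function \<open>u\<close>
  is not a probability density, and it controls all parameters of its cell at once.\<close>

lemma prob_bracket_le:
  assumes [measurable]: "u \<in> borel_measurable (YX p)" and u: "\<And>z. 0 \<le> u z"
    and aff: "(\<integral>\<^sup>+ z. ennreal (sqrt (u z * l0 z)) \<partial>YX p) \<le> ennreal (exp (- \<kappa>))"
  shows "{D \<in> space (P0 n). exp (- \<kappa> * n) * L0 n D \<le> (\<Prod>i<n. u (D i))} \<in> sets (P0 n)" (is "?E \<in> _")
    and "measure (P0 n) {D \<in> space (P0 n). exp (- \<kappa> * n) * L0 n D \<le> (\<Prod>i<n. u (D i))} \<le> exp (- \<kappa> * n / 2)"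
proof -
  let ?r = "\<lambda>D. sqrt ((\<Prod>i<n. u (D i)) / L0 n D)"
  interpret P: prob_space "P0 n" by (rule prob_space_P0)
  have [measurable]: "(\<lambda>D. u (D i)) \<in> borel_measurable (P0 n)" if "i < n" for i
    by (rule measurable_compose[OF P0_coord[OF that] assms(1)])
  have [measurable]: "(\<lambda>D. \<Prod>i<n. u (D i)) \<in> borel_measurable (P0 n)"
    by (intro borel_measurable_prod) auto
  show "?E \<in> sets (P0 n)" by measurable
  define h where "h = (\<lambda>z. sqrt (u z * l0 z))"
  have [measurable]: "h \<in> borel_measurable (YX p)" unfolding h_def by measurable
  have h: "h z / l0 z = sqrt (u z / l0 z)" for z
    using l0_pos[of z] by (simp add: h_def real_sqrt_mult real_sqrt_divide field_simps)
  have prod_h: "(\<Prod>i<n. ennreal (h (D i) / l0 (D i))) = ennreal (?r D)" for D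
  proof -
    have "(\<Prod>i<n. h (D i) / l0 (D i)) = ?r D"
    proof -
      have "(\<Prod>i<n. sqrt (g i)) = sqrt (\<Prod>i<n. g i)" for g :: "nat \<Rightarrow> real"
        by (induction n) (simp_all add: real_sqrt_mult)
      then show ?thesis unfolding h L0_def by (simp add: prod_dividef)
    qed
    moreover have "0 \<le> h z / l0 z" for z using u l0_pos[of z] by (simp add: h)
    ultimately show ?thesis by (simp add: prod_ennreal)
  qed
  have "(\<integral>\<^sup>+ D. ennreal (?r D) \<partial>P0 n) = (\<integral>\<^sup>+ z. ennreal (h z / l0 z) \<partial>obs) ^ n"
    unfolding prod_h[symmetric] by (subst nn_integral_P0_prod) auto
  also have "\<dots> = (\<integral>\<^sup>+ z. ennreal (h z) \<partial>YX p) ^ n"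
    using u l0_pos by (subst nn_integral_obs_ratio) (auto simp: h_def less_imp_le)
  also have "\<dots> \<le> ennreal (exp (- \<kappa>)) ^ n"
    using aff unfolding h_def by (intro power_mono) auto
  also have "\<dots> = ennreal (exp (- \<kappa> * n))"
    by (simp add: ennreal_power exp_of_nat_mult[symmetric] mult.commute)
  finally have le: "(\<integral>\<^sup>+ D. ennreal (?r D) \<partial>P0 n) \<le> ennreal (exp (- \<kappa> * n))" .
  have "?E \<subseteq> {D \<in> space (P0 n). ennreal (exp (- \<kappa> * n / 2)) \<le> ennreal (?r D)}"
  proof safe
    fix D assume "exp (- \<kappa> * n) * L0 n D \<le> (\<Prod>i<n. u (D i))"
    then have "exp (- \<kappa> * n) \<le> (\<Prod>i<n. u (D i)) / L0 n D"
      using L0_pos[of n D] by (simp add: field_simps)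
    then have "sqrt (exp (- \<kappa> * n)) \<le> ?r D" by simp
    moreover have "sqrt (exp (- \<kappa> * n)) = exp (- \<kappa> * n / 2)"
      by (rule real_sqrt_unique) (simp_all flip: exp_of_nat_mult)
    ultimately have "exp (- \<kappa> * n / 2) \<le> ?r D" by linarith
    then show "ennreal (exp (- \<kappa> * n / 2)) \<le> ennreal (?r D)"
      by (rule ennreal_leI)
  qed
  then have "measure (P0 n) ?E \<le> measure (P0 n) {D \<in> space (P0 n). ennreal (exp (- \<kappa> * n / 2)) \<le> ennreal (?r D)}"
    by (intro P.finite_measure_mono) measurable
  also have "\<dots> \<le> exp (- \<kappa> * n) / exp (- \<kappa> * n / 2)"
    by (intro P.measure_Markov_nn le) auto
  also have "\<dots> = exp (- \<kappa> * n / 2)" by (simp add: exp_diff[symmetric])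
  finally show "measure (P0 n) ?E \<le> exp (- \<kappa> * n / 2)" .
qed

lemma ldens_le_tail: "T > 0 \<Longrightarrow> T \<le> s \<Longrightarrow> ldens f s y x \<le> (2 * pi * T) powr (-1/2)"
proof -
  assume "T > 0" "T \<le> s"
  then have "(2 * pi * s) powr (-1/2) \<le> (2 * pi * T) powr (-1/2)" by (intro powr_mono2') auto
  moreover have "exp (- ((y - f x)\<^sup>2) / (2 * s)) \<le> 1" using \<open>T > 0\<close> \<open>T \<le> s\<close> by simp
  ultimately have "(2 * pi * s) powr (-1/2) * exp (- ((y - f x)\<^sup>2) / (2 * s)) \<le> (2 * pi * T) powr (-1/2) * 1"
    by (intro mult_mono) auto
  then show ?thesis by (simp add: ldens_def)
qed

text \<open>A constant is not integrable in \<open>y\<close>, but its square root against the square root of the true density is;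
  the factor 64 makes the affinity equal to one half.\<close>

lemma nn_integral_tail_affinity:
  "(\<integral>\<^sup>+ z. ennreal (sqrt ((2 * pi * (64 * \<sigma>0\<^sup>2)) powr (-1/2) * l0 z)) \<partial>YX p) = ennreal (1 / 2)"
proof -
  have eq: "sqrt ((2 * pi * (64 * \<sigma>0\<^sup>2)) powr (-1/2) * l0 z) = 1 / 2 * ldens f0 (2 * \<sigma>0\<^sup>2) (fst z) (snd z)" for z
  proof (rule real_sqrt_unique)
    define e where "e = (fst z - f0 (snd z))\<^sup>2 / \<sigma>0\<^sup>2"
    have l: "ldens f0 s (fst z) (snd z) = 1 / sqrt (2 * pi * s) * exp (- (fst z - f0 (snd z))\<^sup>2 / (2 * s))" if "s > 0" for s
      using powr_minus_half[of "2 * pi * s"] that by (simp add: ldens_def)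
    have "(2 * pi * (64 * \<sigma>0\<^sup>2)) powr (-1/2) = 1 / (8 * sqrt (2 * pi * \<sigma>0\<^sup>2))"
    proof -
      have "sqrt (2 * pi * (64 * \<sigma>0\<^sup>2)) = 8 * sqrt (2 * pi * \<sigma>0\<^sup>2)"
        using real_sqrt_mult[of 64 "2 * pi * \<sigma>0\<^sup>2"] real_sqrt_unique[of 8 64] by (simp add: mult_ac)
      then show ?thesis using powr_minus_half[of "2 * pi * (64 * \<sigma>0\<^sup>2)"] by simp
    qed
    moreover have "l0 z = 1 / sqrt (2 * pi * \<sigma>0\<^sup>2) * exp (- e / 2)"
      using l[of "\<sigma>0\<^sup>2"] sigma0_pos by (simp add: l0_def e_def)
    ultimately have "(2 * pi * (64 * \<sigma>0\<^sup>2)) powr (-1/2) * l0 z = 1 / (8 * (sqrt (2 * pi * \<sigma>0\<^sup>2))\<^sup>2) * exp (- e / 2)"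
      by (simp add: power2_eq_square del: real_sqrt_pow2 real_sqrt_mult_self)
    also have "(sqrt (2 * pi * \<sigma>0\<^sup>2))\<^sup>2 = 2 * pi * \<sigma>0\<^sup>2" by simp
    finally have R: "(2 * pi * (64 * \<sigma>0\<^sup>2)) powr (-1/2) * l0 z = 1 / (16 * pi * \<sigma>0\<^sup>2) * exp (- e / 2)" by simp
    have "(1 / 2 * ldens f0 (2 * \<sigma>0\<^sup>2) (fst z) (snd z))\<^sup>2
        = 1 / 4 * (1 / (sqrt (2 * pi * (2 * \<sigma>0\<^sup>2)))\<^sup>2) * (exp (- e / 4))\<^sup>2"
      using l[of "2 * \<sigma>0\<^sup>2"] sigma0_pos by (simp add: e_def power_mult_distrib power_divide del: real_sqrt_pow2)
    also have "(sqrt (2 * pi * (2 * \<sigma>0\<^sup>2)))\<^sup>2 = 4 * pi * \<sigma>0\<^sup>2" by simp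
    also have "(exp (- e / 4))\<^sup>2 = exp (- e / 2)" by (simp flip: exp_of_nat_mult)
    finally show "(1 / 2 * ldens f0 (2 * \<sigma>0\<^sup>2) (fst z) (snd z))\<^sup>2 = (2 * pi * (64 * \<sigma>0\<^sup>2)) powr (-1/2) * l0 z"
      unfolding R by simp
  qed (simp add: ldens_nonneg)
  have "(\<integral>\<^sup>+ z. ennreal (1 / 2 * ldens f0 (2 * \<sigma>0\<^sup>2) (fst z) (snd z)) \<partial>YX p)
    = (\<integral>\<^sup>+ z. ennreal (1 / 2) * ennreal (ldens f0 (2 * \<sigma>0\<^sup>2) (fst z) (snd z)) \<partial>YX p)"
    by (intro nn_integral_cong ennreal_mult) (auto simp: ldens_nonneg)
  also have "\<dots> = ennreal (1 / 2) * 1"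
    using sigma0_pos by (subst nn_integral_cmult) (auto simp: nn_integral_ldens)
  finally show ?thesis unfolding eq by simp
qed

end

section \<open>Prior tails and evidence ratios\<close>

lemma fnet_cong:
  assumes "\<And>i. i < Knum p k \<Longrightarrow> \<theta> i = \<theta>' i"
  shows "fnet p k \<theta> x = fnet p k \<theta>' x"
proof -
  have 1: "\<theta> j = \<theta>' j" if "j \<le> k" for j
    by (rule assms) (use that in \<open>simp add: Knum_def\<close>)
  have 2: "\<theta> (gidx p k j h) = \<theta>' (gidx p k j h)" if "j \<in> {1..k}" "h \<le> p" for j h
    by (rule assms, rule gidx_less) (use that in auto)
  have 3: "(\<Sum>h\<in>{1..p}. \<theta> (gidx p k j h) * x (h - 1)) = (\<Sum>h\<in>{1..p}. \<theta>' (gidx p k j h) * x (h - 1))"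
    if "j \<in> {1..k}" for j
    by (rule sum.cong[OF refl]) (use 2[OF that] in auto)
  have "(\<Sum>j\<in>{1..k}. \<theta> j * psi (\<theta> (gidx p k j 0) + (\<Sum>h\<in>{1..p}. \<theta> (gidx p k j h) * x (h - 1))))
    = (\<Sum>j\<in>{1..k}. \<theta>' j * psi (\<theta>' (gidx p k j 0) + (\<Sum>h\<in>{1..p}. \<theta>' (gidx p k j h) * x (h - 1))))"
    by (rule sum.cong[OF refl]) (use 1 2 3 in auto)
  then show ?thesis unfolding fnet_def using 1[of 0] by simp
qed

text \<open>An arbitrary \<open>\<theta>\<close> need not be extensional, hence not a point of the
  product space. Restricting it to the used coordinates leaves the network unchanged and brings the
  joint result into play.\<close>

lemma fnet_measurable_x: "fnet p k \<theta> \<in> borel_measurable (Xmeas p)"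
proof -
  have "(\<lambda>x. fnet p k (restrict \<theta> {..<Knum p k}) x) \<in> borel_measurable (Xmeas p)"
    by (intro fnet_measurable measurable_const measurable_ident_sets[OF refl]) (auto simp: space_PiM)
  moreover have "fnet p k (restrict \<theta> {..<Knum p k}) x = fnet p k \<theta> x" for x
    by (rule fnet_cong) simp
  ultimately show ?thesis by simp
qed

text \<open>Half of the exponent pays for the tail factor; the other half is, up to
  \<open>sqrt 2\<close>, the Gaussian density with doubled variance.\<close>

lemma nn_integral_gauss_tail:
  assumes "\<zeta> > 0" "N \<ge> 0"
  shows "(\<integral>\<^sup>+ t. ennreal (gauss_dens 0 (\<zeta>\<^sup>2) t) * indicator {t. N < \<bar>t\<bar>} t \<partial>lborel)
    \<le> ennreal (sqrt 2 * exp (- N\<^sup>2 / (4 * \<zeta>\<^sup>2)))"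
proof -
  let ?c = "sqrt 2 * exp (- N\<^sup>2 / (4 * \<zeta>\<^sup>2))"
  have l: "gauss_dens 0 v t = 1 / sqrt (2 * pi * v) * exp (- t\<^sup>2 / (2 * v))" if "v > 0" for v t :: real
    using powr_minus_half[of "2 * pi * v"] that by (simp add: gauss_dens_def)
  have eq: "gauss_dens 0 (\<zeta>\<^sup>2) t = sqrt 2 * exp (- t\<^sup>2 / (4 * \<zeta>\<^sup>2)) * gauss_dens 0 (2 * \<zeta>\<^sup>2) t" for t
  proof -
    have "sqrt (2 * pi * (2 * \<zeta>\<^sup>2)) = sqrt 2 * sqrt (2 * pi * \<zeta>\<^sup>2)"
      by (simp add: mult_ac flip: real_sqrt_mult)
    then show ?thesis using assms(1) by (simp add: l field_simps flip: exp_add)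
  qed
  have "(\<integral>\<^sup>+ t. ennreal (gauss_dens 0 (\<zeta>\<^sup>2) t) * indicator {t. N < \<bar>t\<bar>} t \<partial>lborel)
      \<le> (\<integral>\<^sup>+ t. ennreal (?c) * ennreal (gauss_dens 0 (2 * \<zeta>\<^sup>2) t) \<partial>lborel)"
  proof (intro nn_integral_mono)
    fix t :: real
    show "ennreal (gauss_dens 0 (\<zeta>\<^sup>2) t) * indicator {t. N < \<bar>t\<bar>} t
        \<le> ennreal (?c) * ennreal (gauss_dens 0 (2 * \<zeta>\<^sup>2) t)"
    proof (cases "N < \<bar>t\<bar>")
      case True
      then have "N\<^sup>2 \<le> t\<^sup>2" using assms(2) by (intro abs_le_square_iff[THEN iffD1]) simp
      then have "- t\<^sup>2 / (4 * \<zeta>\<^sup>2) \<le> - N\<^sup>2 / (4 * \<zeta>\<^sup>2)" using assms(1) by (intro divide_right_mono) auto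
      then have "gauss_dens 0 (\<zeta>\<^sup>2) t \<le> ?c * gauss_dens 0 (2 * \<zeta>\<^sup>2) t"
        unfolding eq by (intro mult_right_mono mult_left_mono) (auto simp: gauss_dens_nonneg)
      then have "ennreal (gauss_dens 0 (\<zeta>\<^sup>2) t) \<le> ennreal (?c * gauss_dens 0 (2 * \<zeta>\<^sup>2) t)"
        by (rule ennreal_leI)
      then show ?thesis using True by (simp add: ennreal_mult')
    qed simp
  qed
  also have "\<dots> = ennreal (?c)"
    using assms(1) by (subst nn_integral_cmult) (auto simp: nn_integral_gauss_dens)
  finally show ?thesis .
qed

text \<open>Same splitting as for the Gaussian tail: half of the rate \<open>lam\<close> produces
  the exponential factor, the other half remains an inverse gamma density.\<close>

lemma nn_integral_invgamma_tail:
  assumes "\<alpha> > 0" "lam > 0" "N > 0"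
  shows "(\<integral>\<^sup>+ s. ennreal (invgamma_dens \<alpha> lam s) * indicator {s. s < 1 / N} s \<partial>lborel)
    \<le> ennreal (2 powr \<alpha> * exp (- lam * N / 2))"
proof -
  let ?c = "2 powr \<alpha> * exp (- lam * N / 2)"
  have eq: "invgamma_dens \<alpha> lam s = 2 powr \<alpha> * exp (- lam / (2 * s)) * invgamma_dens \<alpha> (lam / 2) s" if "s > 0" for s
  proof -
    have "lam powr \<alpha> = 2 powr \<alpha> * (lam / 2) powr \<alpha>" using assms by (simp flip: powr_mult)
    moreover have "exp (- lam / s) = exp (- lam / (2 * s)) * exp (- (lam / 2) / s)"
      using that by (simp flip: exp_add add: field_simps)
    ultimately show ?thesis using that by (simp add: invgamma_dens_def)
  qed
  have "(\<integral>\<^sup>+ s. ennreal (invgamma_dens \<alpha> lam s) * indicator {s. s < 1 / N} s \<partial>lborel)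
      \<le> (\<integral>\<^sup>+ s. ennreal (?c) * ennreal (invgamma_dens \<alpha> (lam / 2) s) \<partial>lborel)"
  proof (intro nn_integral_mono)
    fix s :: real
    show "ennreal (invgamma_dens \<alpha> lam s) * indicator {s. s < 1 / N} s
      \<le> ennreal (?c) * ennreal (invgamma_dens \<alpha> (lam / 2) s)"
    proof (cases "0 < s \<and> s < 1 / N")
      case True
      then have "N < 1 / s" using assms by (simp add: field_simps)
      then have "lam / 2 * N \<le> lam / 2 * (1 / s)" using assms by (intro mult_left_mono) auto
      then have "- lam / (2 * s) \<le> - lam * N / 2" by simp
      then have "invgamma_dens \<alpha> lam s \<le> ?c * invgamma_dens \<alpha> (lam / 2) s"
        unfolding eq[OF conjunct1[OF True]] using assms
        by (intro mult_right_mono mult_left_mono) (auto simp: invgamma_dens_nonneg)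
      then have "ennreal (invgamma_dens \<alpha> lam s) \<le> ennreal (?c * invgamma_dens \<alpha> (lam / 2) s)"
        by (rule ennreal_leI)
      then show ?thesis using True by (simp add: ennreal_mult')
    qed (auto simp: invgamma_dens_def)
  qed
  also have "\<dots> = ennreal (?c)"
    using assms by (subst nn_integral_cmult) (auto simp: nn_integral_invgamma_dens)
  finally show ?thesis .
qed

text \<open>The bounds \<open>N\<close> on weights and \<open>1 / N\<^sup>2\<close> on the scale are
  matched so that both prior tails have exponent of order \<open>N\<^sup>2\<close>. There is no
  upper bound on the scale, since large scales are handled by one constant bracket.\<close>

definition sieve :: "nat \<Rightarrow> real \<Rightarrow> ((nat \<Rightarrow> real) \<times> real) set" where
  "sieve K N = {\<omega> \<in> space (param_meas K). (\<forall>i<K. \<bar>fst \<omega> i\<bar> \<le> N) \<and> 1 / N\<^sup>2 \<le> snd \<omega>}"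

lemma sieve_sets: "sieve K N \<in> sets (param_meas K)"
proof -
  have "{\<omega> \<in> space (param_meas K). (\<forall>i\<in>{..<K}. \<bar>fst \<omega> i\<bar> \<le> N) \<and> 1 / N\<^sup>2 \<le> snd \<omega>} \<in> sets (param_meas K)"
  proof (intro sets.sets_Collect_conj sets.sets_Collect_finite_All)
    fix i assume "i \<in> {..<K}"
    then have [measurable]: "(\<lambda>\<omega>. fst \<omega> i) \<in> borel_measurable (param_meas K)"
      by (intro param_coord_measurable[of "\<lambda>w. w"]) auto
    show "{\<omega> \<in> space (param_meas K). \<bar>fst \<omega> i\<bar> \<le> N} \<in> sets (param_meas K)" by measurable
  qed auto
  then show ?thesis by (simp add: sieve_def)
qed

lemma prior_sieve_compl:
  assumes "\<alpha> > 0" "lam > 0" "\<zeta> > 0" "N > 0"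
  shows "(\<integral>\<^sup>+ \<omega>. ennreal (prior_dens \<alpha> lam \<zeta> K \<omega>) * indicator (space (param_meas K) - sieve K N) \<omega> \<partial>param_meas K)
    \<le> ennreal (2 powr \<alpha> * exp (- lam * N\<^sup>2 / 2) + K * (sqrt 2 * exp (- N\<^sup>2 / (4 * \<zeta>\<^sup>2))))"
proof -
  let ?a = "2 powr \<alpha> * exp (- lam * N\<^sup>2 / 2)" and ?b = "sqrt 2 * exp (- N\<^sup>2 / (4 * \<zeta>\<^sup>2))"
  let ?M = "param_meas K"
  let ?v = "vdens K (\<alpha>, lam, (\<lambda>_. 0), (\<lambda>_. \<zeta>))"
  have v: "vvalid K (\<alpha>, lam, (\<lambda>_. 0), (\<lambda>_. \<zeta>))" using assms by (simp add: vvalid_def)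
  let ?A = "\<lambda>s. indicator {s. s < 1 / N\<^sup>2} s :: ennreal" and ?B = "\<lambda>t. indicator {t. N < \<bar>t\<bar>} t :: ennreal"
  have mB: "(\<lambda>\<omega>. ?B (fst \<omega> i)) \<in> borel_measurable (?M)" if "i < K" for i
    using param_coord_measurable[of "\<lambda>w. w" "?M" K i] that
    by (intro measurable_compose[of "\<lambda>\<omega>. fst \<omega> i" "?M" borel ?B]) auto
  have mA: "(\<lambda>\<omega>. ?A (snd \<omega>)) \<in> borel_measurable (?M)"
    by (intro measurable_compose[of snd "?M" borel ?A]) auto
  have "(\<integral>\<^sup>+ \<omega>. ennreal (prior_dens \<alpha> lam \<zeta> K \<omega>) * indicator (space (?M) - sieve K N) \<omega> \<partial>?M)
    \<le> (\<integral>\<^sup>+ \<omega>. ennreal (?v \<omega>) * ?A (snd \<omega>) + (\<Sum>i<K. ennreal (?v \<omega>) * (1 * ?B (fst \<omega> i))) \<partial>?M)"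
  proof (intro nn_integral_mono)
    fix \<omega> assume w: "\<omega> \<in> space (?M)"
    have "indicator (space (?M) - sieve K N) \<omega> \<le> ?A (snd \<omega>) + (\<Sum>i<K. ?B (fst \<omega> i))"
    proof (cases "\<omega> \<in> sieve K N \<or> snd \<omega> < 1 / N\<^sup>2")
      case True
      then show ?thesis by (auto simp: indicator_def add_increasing2)
    next
      case False
      then obtain i where i: "i < K" "N < \<bar>fst \<omega> i\<bar>" using w by (auto simp: sieve_def not_le not_less)
      have "(1::ennreal) = ?B (fst \<omega> i)" using i by simp
      also have "\<dots> \<le> (\<Sum>i<K. ?B (fst \<omega> i))" using i by (intro member_le_sum) auto
      finally have "1 \<le> ?A (snd \<omega>) + (\<Sum>i<K. ?B (fst \<omega> i))" by (simp add: add_increasing)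
      then show ?thesis by (auto simp: indicator_def split: if_splits)
    qed
    then have "ennreal (?v \<omega>) * indicator (space (?M) - sieve K N) \<omega> \<le> ennreal (?v \<omega>) * (?A (snd \<omega>) + (\<Sum>i<K. ?B (fst \<omega> i)))"
      by (rule mult_left_mono) simp
    then show "ennreal (prior_dens \<alpha> lam \<zeta> K \<omega>) * indicator (space (?M) - sieve K N) \<omega>
       \<le> ennreal (?v \<omega>) * ?A (snd \<omega>) + (\<Sum>i<K. ennreal (?v \<omega>) * (1 * ?B (fst \<omega> i)))"
      by (simp only: prior_dens_eq_vdens distrib_left sum_distrib_left mult_1_left)
  qed
  also have "\<dots> = (\<integral>\<^sup>+ \<omega>. ennreal (?v \<omega>) * ?A (snd \<omega>) \<partial>?M)
      + (\<Sum>i<K. \<integral>\<^sup>+ \<omega>. ennreal (?v \<omega>) * (1 * ?B (fst \<omega> i)) \<partial>?M)"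
  proof -
    have 1: "(\<lambda>\<omega>. ennreal (?v \<omega>) * ?A (snd \<omega>)) \<in> borel_measurable (?M)"
      by (intro borel_measurable_times_ennreal measurable_compose[OF vdens_measurable measurable_ennreal] mA)
    have 2: "(\<lambda>\<omega>. ennreal (?v \<omega>) * (1 * ?B (fst \<omega> i))) \<in> borel_measurable (?M)" if "i \<in> {..<K}" for i
      using that by (intro borel_measurable_times_ennreal measurable_compose[OF vdens_measurable measurable_ennreal] mB) auto
    show ?thesis
      by (subst nn_integral_add[OF 1 borel_measurable_sum[OF 2]], assumption, subst nn_integral_sum[OF 2]) simp_all
  qed
  also have "\<dots> \<le> ennreal (?a) + (\<Sum>i<K. ennreal (?b))"
  proof (intro add_mono sum_mono)
    show "(\<integral>\<^sup>+ \<omega>. ennreal (?v \<omega>) * ?A (snd \<omega>) \<partial>?M) \<le> ennreal (?a)"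
      using nn_integral_invgamma_tail[of \<alpha> lam "N\<^sup>2"] assms by (subst nn_integral_vdens_scale[OF v]) auto
    fix i assume "i \<in> {..<K}"
    then have "(\<integral>\<^sup>+ \<omega>. ennreal (?v \<omega>) * (1 * ?B (fst \<omega> i)) \<partial>?M)
       = (\<integral>\<^sup>+ x. ennreal (invgamma_dens \<alpha> lam x) * 1 \<partial>lborel) * (\<integral>\<^sup>+ t. ennreal (gauss_dens 0 (\<zeta>\<^sup>2) t) * ?B t \<partial>lborel)"
      by (intro nn_integral_vdens_coord[OF v]) auto
    also have "\<dots> \<le> ennreal (?b)"
      using nn_integral_gauss_tail[of \<zeta> N] assms by (simp add: nn_integral_invgamma_dens)
    finally show "(\<integral>\<^sup>+ \<omega>. ennreal (?v \<omega>) * (1 * ?B (fst \<omega> i)) \<partial>?M) \<le> ennreal (?b)" .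
  qed
  also have "\<dots> = ennreal (?a + K * (?b))"
    by (simp add: ennreal_plus ennreal_mult' ennreal_of_nat_eq_real_of_nat)
  finally show ?thesis .
qed

section \<open>Averages over the data law: likelihood ratios, evidence, noise and approximation
  error\<close>

context regression
begin

lemma nn_integral_lik_ratio:
  assumes s: "snd \<omega> > 0"
  shows "(\<integral>\<^sup>+ D. ennreal (lik p k n D \<omega> / L0 n D) \<partial>P0 n) = 1"
proof -
  let ?l = "\<lambda>z. ldens (fnet p k (fst \<omega>)) (snd \<omega>) (fst z) (snd z)"
  have m: "?l \<in> borel_measurable (YX p)"
    using fnet_measurable_x by (intro ldens_measurable) auto
  have "ennreal (lik p k n D \<omega> / L0 n D) = (\<Prod>i<n. ennreal (?l (D i) / l0 (D i)))" for D
    using l0_pos by (simp add: lik_def L0_def prod_dividef prod_ennreal ldens_nonneg less_imp_le)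
  then have "(\<integral>\<^sup>+ D. ennreal (lik p k n D \<omega> / L0 n D) \<partial>P0 n) = (\<integral>\<^sup>+ z. ennreal (?l z / l0 z) \<partial>obs) ^ n"
    using m by (simp, subst nn_integral_P0_prod) auto
  also have "(\<integral>\<^sup>+ z. ennreal (?l z / l0 z) \<partial>obs) = 1"
    using m s fnet_measurable_x by (subst nn_integral_obs_ratio) (auto simp: ldens_nonneg nn_integral_ldens)
  finally show ?thesis by simp
qed

lemma evidence_measurable:
  assumes [measurable]: "S \<in> sets (params k)"
  shows "(\<lambda>D. \<integral>\<^sup>+ \<omega>. ennreal (lik p k n D \<omega> * prior_dens \<alpha> lam \<zeta> (Knum p k) \<omega>) * indicator S \<omega> \<partial>params k)
    \<in> borel_measurable (P0 n)"
proof -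
  interpret A: sigma_finite_measure "params k" by (rule sigma_finite_param_meas)
  have m: "(\<lambda>w. lik p k n (fst w) (snd w)) \<in> borel_measurable (P0 n \<Otimes>\<^sub>M params k)"
    by (intro lik_measurable) auto
  have "(\<lambda>w. ennreal (lik p k n (fst w) (snd w) * prior_dens \<alpha> lam \<zeta> (Knum p k) (snd w)) * indicator S (snd w))
     \<in> borel_measurable (P0 n \<Otimes>\<^sub>M params k)"
    by (intro borel_measurable_times_ennreal measurable_compose[OF _ measurable_ennreal] borel_measurable_times m
        measurable_compose[OF measurable_snd prior_dens_measurable] measurable_compose[OF measurable_snd borel_measurable_indicator] assms)
  then show ?thesis by (intro A.borel_measurable_nn_integral) (simp add: case_prod_unfold)
qed

text \<open>Tonelli, since each likelihood ratio has mean one. With \<open>S\<close> the whole space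
  the evidence ratio has mean one; with \<open>S\<close> the sieve complement the mean is its prior
  mass.\<close>

lemma nn_integral_P0_evidence:
  assumes S[measurable]: "S \<in> sets (params k)" and pos: "\<alpha> > 0" "lam > 0" "\<zeta> > 0"
  shows "(\<integral>\<^sup>+ D. ennreal (1 / L0 n D) *
       (\<integral>\<^sup>+ \<omega>. ennreal (lik p k n D \<omega> * prior_dens \<alpha> lam \<zeta> (Knum p k) \<omega>) * indicator S \<omega> \<partial>params k) \<partial>P0 n)
     = (\<integral>\<^sup>+ \<omega>. ennreal (prior_dens \<alpha> lam \<zeta> (Knum p k) \<omega>) * indicator S \<omega> \<partial>params k)"
proof -
  let ?M = "params k" and ?pr = "prior_dens \<alpha> lam \<zeta> (Knum p k)"
  interpret A: sigma_finite_measure ?M by (rule sigma_finite_param_meas)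
  interpret P: prob_space "P0 n" by (rule prob_space_P0)
  interpret PP: pair_sigma_finite "P0 n" ?M ..
  have v: "vvalid (Knum p k) (\<alpha>, lam, (\<lambda>_. 0), (\<lambda>_. \<zeta>))" using pos by (simp add: vvalid_def)
  have pr: "0 \<le> ?pr \<omega>" "snd \<omega> \<le> 0 \<Longrightarrow> ?pr \<omega> = 0" for \<omega>
    using vdens_nonneg[OF v, of \<omega>] vdens_pos_iff[OF v, of \<omega>] by (auto simp: prior_dens_eq_vdens)
  have m: "(\<lambda>w. lik p k n (fst w) (snd w)) \<in> borel_measurable (P0 n \<Otimes>\<^sub>M ?M)"
    by (intro lik_measurable) auto
  have m2: "(\<lambda>w. ennreal (lik p k n (fst w) (snd w) / L0 n (fst w)) * (ennreal (?pr (snd w)) * indicator S (snd w)))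
     \<in> borel_measurable (P0 n \<Otimes>\<^sub>M ?M)"
    by (intro borel_measurable_times_ennreal measurable_compose[OF _ measurable_ennreal] borel_measurable_divide m
        measurable_compose[OF measurable_fst L0_measurable]
        measurable_compose[OF measurable_snd prior_dens_measurable] measurable_compose[OF measurable_snd borel_measurable_indicator] assms)
  have "(\<integral>\<^sup>+ D. ennreal (1 / L0 n D) * (\<integral>\<^sup>+ \<omega>. ennreal (lik p k n D \<omega> * ?pr \<omega>) * indicator S \<omega> \<partial>?M) \<partial>P0 n)
    = (\<integral>\<^sup>+ D. \<integral>\<^sup>+ \<omega>. ennreal (lik p k n D \<omega> / L0 n D) * (ennreal (?pr \<omega>) * indicator S \<omega>) \<partial>?M \<partial>P0 n)"
  proof (intro nn_integral_cong)
    fix D assume D: "D \<in> space (P0 n)"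
    have "ennreal (1 / L0 n D) * (ennreal (lik p k n D \<omega> * ?pr \<omega>) * indicator S \<omega>)
        = ennreal (lik p k n D \<omega> / L0 n D) * (ennreal (?pr \<omega>) * indicator S \<omega>)" for \<omega>
    proof -
      have "ennreal (1 / L0 n D) * ennreal (lik p k n D \<omega> * ?pr \<omega>) = ennreal (lik p k n D \<omega> / L0 n D) * ennreal (?pr \<omega>)"
        using lik_nonneg[of p k n D \<omega>] pr(1)[of \<omega>] L0_pos[of n D]
        by (subst (1 2) ennreal_mult[symmetric]) auto
      then show ?thesis by (simp add: mult.assoc[symmetric])
    qed
    moreover have "(\<lambda>\<omega>. ennreal (lik p k n D \<omega> * ?pr \<omega>) * indicator S \<omega>) \<in> borel_measurable ?M"
      by (intro borel_measurable_times_ennreal measurable_compose[OF _ measurable_ennreal] borel_measurable_times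
        lik_measurable_param[OF D] prior_dens_measurable borel_measurable_indicator assms)
    ultimately show "ennreal (1 / L0 n D) * (\<integral>\<^sup>+ \<omega>. ennreal (lik p k n D \<omega> * ?pr \<omega>) * indicator S \<omega> \<partial>?M)
      = (\<integral>\<^sup>+ \<omega>. ennreal (lik p k n D \<omega> / L0 n D) * (ennreal (?pr \<omega>) * indicator S \<omega>) \<partial>?M)"
      by (simp add: nn_integral_cmult[symmetric])
  qed
  also have "\<dots> = (\<integral>\<^sup>+ \<omega>. \<integral>\<^sup>+ D. ennreal (lik p k n D \<omega> / L0 n D) * (ennreal (?pr \<omega>) * indicator S \<omega>) \<partial>P0 n \<partial>?M)"
    using PP.Fubini'[of "\<lambda>D \<omega>. ennreal (lik p k n D \<omega> / L0 n D) * (ennreal (?pr \<omega>) * indicator S \<omega>)"] m2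
    by (simp add: case_prod_unfold)
  also have "\<dots> = (\<integral>\<^sup>+ \<omega>. ennreal (?pr \<omega>) * indicator S \<omega> \<partial>?M)"
  proof (intro nn_integral_cong)
    fix \<omega> assume w: "\<omega> \<in> space ?M"
    have mD: "(\<lambda>D. ennreal (lik p k n D \<omega> / L0 n D)) \<in> borel_measurable (P0 n)"
      using w by (intro measurable_compose[OF _ measurable_ennreal] borel_measurable_divide lik_measurable L0_measurable) auto
    show "(\<integral>\<^sup>+ D. ennreal (lik p k n D \<omega> / L0 n D) * (ennreal (?pr \<omega>) * indicator S \<omega>) \<partial>P0 n) = ennreal (?pr \<omega>) * indicator S \<omega>"
    proof (cases "snd \<omega> > 0")
      case True
      then show ?thesis using mD by (simp add: nn_integral_multc nn_integral_lik_ratio)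
    qed (simp add: pr(2))
  qed
  finally show ?thesis .
qed

lemma nn_integral_P0_sum:
  assumes h: "h \<in> borel_measurable (YX p)"
  shows "(\<integral>\<^sup>+ D. (\<Sum>i<n. h (D i)) \<partial>P0 n) = of_nat n * (\<integral>\<^sup>+ z. h z \<partial>obs)"
proof -
  have "(\<integral>\<^sup>+ D. (\<Sum>i<n. h (D i)) \<partial>P0 n) = (\<Sum>i<n. \<integral>\<^sup>+ D. h (D i) \<partial>P0 n)"
    using measurable_compose[OF P0_coord h] by (intro nn_integral_sum) auto
  also have "\<dots> = (\<Sum>i<n. \<integral>\<^sup>+ z. h z \<partial>obs)"
    using h by (intro sum.cong refl nn_integral_P0_coord) auto
  finally show ?thesis by simp
qed

lemma nn_integral_obs_noise:
  "(\<integral>\<^sup>+ z. ennreal ((fst z - f0 (snd z))\<^sup>2) \<partial>obs) = ennreal (\<sigma>0\<^sup>2)"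
proof -
  interpret X: prob_space "Xmeas p" by (rule prob_space_Xmeas)
  have [measurable]: "(\<lambda>z. (fst z - f0 (snd z))\<^sup>2) \<in> borel_measurable (YX p)" by measurable
  have "(\<integral>\<^sup>+ z. ennreal ((fst z - f0 (snd z))\<^sup>2) \<partial>obs)
     = (\<integral>\<^sup>+ x. \<integral>\<^sup>+ y. ennreal (l0 (y, x)) * ennreal ((y - f0 x)\<^sup>2) \<partial>lborel \<partial>Xmeas p)"
    by (subst nn_integral_obs, simp, subst nn_integral_YX_snd) simp_all
  also have "\<dots> = (\<integral>\<^sup>+ x. ennreal (\<sigma>0\<^sup>2) \<partial>Xmeas p)"
    using sigma0_pos nn_integral_normal_density_variance[OF sigma0_pos]
    by (simp add: l0_def ldens_eq_normal_density ennreal_mult[symmetric])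
  finally show ?thesis by (simp add: X.emeasure_space_1)
qed

lemma nn_integral_obs_design:
  assumes [measurable]: "g \<in> borel_measurable (Xmeas p)"
  shows "(\<integral>\<^sup>+ z. g (snd z) \<partial>obs) = (\<integral>\<^sup>+ x. g x \<partial>Xmeas p)"
proof -
  have "(\<integral>\<^sup>+ z. g (snd z) \<partial>obs) = (\<integral>\<^sup>+ x. \<integral>\<^sup>+ y. ennreal (l0 (y, x)) * g x \<partial>lborel \<partial>Xmeas p)"
    by (subst nn_integral_obs, simp, subst nn_integral_YX_snd) simp_all
  also have "\<dots> = (\<integral>\<^sup>+ x. g x \<partial>Xmeas p)"
    using sigma0_pos by (simp add: l0_def ldens_eq_normal_density nn_integral_multc nn_integral_normal_density)
  finally show ?thesis .
qed

lemma dH_eq: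
  "dH p f0 \<sigma>0 k \<omega> = (\<integral>\<^sup>+ z. ennreal ((sqrt (ldens (fnet p k (fst \<omega>)) (snd \<omega>) (fst z) (snd z)) - sqrt (l0 z))\<^sup>2) \<partial>YX p)"
  by (simp add: dH_def l0_def case_prod_unfold)

lemma dH_measurable: "dH p f0 \<sigma>0 k \<in> borel_measurable (params k)"
proof -
  interpret A: sigma_finite_measure "YX p" by (rule sigma_finite_YX)
  have "(\<lambda>w. ldens (fnet p k (fst (fst w))) (snd (fst w)) (fst (snd w)) (snd (snd w))) \<in> borel_measurable (params k \<Otimes>\<^sub>M YX p)"
    by (rule fnet_dens_measurable[OF measurable_fst measurable_snd])
  then have "(\<lambda>w. ennreal ((sqrt (ldens (fnet p k (fst (fst w))) (snd (fst w)) (fst (snd w)) (snd (snd w))) - sqrt (l0 (snd w)))\<^sup>2))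
    \<in> borel_measurable (params k \<Otimes>\<^sub>M YX p)"
    using measurable_compose[OF measurable_snd[of "params k" "YX p"] l0_measurable]
    by (intro measurable_compose[OF _ measurable_ennreal] borel_measurable_power borel_measurable_diff borel_measurable_sqrt) auto
  then show ?thesis unfolding dH_eq[abs_def]
    by (intro A.borel_measurable_nn_integral) (simp add: case_prod_unfold)
qed

lemma Vnbhd_compl_sets: "space (params k) - Vnbhd p f0 \<sigma>0 k e \<in> sets (params k)"
proof -
  note dH_measurable[measurable]
  have "Vnbhd p f0 \<sigma>0 k e \<in> sets (params k)" unfolding Vnbhd_def by measurable
  then show ?thesis by auto
qed

end

section \<open>Covering the sieve\<close>

text \<open>Weights have mesh \<open>n ^ 4\<close> per unit and the scale \<open>n ^ 3\<close> per
  unit. The scale is rounded up, because the perturbation bound asks for \<open>s \<le> s'\<close>.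
  Values beyond \<open>K\<close> are undefined so that codes lie in a finite extensional
  product.\<close>

definition grid_code :: "nat \<Rightarrow> nat \<Rightarrow> (nat \<Rightarrow> real) \<times> real \<Rightarrow> (nat \<Rightarrow> int) \<times> nat" where
  "grid_code K n \<omega> = (\<lambda>i\<in>{..<K}. \<lfloor>fst \<omega> i * real n ^ 4\<rfloor>, nat \<lceil>snd \<omega> * real n ^ 3\<rceil>)"

definition grid_set :: "nat \<Rightarrow> nat \<Rightarrow> real \<Rightarrow> ((nat \<Rightarrow> int) \<times> nat) set" where
  "grid_set K n T = PiE {..<K} (\<lambda>_. {- int (n ^ 5) - 1..int (n ^ 5) + 1}) \<times> {0..nat \<lceil>T * real n ^ 3\<rceil>}"

lemma finite_grid_set: "finite (grid_set K n T)"
  unfolding grid_set_def by (intro finite_cartesian_product finite_PiE) auto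

lemma card_grid_set: "card (grid_set K n T) = (2 * n ^ 5 + 3) ^ K * (nat \<lceil>T * real n ^ 3\<rceil> + 1)"
proof -
  have "card {- int (n ^ 5) - 1..int (n ^ 5) + 1} = 2 * n ^ 5 + 3"
    by (simp add: nat_add_distrib nat_mult_distrib nat_power_eq)
  then show ?thesis unfolding grid_set_def by (simp add: card_cartesian_product card_PiE)
qed

lemma grid_code_in_grid_set:
  assumes "\<omega> \<in> sieve K n" "snd \<omega> \<le> T" "n > 0"
  shows "grid_code K n \<omega> \<in> grid_set K n T"
proof -
  have "\<lfloor>fst \<omega> i * real n ^ 4\<rfloor> \<in> {- int (n ^ 5) - 1..int (n ^ 5) + 1}" if "i < K" for i
  proof -
    have "\<bar>fst \<omega> i\<bar> * real n ^ 4 \<le> n * real n ^ 4"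
      using assms that by (intro mult_right_mono) (auto simp: sieve_def)
    then have "\<bar>fst \<omega> i * real n ^ 4\<bar> \<le> real_of_int (int (n ^ 5))"
      by (simp add: abs_mult numeral_eq_Suc)
    moreover have "\<lfloor>x\<rfloor> \<in> {- Z - 1..Z + 1}" if "\<bar>x\<bar> \<le> real_of_int Z" for x Z
      using that by (simp add: abs_le_iff) linarith
    ultimately show ?thesis by blast
  qed
  moreover have "nat \<lceil>snd \<omega> * real n ^ 3\<rceil> \<le> nat \<lceil>T * real n ^ 3\<rceil>"
    using assms by (intro nat_mono ceiling_mono mult_right_mono) auto
  ultimately show ?thesis unfolding grid_code_def grid_set_def by (auto simp: PiE_iff)
qed

context regression
begin

text \<open>A density of total mass \<open>1 + \<tau>\<close>, evaluated at the rounded parameters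
  with inflated variance.\<close>

definition grid_bracket :: "nat \<Rightarrow> nat \<Rightarrow> real \<Rightarrow> (nat \<Rightarrow> int) \<times> nat \<Rightarrow> real \<times> (nat \<Rightarrow> real) \<Rightarrow> real" where
  "grid_bracket k n \<tau> c z = (1 + \<tau>) *
     ldens (fnet p k (\<lambda>i. real_of_int (fst c i) / real n ^ 4)) (real (snd c) / real n ^ 3 * (1 + \<tau>)) (fst z) (snd z)"

lemma grid_bracket_measurable: "grid_bracket k n \<tau> c \<in> borel_measurable (YX p)"
  unfolding grid_bracket_def[abs_def] using fnet_measurable_x
  by (intro borel_measurable_times ldens_measurable) auto

text \<open>With weights at most \<open>n\<close>, rounding moves the network by at most
  \<open>\<Lambda> / n ^ 4\<close>. Hypothesis \<open>C\<close> is the resulting inflation at the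
  smallest sieve scale \<open>1 / n\<^sup>2\<close>, which is the worst case.\<close>

lemma ldens_le_grid_bracket:
  fixes n k :: nat
  defines "\<Lambda> \<equiv> 1 + real k + real k * real n * (real p + 1)"
  assumes n: "n > 0" and \<tau>: "\<tau> > 0"
    and C: "sqrt ((1 + 1 / n) * (1 + \<tau>)) * exp ((\<Lambda> / n ^ 4)\<^sup>2 / (2 * \<tau> * (1 / (real n)\<^sup>2))) \<le> 1 + \<tau>"
    and w: "\<omega> \<in> sieve (Knum p k) n"
    and x: "\<And>h. h < p \<Longrightarrow> 0 \<le> snd z h \<and> snd z h \<le> 1"
  shows "ldens (fnet p k (fst \<omega>)) (snd \<omega>) (fst z) (snd z) \<le> grid_bracket k n \<tau> (grid_code (Knum p k) n \<omega>) z"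
proof -
  define c where "c = grid_code (Knum p k) n \<omega>"
  define s where "s = snd \<omega>"
  define s' where "s' = real (snd c) / real n ^ 3"
  define \<theta>' where "\<theta>' = (\<lambda>i. real_of_int (fst c i) / real n ^ 4)"
  have n1: "real n \<ge> 1" using n by simp
  have s_ge: "1 / (real n)\<^sup>2 \<le> s" using w by (simp add: sieve_def s_def)
  have s: "s > 0" using s_ge n by (rule_tac less_le_trans[OF _ s_ge]) simp
  have cs: "real (snd c) = of_int \<lceil>s * real n ^ 3\<rceil>" using s n by (simp add: c_def grid_code_def s_def)
  have s1: "s \<le> s'" using n by (simp add: s'_def cs field_simps)
  \<comment> \<open>The absolute rounding error \<open>1 / n ^ 3\<close> is a relative error of at
    most \<open>1 / n\<close>, because \<open>s\<close> is at least
    \<open>1 / n\<^sup>2\<close>.\<close>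
  have s2: "s' \<le> s * (1 + 1 / n)"
  proof -
    have "real (snd c) \<le> s * real n ^ 3 + 1" unfolding cs by linarith
    then have "s' \<le> (s * real n ^ 3 + 1) / real n ^ 3" unfolding s'_def by (intro divide_right_mono) auto
    also have "\<dots> = s + 1 / real n ^ 3" using n by (simp add: field_simps)
    also have "1 / real n ^ 3 = 1 / (real n)\<^sup>2 * (1 / n)" by (simp add: power2_eq_square power3_eq_cube)
    also have "\<dots> \<le> s * (1 / n)" using s_ge by (intro mult_right_mono) auto
    finally show ?thesis by (simp add: distrib_left)
  qed
  have "\<bar>fnet p k \<theta>' (snd z) - fnet p k (fst \<omega>) (snd z)\<bar> \<le> 1 / real n ^ 4 * \<Lambda>"
    unfolding \<Lambda>_def
  proof (rule fnet_Lipschitz[OF x])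
    fix i assume i: "i < Knum p k"
    show "\<bar>fst \<omega> i\<bar> \<le> real n" using w i by (simp add: sieve_def)
    have "fst c i = \<lfloor>fst \<omega> i * real n ^ 4\<rfloor>" using i by (simp add: c_def grid_code_def)
    then have "\<bar>real_of_int (fst c i) - fst \<omega> i * real n ^ 4\<bar> \<le> 1" by linarith
    then have "\<bar>real_of_int (fst c i) - fst \<omega> i * real n ^ 4\<bar> / real n ^ 4 \<le> 1 / real n ^ 4"
      by (intro divide_right_mono) auto
    moreover have "\<theta>' i - fst \<omega> i = (real_of_int (fst c i) - fst \<omega> i * real n ^ 4) / real n ^ 4"
      using n by (simp add: \<theta>'_def field_simps)
    ultimately show "\<bar>\<theta>' i - fst \<omega> i\<bar> \<le> 1 / real n ^ 4" by simp
  qed auto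
  then have d: "\<bar>fnet p k (fst \<omega>) (snd z) - fnet p k \<theta>' (snd z)\<bar> \<le> \<Lambda> / real n ^ 4"
    by (simp add: abs_minus_commute)
  have "ldens (fnet p k (fst \<omega>)) s (fst z) (snd z)
    \<le> sqrt ((1 + 1 / n) * (1 + \<tau>)) * exp ((\<Lambda> / n ^ 4)\<^sup>2 / (2 * \<tau> * s)) * ldens (fnet p k \<theta>') (s' * (1 + \<tau>)) (fst z) (snd z)"
    by (intro ldens_le_perturbed s s1 s2 \<tau>) (use d in simp)
  also have "\<dots> \<le> (1 + \<tau>) * ldens (fnet p k \<theta>') (s' * (1 + \<tau>)) (fst z) (snd z)"
  proof (rule mult_right_mono[OF _ ldens_nonneg])
    have "0 < 2 * \<tau> * (1 / (real n)\<^sup>2)" "2 * \<tau> * (1 / (real n)\<^sup>2) \<le> 2 * \<tau> * s"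
      using \<tau> n s_ge by (simp, intro mult_left_mono) auto
    then have "(\<Lambda> / n ^ 4)\<^sup>2 / (2 * \<tau> * s) \<le> (\<Lambda> / n ^ 4)\<^sup>2 / (2 * \<tau> * (1 / (real n)\<^sup>2))"
      by (intro frac_le) auto
    then have "exp ((\<Lambda> / n ^ 4)\<^sup>2 / (2 * \<tau> * s)) \<le> exp ((\<Lambda> / n ^ 4)\<^sup>2 / (2 * \<tau> * (1 / (real n)\<^sup>2)))" by simp
    then have "sqrt ((1 + 1 / n) * (1 + \<tau>)) * exp ((\<Lambda> / n ^ 4)\<^sup>2 / (2 * \<tau> * s))
      \<le> sqrt ((1 + 1 / n) * (1 + \<tau>)) * exp ((\<Lambda> / n ^ 4)\<^sup>2 / (2 * \<tau> * (1 / (real n)\<^sup>2)))"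
      using \<tau> by (intro mult_left_mono) auto
    then show "sqrt ((1 + 1 / n) * (1 + \<tau>)) * exp ((\<Lambda> / n ^ 4)\<^sup>2 / (2 * \<tau> * s)) \<le> 1 + \<tau>" using C by linarith
  qed
  finally show ?thesis by (simp add: grid_bracket_def s_def s'_def \<theta>'_def c_def)
qed

lemma lik_le_prod:
  assumes "\<And>i. i < n \<Longrightarrow> ldens (fnet p k (fst \<omega>)) (snd \<omega>) (fst (D i)) (snd (D i)) \<le> u (D i)"
  shows "lik p k n D \<omega> \<le> (\<Prod>i<n. u (D i))"
  unfolding lik_def using assms by (intro prod_mono) (auto simp: ldens_nonneg)

text \<open>Union bound over the grid brackets and the constant bracket. The value
  \<open>\<tau> = (e / 4)\<^sup>2\<close> turns the affinity bound
  \<open>1 - e / 2 + sqrt \<tau>\<close> into \<open>1 - e / 4\<close>, which is at most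
  \<open>exp (- (e / 4))\<close>. The exceptional event does not depend on the parameter.\<close>

lemma sieve_event:
  fixes n k :: nat and e :: real
  defines "\<Lambda> \<equiv> 1 + real k + real k * real n * (real p + 1)" and "\<tau> \<equiv> (e / 4)\<^sup>2" and "K \<equiv> Knum p k"
  assumes n: "n > 0" and e: "0 < e" "e \<le> 2"
    and C: "sqrt ((1 + 1 / n) * (1 + \<tau>)) * exp ((\<Lambda> / n ^ 4)\<^sup>2 / (2 * \<tau> * (1 / (real n)\<^sup>2))) \<le> 1 + \<tau>"
  shows "\<exists>E\<in>sets (P0 n).
    measure (P0 n) E \<le> (card (grid_set K n (64 * \<sigma>0\<^sup>2)) + 1) * exp (- (e / 4) * n / 2) \<and>
    (\<forall>D\<in>space (P0 n) - E. (\<forall>i<n. \<forall>h<p. 0 \<le> snd (D i) h \<and> snd (D i) h \<le> 1) \<longrightarrow>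
       (\<forall>\<omega>\<in>sieve K n. ennreal e \<le> dH p f0 \<sigma>0 k \<omega> \<longrightarrow> lik p k n D \<omega> \<le> exp (- (e / 4) * n) * L0 n D))"
proof -
  interpret P: prob_space "P0 n" by (rule prob_space_P0)
  let ?T = "64 * \<sigma>0\<^sup>2"
  have T: "?T > 0" using sigma0_pos by simp
  have \<tau>: "\<tau> > 0" using e by (simp add: \<tau>_def)
  have sq: "sqrt \<tau> = e / 4" using e by (simp add: \<tau>_def)
  define ev where "ev = (\<lambda>u. {D \<in> space (P0 n). exp (- (e / 4) * n) * L0 n D \<le> (\<Prod>i<n. u (D i))})"
  define uT where "uT = (\<lambda>z::real \<times> (nat \<Rightarrow> real). (2 * pi * ?T) powr (-1/2))"
  \<comment> \<open>Only cells meeting the set of distant parameters receive a bracket; any such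
    parameter in the cell serves as the lower function in the affinity bound.\<close>
  define J where "J = {c. \<exists>\<omega>\<in>sieve K n. ennreal e \<le> dH p f0 \<sigma>0 k \<omega> \<and> snd \<omega> \<le> ?T \<and> grid_code K n \<omega> = c}"
  have J: "J \<subseteq> grid_set K n ?T"
  proof
    fix c assume "c \<in> J"
    then obtain \<omega> where "\<omega> \<in> sieve K n" "snd \<omega> \<le> ?T" "grid_code K n \<omega> = c" by (auto simp only: J_def mem_Collect_eq)
    then show "c \<in> grid_set K n ?T" using grid_code_in_grid_set[OF _ _ n] by blast
  qed
  have finJ: "finite J" by (rule finite_subset[OF J finite_grid_set])
  have evT: "ev uT \<in> sets (P0 n) \<and> measure (P0 n) (ev uT) \<le> exp (- (e / 4) * n / 2)"
  proof -
    \<comment> \<open>Here \<open>e \<le> 2\<close> enters: the constant bracket has affinity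
      exactly one half.\<close>
    have "1 / 2 \<le> exp (- (e / 4))" using exp_ge_add_one_self[of "- (e / 4)"] e by linarith
    then have "(\<integral>\<^sup>+ z. ennreal (sqrt (uT z * l0 z)) \<partial>YX p) \<le> ennreal (exp (- (e / 4)))"
      unfolding uT_def nn_integral_tail_affinity by (rule ennreal_leI)
    then show ?thesis unfolding ev_def by (intro conjI prob_bracket_le) (auto simp: uT_def)
  qed
  have evJ: "ev (grid_bracket k n \<tau> c) \<in> sets (P0 n) \<and> measure (P0 n) (ev (grid_bracket k n \<tau> c)) \<le> exp (- (e / 4) * n / 2)"
    if c: "c \<in> J" for c
  proof -
    obtain \<omega> where w: "\<omega> \<in> sieve K n" "ennreal e \<le> dH p f0 \<sigma>0 k \<omega>" "grid_code K n \<omega> = c"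
      using c by (auto simp: J_def)
    let ?l = "\<lambda>z. ldens (fnet p k (fst \<omega>)) (snd \<omega>) (fst z) (snd z)"
    have s: "snd \<omega> > 0"
    proof -
      have "1 / (real n)\<^sup>2 \<le> snd \<omega>" using w(1) by (simp add: sieve_def)
      moreover have "0 < 1 / (real n)\<^sup>2" using n by simp
      ultimately show ?thesis by linarith
    qed
    have gnn: "0 \<le> grid_bracket k n \<tau> c z" for z
      using \<tau> by (simp add: grid_bracket_def ldens_nonneg)
    have "0 < snd c" using s n w(3) by (auto simp: grid_code_def)
    then have sc: "0 < real (snd c) / real n ^ 3 * (1 + \<tau>)" using n \<tau> by simp
    have "(\<integral>\<^sup>+ z. ennreal (sqrt (grid_bracket k n \<tau> c z * l0 z)) \<partial>YX p) \<le> ennreal (1 - e / 2 + sqrt \<tau>)"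
    proof (rule nn_integral_bracket_affinity[where l = ?l])
      show "?l \<in> borel_measurable (YX p)" using fnet_measurable_x by (intro ldens_measurable) auto
      show "(\<integral>\<^sup>+ z. ennreal (?l z) \<partial>YX p) = 1" by (rule nn_integral_ldens[OF fnet_measurable_x s])
      show "AE z in YX p. ?l z \<le> grid_bracket k n \<tau> c z"
        using AE_YX
      proof eventually_elim
        case (elim z)
        show ?case using ldens_le_grid_bracket[OF n \<tau> C[unfolded \<Lambda>_def], of \<omega> z] w(1,3) elim
          by (simp add: K_def)
      qed
      let ?g = "\<lambda>z. ldens (fnet p k (\<lambda>i. real_of_int (fst c i) / real n ^ 4)) (real (snd c) / real n ^ 3 * (1 + \<tau>)) (fst z) (snd z)"
      have "?g \<in> borel_measurable (YX p)" using fnet_measurable_x by (intro ldens_measurable) auto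
      moreover have "ennreal (grid_bracket k n \<tau> c z) = ennreal (1 + \<tau>) * ennreal (?g z)" for z
        unfolding grid_bracket_def using \<tau> by (intro ennreal_mult ldens_nonneg) simp
      ultimately have "(\<integral>\<^sup>+ z. ennreal (grid_bracket k n \<tau> c z) \<partial>YX p) = ennreal (1 + \<tau>) * (\<integral>\<^sup>+ z. ennreal (?g z) \<partial>YX p)"
        by (simp only:) (rule nn_integral_cmult, rule measurable_compose[OF _ measurable_ennreal])
      also have "\<dots> = ennreal (1 + \<tau>)" by (simp only: nn_integral_ldens[OF fnet_measurable_x sc] mult_1_right)
      finally show "(\<integral>\<^sup>+ z. ennreal (grid_bracket k n \<tau> c z) \<partial>YX p) \<le> ennreal (1 + \<tau>)" by simp
      show "ennreal e \<le> (\<integral>\<^sup>+ z. ennreal ((sqrt (?l z) - sqrt (l0 z))\<^sup>2) \<partial>YX p)"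
        using w(2) by (simp add: dH_eq)
    qed (use e \<tau> gnn grid_bracket_measurable in \<open>auto simp: ldens_nonneg\<close>)
    also have "\<dots> \<le> ennreal (exp (- (e / 4)))"
      using exp_ge_add_one_self[of "- (e / 4)"] by (intro ennreal_leI) (simp add: sq)
    finally show ?thesis unfolding ev_def
      using gnn grid_bracket_measurable by (intro conjI prob_bracket_le) auto
  qed
  define E where "E = ev uT \<union> (\<Union>c\<in>J. ev (grid_bracket k n \<tau> c))"
  have UJ: "(\<Union>c\<in>J. ev (grid_bracket k n \<tau> c)) \<in> sets (P0 n)"
    using evJ by (intro sets.finite_UN finJ) blast
  have E_sets: "E \<in> sets (P0 n)" unfolding E_def using evT UJ by blast
  have "measure (P0 n) E \<le> measure (P0 n) (ev uT) + measure (P0 n) (\<Union>c\<in>J. ev (grid_bracket k n \<tau> c))"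
    unfolding E_def using evT UJ by (intro measure_Un_le) blast+
  also have "measure (P0 n) (\<Union>c\<in>J. ev (grid_bracket k n \<tau> c)) \<le> (\<Sum>c\<in>J. measure (P0 n) (ev (grid_bracket k n \<tau> c)))"
    using evJ by (intro P.finite_measure_subadditive_finite finJ) blast
  also have "\<dots> \<le> (\<Sum>c\<in>J. exp (- (e / 4) * n / 2))" using evJ by (intro sum_mono) blast
  also have "\<dots> = card J * exp (- (e / 4) * n / 2)" by simp
  also have "\<dots> \<le> card (grid_set K n ?T) * exp (- (e / 4) * n / 2)"
    using card_mono[OF finite_grid_set J] by (intro mult_right_mono) auto
  finally have "measure (P0 n) E \<le> (card (grid_set K n ?T) + 1) * exp (- (e / 4) * n / 2)"
    using evT by (simp add: algebra_simps)
  moreover have "lik p k n D \<omega> \<le> exp (- (e / 4) * n) * L0 n D"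
    if D: "D \<in> space (P0 n) - E" and cube: "\<forall>i<n. \<forall>h<p. 0 \<le> snd (D i) h \<and> snd (D i) h \<le> 1"
      and w: "\<omega> \<in> sieve K n" "ennreal e \<le> dH p f0 \<sigma>0 k \<omega>" for D \<omega>
  proof (cases "snd \<omega> \<le> ?T")
    case True
    define c where "c = grid_code K n \<omega>"
    have "c \<in> J" using w True by (auto simp: J_def c_def)
    then have "D \<notin> ev (grid_bracket k n \<tau> c)" using D by (auto simp: E_def)
    then have "(\<Prod>i<n. grid_bracket k n \<tau> c (D i)) < exp (- (e / 4) * n) * L0 n D"
      using D by (auto simp: ev_def not_le)
    moreover have "lik p k n D \<omega> \<le> (\<Prod>i<n. grid_bracket k n \<tau> c (D i))"
    proof (rule lik_le_prod)
      fix i assume "i < n"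
      then show "ldens (fnet p k (fst \<omega>)) (snd \<omega>) (fst (D i)) (snd (D i)) \<le> grid_bracket k n \<tau> c (D i)"
        using ldens_le_grid_bracket[OF n \<tau> C[unfolded \<Lambda>_def], of \<omega> "D i"] w(1) cube by (simp add: K_def c_def)
    qed
    ultimately show ?thesis by linarith
  next
    case False
    have "D \<notin> ev uT" using D by (auto simp: E_def)
    then have "(\<Prod>i<n. uT (D i)) < exp (- (e / 4) * n) * L0 n D"
      using D by (auto simp: ev_def not_le)
    moreover have "lik p k n D \<omega> \<le> (\<Prod>i<n. uT (D i))"
      unfolding uT_def using False T by (intro lik_le_prod ldens_le_tail) auto
    ultimately show ?thesis by linarith
  qed
  ultimately show ?thesis using E_sets by (intro bexI[of _ E]) auto
qed

end

section \<open>Finite-sample bound\<close>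

text \<open>The tilt \<open>T = \<kappa> + A\<close> depends on the data through the log evidence ratio \<open>A\<close>; nonnegativity of the
  divergence bound \<open>EP + A\<close> prevents \<open>A\<close> from being very negative.\<close>

lemma measure_le_of_dKL:
  assumes [measurable]: "q \<in> borel_measurable M" "\<pi> \<in> borel_measurable M" "U \<in> sets M"
    and q: "\<And>w. 0 \<le> q w" "(\<integral>\<^sup>+ w. ennreal (q w) \<partial>M) = 1" and pi: "\<And>w. 0 \<le> \<pi> w"
    and KL: "0 \<le> EP + A" "dKL M q \<pi> \<le> ennreal (EP + A)"
    and A: "A \<le> r1" and EP: "EP \<le> r2" and r2: "2 * r2 \<le> \<kappa>" and \<kappa>: "\<kappa> > 0"
    and post: "(\<integral>\<^sup>+ w. ennreal (\<pi> w) * indicator U w \<partial>M) \<le> ennreal (2 * exp (- \<kappa> - A))"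
  shows "measure (density M q) U \<le> 2 * (r1 + r2 + 2) / \<kappa>"
proof -
  define T where "T = \<kappa> + A"
  define x where "x = measure (density M q) U"
  \<comment> \<open>\<open>A \<ge> - EP \<ge> - r2 \<ge> - \<kappa> / 2\<close>, so the tilt keeps
    at least half of \<open>\<kappa>\<close>.\<close>
  have T: "\<kappa> / 2 \<le> T" using KL(1) EP r2 by (simp add: T_def)
  have T0: "T > 0" using T \<kappa> by linarith
  have "emeasure (density M q) (space (density M q)) = 1"
    using q(2) by (subst emeasure_density) (auto cong: nn_integral_cong)
  then interpret Q: prob_space "density M q" by (rule prob_spaceI)
  have "ennreal (T * x) = ennreal T * emeasure (density M q) U"
    using T0 by (simp add: x_def Q.emeasure_eq_measure ennreal_mult)
  also have "\<dots> \<le> dKL M q \<pi> + ennreal (exp T) * (\<integral>\<^sup>+ w. ennreal (\<pi> w) * indicator U w \<partial>M)"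
    using q pi T0 by (intro dKL_Gibbs) auto
  also have "\<dots> \<le> ennreal (EP + A) + ennreal (exp T) * ennreal (2 * exp (- \<kappa> - A))"
    using KL post by (intro add_mono mult_left_mono) auto
  also have "ennreal (exp T) * ennreal (2 * exp (- \<kappa> - A)) = ennreal (exp T * (2 * exp (- \<kappa> - A)))"
    by (rule ennreal_mult[symmetric]) auto
  also have "exp T * (2 * exp (- \<kappa> - A)) = 2" by (simp add: T_def flip: exp_add)
  also have "ennreal (EP + A) + ennreal 2 = ennreal (EP + A + 2)"
    using KL(1) by (intro ennreal_plus[symmetric]) auto
  finally have "T * x \<le> EP + A + 2"
    using KL(1) by (subst (asm) ennreal_le_iff) auto
  then have "T * x \<le> r1 + r2 + 2" using A EP by linarith
  moreover have "\<kappa> / 2 * x \<le> T * x" using T by (intro mult_right_mono) (auto simp: x_def)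
  ultimately have "\<kappa> / 2 * x \<le> r1 + r2 + 2" by linarith
  then show ?thesis using \<kappa> by (simp add: x_def field_simps)
qed

context regression
begin

text \<open>\<open>L2norm\<close> is a Bochner integral with default value 0. Square integrability
  of \<open>f0\<close> and boundedness of the network show that it measures the true error.\<close>

lemma nn_integral_approx_error:
  assumes f0: "integrable (Xmeas p) (\<lambda>x. (f0 x)\<^sup>2)"
  shows "(\<integral>\<^sup>+ x. ennreal ((f0 x - fnet p k \<theta> x)\<^sup>2) \<partial>Xmeas p) = ennreal ((L2norm p (\<lambda>x. fnet p k \<theta> x - f0 x))\<^sup>2)"
proof -
  interpret X: prob_space "Xmeas p" by (rule prob_space_Xmeas)
  note fnet_measurable_x[measurable]
  define C where "C = \<bar>\<theta> 0\<bar> + (\<Sum>j\<in>{1..k}. \<bar>\<theta> j\<bar>)"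
  have int: "integrable (Xmeas p) (\<lambda>x. (fnet p k \<theta> x - f0 x)\<^sup>2)"
  proof (rule Bochner_Integration.integrable_bound)
    show "integrable (Xmeas p) (\<lambda>x. 2 * (f0 x)\<^sup>2 + 2 * C\<^sup>2)" using f0 by auto
    have "(fnet p k \<theta> x - f0 x)\<^sup>2 \<le> 2 * (f0 x)\<^sup>2 + 2 * C\<^sup>2" for x
    proof -
      have "(fnet p k \<theta> x)\<^sup>2 \<le> C\<^sup>2" using abs_fnet_le[of p k \<theta> x] unfolding C_def
        by (intro abs_le_square_iff[THEN iffD1]) simp
      then show ?thesis using square_sum_le[of 1 "fnet p k \<theta> x" "- f0 x"] by simp
    qed
    then show "AE x in Xmeas p. norm ((fnet p k \<theta> x - f0 x)\<^sup>2) \<le> norm (2 * (f0 x)\<^sup>2 + 2 * C\<^sup>2)" by auto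
  qed measurable
  have "(\<integral>\<^sup>+ x. ennreal ((f0 x - fnet p k \<theta> x)\<^sup>2) \<partial>Xmeas p) = ennreal (\<integral>x. (fnet p k \<theta> x - f0 x)\<^sup>2 \<partial>Xmeas p)"
    using int by (subst nn_integral_eq_integral[symmetric]) (auto simp: power2_commute)
  then show ?thesis by (simp add: L2norm_def)
qed

text \<open>Excludes a zero denominator in \<open>post_dens\<close>: likelihood and prior are
  positive at every positive scale, and the prior has mass one.\<close>

lemma evidence_pos:
  assumes D: "D \<in> space (P0 n)" and pos: "\<alpha> > 0" "lam > 0" "\<zeta> > 0"
  shows "(\<integral>\<^sup>+ \<omega>. ennreal (lik p k n D \<omega> * prior_dens \<alpha> lam \<zeta> (Knum p k) \<omega>) \<partial>params k) \<noteq> 0"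
proof
  let ?M = "params k" and ?pr = "prior_dens \<alpha> lam \<zeta> (Knum p k)"
  have v: "vvalid (Knum p k) (\<alpha>, lam, (\<lambda>_. 0), (\<lambda>_. \<zeta>))" using pos by (simp add: vvalid_def)
  assume "(\<integral>\<^sup>+ \<omega>. ennreal (lik p k n D \<omega> * ?pr \<omega>) \<partial>?M) = 0"
  moreover have "(\<lambda>\<omega>. ennreal (lik p k n D \<omega> * ?pr \<omega>)) \<in> borel_measurable ?M"
    by (intro measurable_compose[OF _ measurable_ennreal] borel_measurable_times lik_measurable_param[OF D] prior_dens_measurable)
  ultimately have "AE \<omega> in ?M. ennreal (lik p k n D \<omega> * ?pr \<omega>) = 0" by (simp add: nn_integral_0_iff_AE)
  then have "AE \<omega> in ?M. ennreal (?pr \<omega>) = 0"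
  proof eventually_elim
    case (elim \<omega>)
    show ?case
    proof (cases "snd \<omega> > 0")
      case True
      then have "0 < lik p k n D \<omega> * ?pr \<omega>"
        using lik_pos vdens_pos_iff[OF v] by (simp add: prior_dens_eq_vdens)
      then show ?thesis using elim by (simp add: ennreal_eq_0_iff)
    next
      case False
      then show ?thesis using vdens_pos_iff[OF v, of \<omega>] by (simp add: prior_dens_eq_vdens ennreal_eq_0_iff not_less)
    qed
  qed
  then have "(\<integral>\<^sup>+ \<omega>. ennreal (?pr \<omega>) \<partial>?M) = 0" by (subst nn_integral_0_iff_AE) auto
  then show False using nn_integral_vdens[OF v] by (simp add: prior_dens_eq_vdens)
qed

lemma nn_integral_prior: "\<alpha> > 0 \<Longrightarrow> lam > 0 \<Longrightarrow> \<zeta> > 0 \<Longrightarrow> (\<integral>\<^sup>+ \<omega>. ennreal (prior_dens \<alpha> lam \<zeta> K \<omega>) \<partial>param_meas K) = 1"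
  unfolding prior_dens_eq_vdens by (rule nn_integral_vdens) (simp add: vvalid_def)

text \<open>The four summands bound four exceptional events: an evidence ratio above
  \<open>exp r1\<close>, a candidate cost above \<open>r2\<close>, a failing bracket, and too much
  evidence outside the sieve. \<open>A0\<close>, \<open>A1\<close>, \<open>A2\<close> regroup the
  cost into a deterministic part and multiples of squared noise and squared approximation
  error.\<close>

lemma variational_tail_bound:
  fixes n k :: nat and \<theta>0 :: "nat \<Rightarrow> real" and \<alpha> lam \<zeta> t \<tau> R e e' r1 r2 B :: real
    and v :: "(nat \<Rightarrow> real \<times> (nat \<Rightarrow> real)) \<Rightarrow> vparam"
  defines "K \<equiv> Knum p k"
  defines "c \<equiv> (real n + 1) / (real n * \<sigma>0\<^sup>2)"
    and "C0 \<equiv> \<alpha> * \<bar>ln (\<sigma>0\<^sup>2) + 1\<bar> + ln (Gamma \<alpha>) - \<alpha> * ln lam"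
    and "\<Lambda> \<equiv> 1 + real k + real k * R * (real p + 1)"
    and "\<Lambda>' \<equiv> 1 + real k + real k * real n * (real p + 1)"
    and "\<tau>' \<equiv> (e / 4)\<^sup>2"
  defines "A0 \<equiv> K * ln (\<zeta> / t) + (\<Sum>i<K. (\<theta>0 i)\<^sup>2) / \<zeta>\<^sup>2 + ln n + C0 + K * t\<^sup>2 / \<zeta>\<^sup>2
      + c * (\<sigma>0\<^sup>2 + lam + (1 + 1 / \<tau>) * n * \<Lambda>\<^sup>2 * (K * t\<^sup>2))"
    and "A1 \<equiv> c * (1 + \<tau>) / 2 - 1 / (2 * \<sigma>0\<^sup>2)"
    and "A2 \<equiv> c * (1 + 1 / \<tau>)"
  assumes f0: "integrable (Xmeas p) (\<lambda>x. (f0 x)\<^sup>2)"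
    and n: "n > 0" "\<alpha> \<le> real n"
    and pos: "\<alpha> > 0" "lam > 0" "\<zeta> > 0" "t > 0" "\<tau> > 0"
    and R: "\<And>i. i < K \<Longrightarrow> \<bar>\<theta>0 i\<bar> \<le> R"
    and e: "0 < e" "e \<le> 2" "e \<le> e'"
    and C: "sqrt ((1 + 1 / n) * (1 + \<tau>')) * exp ((\<Lambda>' / n ^ 4)\<^sup>2 / (2 * \<tau>' * (1 / (real n)\<^sup>2))) \<le> 1 + \<tau>'"
    and r: "r2 > 0" "2 * r2 \<le> e / 4 * n"
    and B: "\<bar>A0\<bar> + A1 * (n * \<sigma>0\<^sup>2) + A2 * (n * (L2norm p (\<lambda>x. fnet p k \<theta>0 x - f0 x))\<^sup>2) \<le> B"
    and v: "AE D in P0 n. vvalid K (v D) \<and>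
          (\<forall>w. vvalid K w \<longrightarrow>
             dKL (param_meas K) (vdens K (v D)) (post_dens p \<alpha> lam \<zeta> k n D)
             \<le> dKL (param_meas K) (vdens K w) (post_dens p \<alpha> lam \<zeta> k n D))"
  shows "outer_meas (P0 n) {D \<in> space (P0 n).
      2 * (r1 + r2 + 2) / (e / 4 * n) <
      \<bar>outer_meas (density (param_meas K) (\<lambda>\<omega>. ennreal (vdens K (v D) \<omega>))) (space (param_meas K) - Vnbhd p f0 \<sigma>0 k e')\<bar>}
    \<le> exp (- r1) + B / r2 + (card (grid_set K n (64 * \<sigma>0\<^sup>2)) + 1) * exp (- (e / 4) * n / 2)
      + exp (e / 4 * n) * (2 powr \<alpha> * exp (- lam * (real n)\<^sup>2 / 2) + K * (sqrt 2 * exp (- (real n)\<^sup>2 / (4 * \<zeta>\<^sup>2))))"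
proof -
  let ?joint = "\<lambda>D \<omega>. ennreal (lik p k n D \<omega> * prior_dens \<alpha> lam \<zeta> K \<omega>)"
  let ?\<xi> = "\<lambda>D i. fst (D i) - f0 (snd (D i))" and ?g = "\<lambda>D i. f0 (snd (D i)) - fnet p k \<theta>0 (snd (D i))"
  interpret P: prob_space "P0 n" by (rule prob_space_P0)
  let ?M = "param_meas K" and ?pr = "prior_dens \<alpha> lam \<zeta> K"
  let ?Q = "\<lambda>D. density ?M (\<lambda>\<omega>. ennreal (vdens K (v D) \<omega>))" and ?post = "post_dens p \<alpha> lam \<zeta> k n"
  define U where "U = space ?M - Vnbhd p f0 \<sigma>0 k e'"
  define \<kappa> where "\<kappa> = e / 4 * n"
  define ev where "ev = (\<lambda>S D. \<integral>\<^sup>+ \<omega>. ?joint D \<omega> * indicator S \<omega> \<partial>?M)"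
  define W where "W = space ?M - sieve K n"
  define w where "w = 2 powr \<alpha> * exp (- lam * (real n)\<^sup>2 / 2) + K * (sqrt 2 * exp (- (real n)\<^sup>2 / (4 * \<zeta>\<^sup>2)))"
  define \<Xi> where "\<Xi> = (\<lambda>D::nat \<Rightarrow> real \<times> (nat \<Rightarrow> real). \<Sum>i<n. (?\<xi> D i)\<^sup>2)"
  define \<Gamma> where "\<Gamma> = (\<lambda>D::nat \<Rightarrow> real \<times> (nat \<Rightarrow> real). \<Sum>i<n. (?g D i)\<^sup>2)"
  define EP where "EP = (\<lambda>D. A0 + A1 * \<Xi> D + A2 * \<Gamma> D)"
  \<comment> \<open>A nonnegative majorant of \<open>EP\<close>, with \<open>A0\<close> replaced by
    its modulus, so that Markov's inequality applies.\<close>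
  define X where "X = (\<lambda>D. ennreal \<bar>A0\<bar> + ennreal A1 * (\<Sum>i<n. ennreal ((?\<xi> D i)\<^sup>2))
      + ennreal A2 * (\<Sum>i<n. ennreal ((?g D i)\<^sup>2)))"
  have s0: "\<sigma>0\<^sup>2 > 0" using sigma0_pos by simp
  have \<kappa>: "\<kappa> > 0" using e n by (simp add: \<kappa>_def)
  have c: "c > 0" using n s0 by (simp add: c_def)
  \<comment> \<open>The shape \<open>n + 1\<close> against rate \<open>n * \<sigma>0\<^sup>2\<close>
    makes \<open>c\<close> slightly larger than \<open>1 / \<sigma>0\<^sup>2\<close>; this gives the
    sign.\<close>
  have A1: "A1 \<ge> 0"
  proof -
    have "1 / \<sigma>0\<^sup>2 \<le> c" using n s0 by (simp add: c_def field_simps)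
    also have "\<dots> \<le> c * (1 + \<tau>)" using c pos by (simp add: algebra_simps)
    finally have "1 / \<sigma>0\<^sup>2 / 2 \<le> c * (1 + \<tau>) / 2" by (rule divide_right_mono) simp
    then show ?thesis by (simp add: A1_def)
  qed
  have A2: "A2 \<ge> 0" using c pos by (simp add: A2_def)
  have U: "U \<in> sets ?M" unfolding U_def K_def by (rule Vnbhd_compl_sets)
  have W: "W \<in> sets ?M" unfolding W_def using sieve_sets by auto
  have w0: "0 \<le> w" by (simp add: w_def)
  have ev_meas: "ev S \<in> borel_measurable (P0 n)" if "S \<in> sets ?M" for S
    unfolding ev_def K_def using that by (intro evidence_measurable) (simp add: K_def)
  have ev_int: "(\<integral>\<^sup>+ D. ennreal (1 / L0 n D) * ev S D \<partial>P0 n) = (\<integral>\<^sup>+ \<omega>. ennreal (?pr \<omega>) * indicator S \<omega> \<partial>?M)"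
    if "S \<in> sets ?M" for S
    unfolding ev_def K_def using that pos by (intro nn_integral_P0_evidence) (simp_all add: K_def)
  have ratio_meas: "(\<lambda>D. ennreal (1 / L0 n D) * ev S D) \<in> borel_measurable (P0 n)" if "S \<in> sets ?M" for S
    by (intro borel_measurable_times_ennreal measurable_compose[OF _ measurable_ennreal] borel_measurable_divide L0_measurable ev_meas that) auto
  define E1 where "E1 = {D \<in> space (P0 n). ennreal (exp r1) \<le> ennreal (1 / L0 n D) * ev (space ?M) D}"
  define E2 where "E2 = {D \<in> space (P0 n). ennreal r2 \<le> X D}"
  define E4 where "E4 = {D \<in> space (P0 n). ennreal (exp (- \<kappa>)) \<le> ennreal (1 / L0 n D) * ev W D}"
  obtain E3 where E3: "E3 \<in> sets (P0 n)"
    "measure (P0 n) E3 \<le> (card (grid_set K n (64 * \<sigma>0\<^sup>2)) + 1) * exp (- (e / 4) * n / 2)"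
    "\<And>D \<omega>. D \<in> space (P0 n) \<Longrightarrow> D \<notin> E3 \<Longrightarrow> (\<forall>i<n. \<forall>h<p. 0 \<le> snd (D i) h \<and> snd (D i) h \<le> 1) \<Longrightarrow>
       \<omega> \<in> sieve K n \<Longrightarrow> ennreal e \<le> dH p f0 \<sigma>0 k \<omega> \<Longrightarrow> lik p k n D \<omega> \<le> exp (- \<kappa>) * L0 n D"
    using sieve_event[OF n(1) e(1,2) C[unfolded \<tau>'_def \<Lambda>'_def]] unfolding K_def \<kappa>_def by auto
  have noise_meas: "(\<lambda>z. ennreal ((fst z - f0 (snd z))\<^sup>2)) \<in> borel_measurable (YX p)" by measurable
  have design_meas: "(\<lambda>x. ennreal ((f0 x - fnet p k \<theta>0 x)\<^sup>2)) \<in> borel_measurable (Xmeas p)"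
    using fnet_measurable_x by (intro measurable_compose[OF _ measurable_ennreal] borel_measurable_power borel_measurable_diff f0_measurable)
  note design_meas' = measurable_compose[OF measurable_snd design_meas, of "lborel :: real measure"]
  have sum_meas: "(\<lambda>D. \<Sum>i<n. ennreal ((?\<xi> D i)\<^sup>2)) \<in> borel_measurable (P0 n)"
    "(\<lambda>D. \<Sum>i<n. ennreal ((?g D i)\<^sup>2)) \<in> borel_measurable (P0 n)"
    using measurable_compose[OF P0_coord noise_meas] measurable_compose[OF P0_coord design_meas']
    by (auto intro!: borel_measurable_sum)
  have X_meas: "X \<in> borel_measurable (P0 n)" unfolding X_def
    by (intro borel_measurable_add borel_measurable_times_ennreal sum_meas) auto
  have E1: "E1 \<in> sets (P0 n)" "measure (P0 n) E1 \<le> 1 / exp r1"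
  proof -
    note ratio_meas[OF sets.top, measurable]
    show "E1 \<in> sets (P0 n)" unfolding E1_def by measurable
    have "(\<integral>\<^sup>+ \<omega>. ennreal (?pr \<omega>) * indicator (space ?M) \<omega> \<partial>?M) = (\<integral>\<^sup>+ \<omega>. ennreal (?pr \<omega>) \<partial>?M)"
      by (intro nn_integral_cong) simp
    then show "measure (P0 n) E1 \<le> 1 / exp r1" unfolding E1_def
      using pos by (intro P.measure_Markov_nn ratio_meas) (auto simp: ev_int nn_integral_prior)
  qed
  have E4: "E4 \<in> sets (P0 n)" "measure (P0 n) E4 \<le> w / exp (- \<kappa>)"
  proof -
    note ratio_meas[OF W, measurable]
    show "E4 \<in> sets (P0 n)" unfolding E4_def by measurable
    have "(\<integral>\<^sup>+ \<omega>. ennreal (?pr \<omega>) * indicator W \<omega> \<partial>?M) \<le> ennreal w"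
      unfolding W_def w_def using pos n by (intro prior_sieve_compl) auto
    then show "measure (P0 n) E4 \<le> w / exp (- \<kappa>)" unfolding E4_def
      using w0 W by (intro P.measure_Markov_nn ratio_meas) (auto simp: ev_int)
  qed
  have E2: "E2 \<in> sets (P0 n)" "measure (P0 n) E2 \<le> B / r2"
  proof -
    note X_meas[measurable]
    show "E2 \<in> sets (P0 n)" unfolding E2_def by measurable
    define L where "L = (L2norm p (\<lambda>x. fnet p k \<theta>0 x - f0 x))\<^sup>2"
    have L: "L \<ge> 0" by (simp add: L_def)
    have "(\<integral>\<^sup>+ D. X D \<partial>P0 n) = ennreal \<bar>A0\<bar>
       + ennreal A1 * (\<integral>\<^sup>+ D. (\<Sum>i<n. ennreal ((?\<xi> D i)\<^sup>2)) \<partial>P0 n)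
       + ennreal A2 * (\<integral>\<^sup>+ D. (\<Sum>i<n. ennreal ((?g D i)\<^sup>2)) \<partial>P0 n)"
      unfolding X_def using sum_meas
      by (simp add: nn_integral_add nn_integral_cmult P.emeasure_space_1)
    also have "(\<integral>\<^sup>+ D. (\<Sum>i<n. ennreal ((?\<xi> D i)\<^sup>2)) \<partial>P0 n) = of_nat n * ennreal (\<sigma>0\<^sup>2)"
      using nn_integral_P0_sum[OF noise_meas, of n] by (simp add: nn_integral_obs_noise)
    also have "(\<integral>\<^sup>+ D. (\<Sum>i<n. ennreal ((?g D i)\<^sup>2)) \<partial>P0 n) = of_nat n * ennreal L"
      using nn_integral_P0_sum[OF design_meas', of n] nn_integral_obs_design[OF design_meas]
      by (simp add: nn_integral_approx_error[OF f0] L_def)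
    also have "ennreal \<bar>A0\<bar> + ennreal A1 * (of_nat n * ennreal (\<sigma>0\<^sup>2)) + ennreal A2 * (of_nat n * ennreal L)
      = ennreal (\<bar>A0\<bar> + A1 * (n * \<sigma>0\<^sup>2) + A2 * (n * L))"
      using A1 A2 s0 L by (simp add: ennreal_plus ennreal_mult ennreal_of_nat_eq_real_of_nat)
    also have "\<dots> \<le> ennreal B" using B by (intro ennreal_leI) (simp add: L_def)
    finally have "(\<integral>\<^sup>+ D. X D \<partial>P0 n) \<le> ennreal B" .
    moreover have "0 \<le> \<bar>A0\<bar> + A1 * (n * \<sigma>0\<^sup>2) + A2 * (n * L)" using A1 A2 s0 L by simp
    then have "0 \<le> B" using B by (simp add: L_def)
    ultimately show "measure (P0 n) E2 \<le> B / r2" unfolding E2_def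
      using r by (intro P.measure_Markov_nn X_meas) auto
  qed
  have key: "measure (?Q D) U \<le> 2 * (r1 + r2 + 2) / \<kappa>"
    if D: "D \<in> space (P0 n)" and notE: "D \<notin> E1" "D \<notin> E2" "D \<notin> E3" "D \<notin> E4"
      and cube: "\<forall>i<n. \<forall>h<p. 0 \<le> snd (D i) h \<and> snd (D i) h \<le> 1"
      and vD: "vvalid K (v D)" "\<And>w. vvalid K w \<Longrightarrow>
             dKL ?M (vdens K (v D)) (?post D) \<le> dKL ?M (vdens K w) (?post D)" for D
  proof -
    have L0: "L0 n D > 0" by (rule L0_pos)
    have pr: "0 \<le> ?pr \<omega>" for \<omega>
      unfolding prior_dens_eq_vdens using pos by (intro vdens_nonneg) (simp add: vvalid_def)
    have joint_meas: "(\<lambda>\<omega>. lik p k n D \<omega> * ?pr \<omega>) \<in> borel_measurable ?M"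
      unfolding K_def by (intro borel_measurable_times lik_measurable_param[OF D] prior_dens_measurable)
    have ev_all: "ev (space ?M) D = (\<integral>\<^sup>+ \<omega>. ?joint D \<omega> \<partial>?M)"
      unfolding ev_def by (intro nn_integral_cong) simp
    have lt: "ennreal (1 / L0 n D) * ev (space ?M) D < ennreal (exp r1)"
      using notE(1) D by (simp add: E1_def not_le)
    \<comment> \<open>\<open>enn2real\<close> sends infinity to 0, which would make
      \<open>post_dens\<close> vanish; finiteness holds off \<open>E1\<close>.\<close>
    then have "ev (space ?M) D \<noteq> \<top>"
      using L0 by (auto simp: ennreal_mult_top)
    then obtain m where m: "ev (space ?M) D = ennreal m" "m \<ge> 0" by (cases "ev (space ?M) D") auto
    have "m \<noteq> 0" using evidence_pos[OF D pos(1-3), of k] m ev_all by (auto simp: K_def)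
    then have m0: "m > 0" using m(2) by simp
    have "ennreal (m / L0 n D) < ennreal (exp r1)"
      using lt m L0 ennreal_mult'[of "1 / L0 n D" m] by simp
    then have "m / L0 n D < exp r1" using m0 L0 by (subst (asm) ennreal_less_iff) auto
    then have "ln (m / L0 n D) < ln (exp r1)" using m0 L0 by (subst ln_less_cancel_iff) auto
    then have A: "ln (m / L0 n D) \<le> r1" by simp
    have "X D = ennreal (\<bar>A0\<bar> + A1 * \<Xi> D + A2 * \<Gamma> D)"
      unfolding X_def \<Xi>_def \<Gamma>_def using A1 A2
      by (simp add: ennreal_plus ennreal_mult sum_nonneg)
    then have "\<bar>A0\<bar> + A1 * \<Xi> D + A2 * \<Gamma> D < r2"
      using notE(2) D ennreal_leI[of r2 "\<bar>A0\<bar> + A1 * \<Xi> D + A2 * \<Gamma> D"] by (force simp: E2_def)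
    then have EP: "EP D \<le> r2" unfolding EP_def by linarith
    have KL: "0 \<le> EP D + ln (m / L0 n D) \<and>
       dKL ?M (vdens K (real n + 1, real n * \<sigma>0\<^sup>2, \<theta>0, \<lambda>_. t)) (?post D) \<le> ennreal (EP D + ln (m / L0 n D))"
    proof -
      have "EP D = K * ln (\<zeta> / t) + (\<Sum>i<K. (\<theta>0 i)\<^sup>2) / \<zeta>\<^sup>2 + ln n + C0 + K * t\<^sup>2 / \<zeta>\<^sup>2
        + c * (\<sigma>0\<^sup>2 + lam + ((1 + \<tau>) * \<Xi> D + (1 + 1 / \<tau>) * (2 * \<Gamma> D)) / 2 + (1 + 1 / \<tau>) * n * \<Lambda>\<^sup>2 * (K * t\<^sup>2))
        - \<Xi> D / (2 * \<sigma>0\<^sup>2)"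
        unfolding EP_def A0_def A1_def A2_def
        by (simp only: ring_distribs add_divide_distrib diff_divide_distrib) (simp add: algebra_simps)
      then show ?thesis
        using dKL_candidate_le[where n = n and k = k and D = D and m = m and R = R, OF D _ n pos, of \<theta>0] cube R m m0
        unfolding K_def c_def C0_def \<Lambda>_def \<Xi>_def \<Gamma>_def ev_all[unfolded K_def] by simp
    qed
    have vc: "vvalid K (real n + 1, real n * \<sigma>0\<^sup>2, \<theta>0, \<lambda>_. t)" using n pos s0 by (simp add: vvalid_def)
    have post: "?post D \<omega> = lik p k n D \<omega> * ?pr \<omega> / m" for \<omega>
      using m m0 ev_all by (simp add: post_dens_def K_def)
    \<comment> \<open>\<open>U\<close> is split by the sieve: inside, the brackets bound the
      likelihood and the prior integrates to one; outside, \<open>E4\<close> was excluded. Each part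
      contributes \<open>exp (- \<kappa>)\<close>.\<close>
    have "ennreal (1 / L0 n D) * ev U D \<le> ennreal (2 * exp (- \<kappa>))"
    proof -
      have "ev U D \<le> (\<integral>\<^sup>+ \<omega>. ennreal (exp (- \<kappa>) * L0 n D) * ennreal (?pr \<omega>) + ?joint D \<omega> * indicator W \<omega> \<partial>?M)"
        unfolding ev_def
      proof (intro nn_integral_mono)
        fix \<omega> assume w: "\<omega> \<in> space ?M"
        show "?joint D \<omega> * indicator U \<omega>
          \<le> ennreal (exp (- \<kappa>) * L0 n D) * ennreal (?pr \<omega>) + ?joint D \<omega> * indicator W \<omega>"
        proof (cases "\<omega> \<in> U \<and> \<omega> \<in> sieve K n")
          case True
          then have "ennreal e' \<le> dH p f0 \<sigma>0 k \<omega>" by (auto simp: U_def Vnbhd_def K_def not_less)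
          then have "ennreal e \<le> dH p f0 \<sigma>0 k \<omega>" using e(3) by (meson ennreal_leI order_trans)
          then have "lik p k n D \<omega> \<le> exp (- \<kappa>) * L0 n D" using E3(3)[OF D notE(3) cube] True by blast
          then have "lik p k n D \<omega> * ?pr \<omega> \<le> exp (- \<kappa>) * L0 n D * ?pr \<omega>" using pr by (intro mult_right_mono)
          then have "?joint D \<omega> \<le> ennreal (exp (- \<kappa>) * L0 n D * ?pr \<omega>)" by (rule ennreal_leI)
          also have "\<dots> = ennreal (exp (- \<kappa>) * L0 n D) * ennreal (?pr \<omega>)" using L0 pr by (intro ennreal_mult) auto
          finally show ?thesis using True by (simp add: add_increasing2)
        next
          case False
          then show ?thesis using w by (auto simp: W_def indicator_def)
        qed
      qed
      also have "\<dots> = ennreal (exp (- \<kappa>) * L0 n D) * 1 + ev W D"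
      proof -
        have "(\<lambda>\<omega>. ennreal (exp (- \<kappa>) * L0 n D) * ennreal (?pr \<omega>)) \<in> borel_measurable ?M"
          by (intro borel_measurable_times_ennreal measurable_compose[OF prior_dens_measurable measurable_ennreal] measurable_const) simp
        moreover have "(\<lambda>\<omega>. ?joint D \<omega> * indicator W \<omega>) \<in> borel_measurable ?M"
          by (intro borel_measurable_times_ennreal measurable_compose[OF joint_meas measurable_ennreal] borel_measurable_indicator W)
        moreover have "(\<integral>\<^sup>+ \<omega>. ennreal (exp (- \<kappa>) * L0 n D) * ennreal (?pr \<omega>) \<partial>?M) = ennreal (exp (- \<kappa>) * L0 n D) * 1"
          unfolding nn_integral_prior[OF pos(1-3), of K, symmetric]
          by (rule nn_integral_cmult) (rule measurable_compose[OF prior_dens_measurable measurable_ennreal])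
        ultimately show ?thesis by (simp add: nn_integral_add ev_def)
      qed
      finally have "ennreal (1 / L0 n D) * ev U D \<le> ennreal (1 / L0 n D) * (ennreal (exp (- \<kappa>) * L0 n D) * 1 + ev W D)"
        by (rule mult_left_mono) simp
      also have "\<dots> = ennreal (exp (- \<kappa>)) + ennreal (1 / L0 n D) * ev W D"
        using L0 ennreal_mult'[of "1 / L0 n D" "exp (- \<kappa>) * L0 n D"] by (simp add: distrib_left)
      also have "\<dots> \<le> ennreal (exp (- \<kappa>)) + ennreal (exp (- \<kappa>))"
        using notE(4) D by (intro add_mono order_refl) (simp add: E4_def not_le less_imp_le)
      also have "\<dots> = ennreal (2 * exp (- \<kappa>))" by (simp flip: ennreal_plus)
      finally show ?thesis .
    qed
    then have evU: "ennreal (L0 n D / m) * (ennreal (1 / L0 n D) * ev U D) \<le> ennreal (L0 n D / m) * ennreal (2 * exp (- \<kappa>))"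
      by (rule mult_left_mono) simp
    have "(\<integral>\<^sup>+ \<omega>. ennreal (?post D \<omega>) * indicator U \<omega> \<partial>?M) = ennreal (1 / m) * ev U D"
    proof -
      have "(\<lambda>\<omega>. ?joint D \<omega> * indicator U \<omega>) \<in> borel_measurable ?M"
        by (intro borel_measurable_times_ennreal measurable_compose[OF joint_meas measurable_ennreal] borel_measurable_indicator U)
      then have "ennreal (1 / m) * ev U D = (\<integral>\<^sup>+ \<omega>. ennreal (1 / m) * (?joint D \<omega> * indicator U \<omega>) \<partial>?M)"
        unfolding ev_def by (rule nn_integral_cmult[symmetric])
      also have "\<dots> = (\<integral>\<^sup>+ \<omega>. ennreal (?post D \<omega>) * indicator U \<omega> \<partial>?M)"
      proof (intro nn_integral_cong)
        fix \<omega>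
        have "ennreal (1 / m) * ?joint D \<omega> = ennreal (?post D \<omega>)"
          using m0 ennreal_mult'[of "1 / m" "lik p k n D \<omega> * ?pr \<omega>"] by (simp add: post)
        then show "ennreal (1 / m) * (?joint D \<omega> * indicator U \<omega>) = ennreal (?post D \<omega>) * indicator U \<omega>"
          by (simp add: mult.assoc[symmetric])
      qed
      finally show ?thesis by simp
    qed
    also have "ennreal (1 / m) * ev U D = ennreal (L0 n D / m) * (ennreal (1 / L0 n D) * ev U D)"
      using L0 m0 ennreal_mult'[of "L0 n D / m" "1 / L0 n D"] by (simp add: mult.assoc[symmetric])
    also note evU
    also have "ennreal (L0 n D / m) * ennreal (2 * exp (- \<kappa>)) = ennreal (2 * exp (- \<kappa> - ln (m / L0 n D)))"
    proof -
      have "exp (- \<kappa> - ln (m / L0 n D)) = exp (- \<kappa>) * (L0 n D / m)"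
        using L0 m0 by (simp add: exp_diff)
      then show ?thesis using L0 m0 by (simp add: mult_ac flip: ennreal_mult')
    qed
    finally have postU: "(\<integral>\<^sup>+ \<omega>. ennreal (?post D \<omega>) * indicator U \<omega> \<partial>?M) \<le> ennreal (2 * exp (- \<kappa> - ln (m / L0 n D)))" .
    have post_meas: "?post D \<in> borel_measurable ?M"
      unfolding post[abs_def] by (intro borel_measurable_divide joint_meas) simp
    show ?thesis
    proof (rule measure_le_of_dKL[OF vdens_measurable post_meas U vdens_nonneg[OF vD(1)] nn_integral_vdens[OF vD(1)]])
      show "0 \<le> ?post D \<omega>" for \<omega> using pr lik_nonneg m0 by (simp add: post)
      show "0 \<le> EP D + ln (m / L0 n D)" using KL by simp
      show "dKL ?M (vdens K (v D)) (?post D) \<le> ennreal (EP D + ln (m / L0 n D))"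
        using KL vD(2)[OF vc] by (blast intro: order_trans)
    qed (use A EP r \<kappa> postU in \<open>auto simp: \<kappa>_def\<close>)
  qed
  let ?A = "{D \<in> space (P0 n). 2 * (r1 + r2 + 2) / (e / 4 * n) < \<bar>outer_meas (?Q D) U\<bar>}"
  \<comment> \<open>The inclusion holds up to null sets, where a covariate leaves the cube or
    minimality fails.\<close>
  have "outer_meas (P0 n) ?A \<le> measure (P0 n) (E1 \<union> E2 \<union> E3 \<union> E4)"
  proof (rule P.outer_meas_le_AE)
    show "E1 \<union> E2 \<union> E3 \<union> E4 \<in> sets (P0 n)" using E1 E2 E3 E4 by blast
    show "AE D in P0 n. D \<in> ?A \<longrightarrow> D \<in> E1 \<union> E2 \<union> E3 \<union> E4"
      using v AE_P0
    proof eventually_elim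
      case (elim D)
      show ?case
      proof (rule ccontr)
        assume neg: "\<not> (D \<in> ?A \<longrightarrow> D \<in> E1 \<union> E2 \<union> E3 \<union> E4)"
        then have "measure (?Q D) U \<le> 2 * (r1 + r2 + 2) / \<kappa>"
          using elim by (intro key) auto
        moreover have "outer_meas (?Q D) U \<le> measure (?Q D) U"
          using U by (intro outer_meas_le) auto
        moreover have "0 \<le> outer_meas (?Q D) U"
          using sets.sets_into_space[OF U] by (intro outer_meas_nonneg) auto
        ultimately show False using neg by (auto simp: \<kappa>_def)
      qed
    qed
  qed auto
  also have "\<dots> \<le> measure (P0 n) E1 + measure (P0 n) E2 + measure (P0 n) E3 + measure (P0 n) E4"
  proof -
    have "measure (P0 n) (E1 \<union> E2 \<union> E3 \<union> E4) \<le> measure (P0 n) (E1 \<union> E2 \<union> E3) + measure (P0 n) E4"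
      using E1 E2 E3 E4 by (intro measure_Un_le) blast+
    moreover have "measure (P0 n) (E1 \<union> E2 \<union> E3) \<le> measure (P0 n) (E1 \<union> E2) + measure (P0 n) E3"
      using E1 E2 E3 by (intro measure_Un_le) blast+
    moreover have "measure (P0 n) (E1 \<union> E2) \<le> measure (P0 n) E1 + measure (P0 n) E2"
      using E1 E2 by (intro measure_Un_le) blast+
    ultimately show ?thesis by linarith
  qed
  also have "\<dots> \<le> exp (- r1) + B / r2 + (card (grid_set K n (64 * \<sigma>0\<^sup>2)) + 1) * exp (- (e / 4) * n / 2) + exp \<kappa> * w"
    using E1(2) E2(2) E3(2) E4(2) by (simp add: exp_minus inverse_eq_divide mult.commute)
  finally show ?thesis unfolding U_def w_def \<kappa>_def .
qed

end

section \<open>Asymptotics\<close>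

text \<open>The limit is \<open>sqrt (1 + \<tau>)\<close>, and the strict gap to
  \<open>1 + \<tau>\<close> absorbs the vanishing discretisation error.\<close>

lemma eventually_bracket_const_le:
  fixes \<tau> c :: real assumes "\<tau> > 0"
  shows "eventually (\<lambda>n::nat. sqrt ((1 + 1 / n) * (1 + \<tau>)) * exp (c / (real n)\<^sup>2) \<le> 1 + \<tau>) at_top"
proof -
  have "(\<lambda>n::nat. c / (real n)\<^sup>2) \<longlonglongrightarrow> 0" by real_asymp
  then have "(\<lambda>n::nat. sqrt ((1 + 1 / n) * (1 + \<tau>)) * exp (c / (real n)\<^sup>2)) \<longlonglongrightarrow> sqrt ((1 + 0) * (1 + \<tau>)) * exp 0"
    by (intro tendsto_intros lim_1_over_n)
  moreover have "sqrt ((1 + 0) * (1 + \<tau>)) * exp 0 < 1 + \<tau>"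
  proof -
    have "1 + \<tau> < (1 + \<tau>)\<^sup>2" using assms by (simp add: power2_eq_square algebra_simps add_pos_pos)
    then have "sqrt (1 + \<tau>) < sqrt ((1 + \<tau>)\<^sup>2)" by (simp only: real_sqrt_less_iff)
    then show ?thesis using assms by simp
  qed
  ultimately have "eventually (\<lambda>n::nat. sqrt ((1 + 1 / n) * (1 + \<tau>)) * exp (c / (real n)\<^sup>2) < 1 + \<tau>) at_top"
    by (rule order_tendstoD(2))
  then show ?thesis by eventually_elim simp
qed

text \<open>Markov's inequality at level \<open>exp (- \<kappa>)\<close> costs a factor with
  exponent linear in \<open>n\<close>; cutting the sieve at \<open>n\<close> gives tails with
  quadratic exponent.\<close>

lemma tendsto_sieve_compl_bound:
  fixes P lam \<zeta> e A :: real assumes "lam > 0" "\<zeta> > 0" "e > 0"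
  shows "(\<lambda>n::nat. exp (e / 4 * n) * (A * exp (- lam * (real n)\<^sup>2 / 2) + P * n * (sqrt 2 * exp (- (real n)\<^sup>2 / (4 * \<zeta>\<^sup>2))))) \<longlonglongrightarrow> 0"
proof -
  have lim: "(\<lambda>n::nat. real n * exp (c * n - b * (real n)\<^sup>2)) \<longlonglongrightarrow> 0" "(\<lambda>n::nat. exp (c * n - b * (real n)\<^sup>2)) \<longlonglongrightarrow> 0"
    if "b > 0" "c > 0" for b c :: real using that by real_asymp+
  have "(\<lambda>n::nat. A * exp (e / 4 * n - lam / 2 * (real n)\<^sup>2)
      + P * sqrt 2 * (real n * exp (e / 4 * n - 1 / (4 * \<zeta>\<^sup>2) * (real n)\<^sup>2))) \<longlonglongrightarrow> A * 0 + P * sqrt 2 * 0"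
    using assms by (intro tendsto_intros lim) auto
  moreover have "exp (e / 4 * n) * (A * exp (- lam * (real n)\<^sup>2 / 2) + P * n * (sqrt 2 * exp (- (real n)\<^sup>2 / (4 * \<zeta>\<^sup>2))))
     = A * exp (e / 4 * n - lam / 2 * (real n)\<^sup>2)
      + P * sqrt 2 * (real n * exp (e / 4 * n - 1 / (4 * \<zeta>\<^sup>2) * (real n)\<^sup>2))" for n :: nat
  proof -
    have "exp (e / 4 * n - lam / 2 * (real n)\<^sup>2) = exp (e / 4 * n) * exp (- lam * (real n)\<^sup>2 / 2)"
      "exp (e / 4 * n - 1 / (4 * \<zeta>\<^sup>2) * (real n)\<^sup>2) = exp (e / 4 * n) * exp (- (real n)\<^sup>2 / (4 * \<zeta>\<^sup>2))"
      by (subst exp_add[symmetric], simp)+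
    then show ?thesis by (simp only:) (simp only: ring_distribs mult_ac)
  qed
  ultimately show ?thesis by simp
qed

text \<open>Every summand is compared with \<open>x powr (1 - \<delta>)\<close>, which is at least 1
  and so absorbs constants. The variable \<open>p\<close> is a generic constant here, later
  instantiated by \<open>real p + 3\<close> for the input dimension.\<close>

lemma candidate_cost_le:
  fixes x a \<delta> K P p \<zeta> lam v C0 S L \<Lambda> :: real
  assumes x: "x \<ge> 1" and \<delta>: "0 < \<delta>" "\<delta> < 1"
    and K: "0 \<le> K" "K \<le> P * x powr a" "K \<le> p * x" and P: "P > 0" and p: "p \<ge> 0"
    and pos: "\<zeta> > 0" "lam > 0" "v > 0"
    and ln1: "x powr a * (\<bar>ln \<zeta>\<bar> + 4 * ln x) \<le> x powr (1 - \<delta>)" and ln2: "ln x \<le> x powr (1 - \<delta>)"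
    and S: "0 \<le> S" "S \<le> x powr (1 - \<delta>)" and L: "\<bar>L\<bar> \<le> x powr (- \<delta>)" and \<Lambda>: "0 \<le> \<Lambda>" "\<Lambda> \<le> p * x\<^sup>2"
  defines "t \<equiv> 1 / x ^ 4" and "\<tau> \<equiv> x powr (- \<delta>)" and "c \<equiv> (x + 1) / (x * v)"
  shows "\<bar>K * ln (\<zeta> / t) + S / \<zeta>\<^sup>2 + ln x + C0 + K * t\<^sup>2 / \<zeta>\<^sup>2
        + c * (v + lam + (1 + 1 / \<tau>) * x * \<Lambda>\<^sup>2 * (K * t\<^sup>2))\<bar>
      + (c * (1 + \<tau>) / 2 - 1 / (2 * v)) * (x * v) + c * (1 + 1 / \<tau>) * (x * L\<^sup>2)
    \<le> (P + 1 / \<zeta>\<^sup>2 + 1 + \<bar>C0\<bar> + p / \<zeta>\<^sup>2 + 2 / v * (v + lam + 2 * p ^ 3) + 3 / 2 + 4 / v) * x powr (1 - \<delta>)"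
proof -
  define r where "r = x powr (1 - \<delta>)"
  have r1: "1 \<le> r" unfolding r_def using x \<delta> by (intro ge_one_powr_ge_zero) auto
  have xd: "1 \<le> x powr \<delta>" using x \<delta> by (intro ge_one_powr_ge_zero) auto
  have xd2: "x powr \<delta> \<le> x" using powr_mono[of \<delta> 1 x] x \<delta> by simp
  have \<tau>inv: "1 / \<tau> = x powr \<delta>" using x by (simp add: \<tau>_def powr_minus_divide)
  have \<tau>1: "\<tau> \<le> 1" "\<tau> \<ge> 0" using xd by (auto simp: \<tau>_def powr_minus_divide divide_le_eq_1)
  have x\<tau>: "x * \<tau> = r" using x by (simp add: \<tau>_def r_def powr_diff powr_minus_divide)
  have c: "0 \<le> c" "c \<le> 2 / v" using x pos by (auto simp: c_def field_simps)
  have t2: "t\<^sup>2 = 1 / x ^ 8" by (simp add: t_def power_divide flip: power_mult)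
  have Kt: "K * t\<^sup>2 \<le> p * x / x ^ 8" unfolding t2 using K(3) x by (simp add: divide_right_mono)
  also have "\<dots> = p / x ^ 7" using x by (simp add: field_simps eval_nat_numeral)
  finally have Kt7: "K * t\<^sup>2 \<le> p / x ^ 7" .
  have Kt0: "0 \<le> K * t\<^sup>2" using K by simp
  have Ktp: "K * t\<^sup>2 \<le> p"
  proof -
    have "p / x ^ 7 \<le> p / 1" using x p by (intro divide_left_mono) auto
    then show ?thesis using Kt7 by simp
  qed
  have b1: "\<bar>K * ln (\<zeta> / t)\<bar> \<le> P * r"
  proof -
    have "ln (\<zeta> / t) = ln \<zeta> + 4 * ln x"
      using pos x by (simp add: t_def ln_mult ln_realpow)
    then have "\<bar>ln (\<zeta> / t)\<bar> \<le> \<bar>ln \<zeta>\<bar> + 4 * ln x"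
      using x ln_ge_zero[of x] abs_triangle_ineq[of "ln \<zeta>" "4 * ln x"] by simp
    then have "\<bar>K * ln (\<zeta> / t)\<bar> \<le> P * x powr a * (\<bar>ln \<zeta>\<bar> + 4 * ln x)"
      unfolding abs_mult using K by (intro mult_mono) auto
    also have "\<dots> = P * (x powr a * (\<bar>ln \<zeta>\<bar> + 4 * ln x))" by simp
    also have "\<dots> \<le> P * r" unfolding r_def using ln1 P by (intro mult_left_mono) auto
    finally show ?thesis .
  qed
  have b2: "0 \<le> S / \<zeta>\<^sup>2" "S / \<zeta>\<^sup>2 \<le> 1 / \<zeta>\<^sup>2 * r"
    using S pos by (auto simp: r_def divide_right_mono)
  have b3: "0 \<le> ln x" "ln x \<le> 1 * r" using x ln2 by (auto simp: r_def)
  have b4: "\<bar>C0\<bar> \<le> \<bar>C0\<bar> * r" using mult_left_mono[OF r1, of "\<bar>C0\<bar>"] by simp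
  have b5: "0 \<le> K * t\<^sup>2 / \<zeta>\<^sup>2" "K * t\<^sup>2 / \<zeta>\<^sup>2 \<le> p / \<zeta>\<^sup>2 * r"
  proof -
    have "K * t\<^sup>2 / \<zeta>\<^sup>2 \<le> p / \<zeta>\<^sup>2" using Ktp by (intro divide_right_mono) auto
    also have "\<dots> \<le> p / \<zeta>\<^sup>2 * r" using mult_left_mono[OF r1, of "p / \<zeta>\<^sup>2"] p by simp
    finally show "K * t\<^sup>2 / \<zeta>\<^sup>2 \<le> p / \<zeta>\<^sup>2 * r" .
  qed (use K in simp)
  have err: "0 \<le> (1 + 1 / \<tau>) * x * \<Lambda>\<^sup>2 * (K * t\<^sup>2)" "(1 + 1 / \<tau>) * x * \<Lambda>\<^sup>2 * (K * t\<^sup>2) \<le> 2 * p ^ 3"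
  proof -
    \<comment> \<open>The factors are of order at most \<open>x\<close>, \<open>x\<close>,
      \<open>x ^ 4\<close> and \<open>1 / x ^ 7\<close>; this bookkeeping dictates the Gaussian
      scale \<open>1 / x ^ 4\<close>.\<close>
    have "(1 + 1 / \<tau>) * x * \<Lambda>\<^sup>2 * (K * t\<^sup>2) \<le> (2 * x) * x * (p * x\<^sup>2)\<^sup>2 * (p / x ^ 7)"
      using \<tau>inv xd2 x \<Lambda> Kt7 Kt0 p by (intro mult_mono power_mono) auto
    also have "\<dots> = 2 * p ^ 3 / x" using x by (simp add: field_simps eval_nat_numeral)
    also have "\<dots> \<le> 2 * p ^ 3 / 1" using x p by (intro divide_left_mono) auto
    finally show "(1 + 1 / \<tau>) * x * \<Lambda>\<^sup>2 * (K * t\<^sup>2) \<le> 2 * p ^ 3" by simp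
    show "0 \<le> (1 + 1 / \<tau>) * x * \<Lambda>\<^sup>2 * (K * t\<^sup>2)" using \<tau>1 x K(1) by (intro mult_nonneg_nonneg) auto
  qed
  define E where "E = v + lam + (1 + 1 / \<tau>) * x * \<Lambda>\<^sup>2 * (K * t\<^sup>2)"
  have E: "0 \<le> E" "E \<le> v + lam + 2 * p ^ 3" using err pos by (auto simp: E_def)
  have b6: "0 \<le> c * E" "c * E \<le> 2 / v * (v + lam + 2 * p ^ 3) * r"
  proof -
    have "c * E \<le> 2 / v * (v + lam + 2 * p ^ 3)" using c E pos by (intro mult_mono) auto
    also have "\<dots> \<le> 2 / v * (v + lam + 2 * p ^ 3) * r"
      using mult_left_mono[OF r1, of "2 / v * (v + lam + 2 * p ^ 3)"] pos p by simp
    finally show "c * E \<le> 2 / v * (v + lam + 2 * p ^ 3) * r" .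
  qed (use c E in simp)
  \<comment> \<open>The two leading terms \<open>x / 2\<close> cancel exactly, leaving
    \<open>(x * \<tau> + 1 + \<tau>) / 2\<close>.\<close>
  have b7: "(c * (1 + \<tau>) / 2 - 1 / (2 * v)) * (x * v) \<le> 3 / 2 * r"
  proof -
    have "c * (x * v) = x + 1" using x pos by (simp add: c_def)
    moreover have "(c * (1 + \<tau>) / 2 - 1 / (2 * v)) * (x * v) = (c * (x * v)) * (1 + \<tau>) / 2 - x / 2"
      using pos by (simp add: field_simps)
    ultimately have "(c * (1 + \<tau>) / 2 - 1 / (2 * v)) * (x * v) = (x * \<tau> + 1 + \<tau>) / 2"
      by (simp add: field_simps)
    then show ?thesis using \<tau>1 r1 by (simp add: x\<tau>)
  qed
  \<comment> \<open>\<open>L\<^sup>2 \<le> \<tau>\<^sup>2\<close> against the penalty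
    \<open>1 / \<tau>\<close> leaves \<open>x * \<tau>\<close>, the same order as the noise
    term.\<close>
  have b8: "c * (1 + 1 / \<tau>) * (x * L\<^sup>2) \<le> 4 / v * r"
  proof -
    have "L\<^sup>2 \<le> \<tau>\<^sup>2" using L \<tau>1 unfolding \<tau>_def by (intro abs_le_square_iff[THEN iffD1]) simp
    then have "c * (1 + 1 / \<tau>) * (x * L\<^sup>2) \<le> 2 / v * (2 * x powr \<delta>) * (x * \<tau>\<^sup>2)"
      using c xd x pos \<tau>inv by (intro mult_mono mult_left_mono) auto
    also have "\<dots> = 4 / v * (x powr \<delta> * \<tau>) * (x * \<tau>)" by (simp add: power2_eq_square)
    also have "x powr \<delta> * \<tau> = 1" using x by (simp add: \<tau>_def powr_minus field_simps)
    finally show ?thesis by (simp add: x\<tau>)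
  qed
  have "\<bar>K * ln (\<zeta> / t) + S / \<zeta>\<^sup>2 + ln x + C0 + K * t\<^sup>2 / \<zeta>\<^sup>2 + c * E\<bar>
      + (c * (1 + \<tau>) / 2 - 1 / (2 * v)) * (x * v) + c * (1 + 1 / \<tau>) * (x * L\<^sup>2)
    \<le> P * r + 1 / \<zeta>\<^sup>2 * r + 1 * r + \<bar>C0\<bar> * r + p / \<zeta>\<^sup>2 * r + 2 / v * (v + lam + 2 * p ^ 3) * r + 3 / 2 * r + 4 / v * r"
    using b1 b2 b3 b4 b5 b6 b7 b8 by (simp only: abs_le_iff) linarith
  also have "\<dots> = (P + 1 / \<zeta>\<^sup>2 + 1 + \<bar>C0\<bar> + p / \<zeta>\<^sup>2 + 2 / v * (v + lam + 2 * p ^ 3) + 3 / 2 + 4 / v) * r"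
    by (simp only: ring_distribs)
  finally show ?thesis by (simp only: E_def r_def)
qed

text \<open>At most \<open>x ^ 6\<close> cells per weight explains the factor 6. Since
  \<open>a < 1\<close> in the application, the exponent is of smaller order than \<open>n\<close>
  and loses against the probability bound of a single bracket.\<close>

lemma card_grid_set_le:
  fixes x T P :: real
  assumes x: "x = real n" "x \<ge> 1" and T: "T > 0" "T * x ^ 3 + 2 \<le> x ^ 4" and n5: "2 * x ^ 5 + 3 \<le> x ^ 6"
    and K: "real K \<le> P * x powr a"
  shows "real (card (grid_set K n T)) \<le> exp (6 * P * x powr a * ln x) * x ^ 4"
proof -
  have "real ((2 * n ^ 5 + 3) ^ K) = (2 * x ^ 5 + 3) ^ K" by (simp add: x)
  also have "\<dots> \<le> (x ^ 6) ^ K" using n5 x by (intro power_mono) auto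
  also have "\<dots> = exp (6 * real K * ln x)"
  proof -
    have "(x ^ 6) ^ K = x ^ (6 * K)" by (simp flip: power_mult)
    also have "\<dots> = exp (real (6 * K) * ln x)" using x by (subst exp_of_nat_mult) simp
    finally show ?thesis by simp
  qed
  also have "\<dots> \<le> exp (6 * (P * x powr a) * ln x)"
    using K x by (subst exp_le_cancel_iff) (intro mult_right_mono mult_left_mono, auto)
  finally have 1: "real ((2 * n ^ 5 + 3) ^ K) \<le> exp (6 * P * x powr a * ln x)" by (simp add: mult.assoc)
  have "real (nat \<lceil>T * real n ^ 3\<rceil>) = of_int \<lceil>T * x ^ 3\<rceil>" using T x by simp
  then have 2: "real (nat \<lceil>T * real n ^ 3\<rceil> + 1) \<le> x ^ 4" using T(2) by simp linarith
  have "real (card (grid_set K n T)) = real ((2 * n ^ 5 + 3) ^ K) * real (nat \<lceil>T * real n ^ 3\<rceil> + 1)"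
    by (simp only: card_grid_set of_nat_mult)
  also have "\<dots> \<le> exp (6 * P * x powr a * ln x) * x ^ 4" using 1 2 by (intro mult_mono) auto
  finally show ?thesis .
qed

text \<open>\<open>B\<close> is covered by the space itself, so its infimum runs over a nonempty set
  and is not an unspecified real \<open>Inf\<close>.\<close>

lemma outer_meas_mono:
  assumes "A \<subseteq> B" "B \<subseteq> space M"
  shows "outer_meas M A \<le> outer_meas M B"
  unfolding outer_meas_def using assms
  by (intro cInf_superset_mono) (auto intro!: bdd_belowI[of _ 0])

theorem theorem3:
  fixes p :: nat and f0 :: "(nat \<Rightarrow> real) \<Rightarrow> real"
    and \<sigma>0 \<alpha> lam \<zeta> a \<delta> :: real and kn :: "nat \<Rightarrow> nat"
    and \<theta>0 :: "nat \<Rightarrow> nat \<Rightarrow> real"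
    and qstar :: "nat \<Rightarrow> (nat \<Rightarrow> real \<times> (nat \<Rightarrow> real)) \<Rightarrow> vparam"
    and \<epsilon> \<epsilon>' :: real
  assumes "p \<ge> 1"
    and "f0 \<in> borel_measurable (Xmeas p)" and "integrable (Xmeas p) (\<lambda>x. (f0 x)^2)"
    and "\<sigma>0 > 0" and "\<alpha> > 0" and "lam > 0" and "\<zeta> > 0"
    and "0 < a" and "a < 1"
    and "(\<lambda>n. real (kn n)) \<sim>[at_top] (\<lambda>n. real n powr a)"
    and "0 < \<delta>" and "\<delta> < 1 - a"
    and A1: "(\<lambda>n. L2norm p (\<lambda>x. fnet p (kn n) (\<theta>0 n) x - f0 x)) \<in> o(\<lambda>n. real n powr (- \<delta>))"
    and A2: "(\<lambda>n. \<Sum>i<Knum p (kn n). (\<theta>0 n i)^2) \<in> o(\<lambda>n. real n powr (1 - \<delta>))"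
    and qstar_min: "\<And>n. AE D in P0n p f0 \<sigma>0 n.
          vvalid (Knum p (kn n)) (qstar n D) \<and>
          (\<forall>v. vvalid (Knum p (kn n)) v \<longrightarrow>
             dKL (param_meas (Knum p (kn n))) (vdens (Knum p (kn n)) (qstar n D))
                 (post_dens p \<alpha> lam \<zeta> (kn n) n D)
             \<le> dKL (param_meas (Knum p (kn n))) (vdens (Knum p (kn n)) v)
                 (post_dens p \<alpha> lam \<zeta> (kn n) n D))"
    and "\<epsilon> > 0" and "\<epsilon>' > 0"
  shows "o_P (P0n p f0 \<sigma>0)
           (\<lambda>n D. outer_meas
                    (density (param_meas (Knum p (kn n))) (\<lambda>\<omega>. ennreal (vdens (Knum p (kn n)) (qstar n D) \<omega>)))
                    (space (param_meas (Knum p (kn n))) - Vnbhd p f0 \<sigma>0 (kn n) \<epsilon>'))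
           (\<lambda>n. real n powr (\<epsilon> - \<delta>))"
proof -
  interpret regression p f0 \<sigma>0 by unfold_locales (use assms in auto)
  \<comment> \<open>Shrinking the radius enlarges the set to be controlled; the cap 2 is what the
    constant bracket allows.\<close>
  define e where "e = min \<epsilon>' 2"
  \<comment> \<open>Below \<open>\<epsilon>\<close>, so that \<open>r2 / n\<close> is of smaller
    order than the target rate; below \<open>\<delta>\<close>, so that \<open>r2\<close> is of
    smaller order than \<open>n\<close>; positive, so that the Markov bound for the cost tends to
    0.\<close>
  define \<epsilon>1 where "\<epsilon>1 = min \<epsilon> \<delta> / 2"
  have e: "0 < e" "e \<le> 2" "e \<le> \<epsilon>'" using \<open>\<epsilon>' > 0\<close> by (auto simp: e_def)
  have \<delta>: "0 < \<delta>" "\<delta> < 1" using assms by auto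
  have \<epsilon>1: "0 < \<epsilon>1" "\<epsilon>1 < \<epsilon>" "\<epsilon>1 < \<delta>" using \<open>\<epsilon> > 0\<close> \<delta> by (auto simp: \<epsilon>1_def min_def)
  define T where "T = 64 * \<sigma>0\<^sup>2"
  have T: "T > 0" using \<open>\<sigma>0 > 0\<close> by (simp add: T_def)
  define \<tau>' where "\<tau>' = (e / 4)\<^sup>2"
  have \<tau>': "\<tau>' > 0" using e by (simp add: \<tau>'_def)
  \<comment> \<open>One constant for two estimates: \<open>K \<le> q * x\<close> and
    \<open>\<Lambda> \<le> q * x\<^sup>2\<close>, both valid once \<open>k \<le> x\<close>.\<close>
  define q where "q = real p + 3"
  have "(\<lambda>n. real (kn n)) \<in> O(\<lambda>n. real n powr a)"
    using assms(10) by (rule asymp_equiv_imp_bigo)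
  then obtain cK where cK: "cK > 0" "eventually (\<lambda>n. norm (real (kn n)) \<le> cK * norm (real n powr a)) at_top"
    by (rule landau_o.bigE)
  define P where "P = 1 + cK * (real p + 2)"
  have P: "P > 0" using cK by (simp add: P_def add_pos_nonneg)
  define Cb where "Cb = P + 1 / \<zeta>\<^sup>2 + 1 + \<bar>\<alpha> * \<bar>ln (\<sigma>0\<^sup>2) + 1\<bar> + ln (Gamma \<alpha>) - \<alpha> * ln lam\<bar> + q / \<zeta>\<^sup>2
      + 2 / \<sigma>0\<^sup>2 * (\<sigma>0\<^sup>2 + lam + 2 * q ^ 3) + 3 / 2 + 4 / \<sigma>0\<^sup>2"
  define bnd where "bnd = (\<lambda>n::nat. (exp (- (real n powr (1 - \<delta>))) + Cb * real n powr (1 - \<delta>) / real n powr (1 - \<delta> + \<epsilon>1))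
      + (exp (6 * P * real n powr a * ln (real n)) * real n ^ 4 + 1) * exp (- (e / 4) * n / 2)
      + exp (e / 4 * n) * (2 powr \<alpha> * exp (- lam * (real n)\<^sup>2 / 2) + q * n * (sqrt 2 * exp (- (real n)\<^sup>2 / (4 * \<zeta>\<^sup>2)))))"
  have bnd: "bnd \<longlonglongrightarrow> 0"
  proof -
    have "(\<lambda>n::nat. exp (- (real n powr (1 - \<delta>))) + Cb * real n powr (1 - \<delta>) / real n powr (1 - \<delta> + \<epsilon>1)) \<longlonglongrightarrow> 0"
      using \<delta> \<epsilon>1(1) by real_asymp
    moreover have "(\<lambda>n::nat. (exp (6 * P * real n powr a * ln (real n)) * real n ^ 4 + 1) * exp (- (e / 4) * n / 2)) \<longlonglongrightarrow> 0"
      using \<open>0 < a\<close> \<open>a < 1\<close> e(1) P by real_asymp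
    moreover have "(\<lambda>n::nat. exp (e / 4 * n) * (2 powr \<alpha> * exp (- lam * (real n)\<^sup>2 / 2) + q * n * (sqrt 2 * exp (- (real n)\<^sup>2 / (4 * \<zeta>\<^sup>2))))) \<longlonglongrightarrow> 0"
      using \<open>lam > 0\<close> \<open>\<zeta> > 0\<close> e(1) by (rule tendsto_sieve_compl_bound)
    ultimately show ?thesis unfolding bnd_def by (auto intro: tendsto_add_zero)
  qed
  have ev_k: "eventually (\<lambda>n. cK * real n powr a \<le> real n) at_top"
    using \<open>0 < a\<close> \<open>a < 1\<close> by real_asymp
  have ev_S: "eventually (\<lambda>n. norm (\<Sum>i<Knum p (kn n). (\<theta>0 n i)\<^sup>2) \<le> 1 * norm (real n powr (1 - \<delta>))) at_top"
    using landau_o.smallD[OF A2, of 1] by simp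
  have ev_L: "eventually (\<lambda>n. norm (L2norm p (\<lambda>x. fnet p (kn n) (\<theta>0 n) x - f0 x)) \<le> 1 * norm (real n powr (- \<delta>))) at_top"
    using landau_o.smallD[OF A1, of 1] by simp
  have ev_ln1: "eventually (\<lambda>n. real n powr a * (\<bar>ln \<zeta>\<bar> + 4 * ln (real n)) \<le> real n powr (1 - \<delta>)) at_top"
    using \<open>0 < a\<close> \<delta> \<open>\<delta> < 1 - a\<close> by real_asymp
  have ev_ln2: "eventually (\<lambda>n. ln (real n) \<le> real n powr (1 - \<delta>)) at_top"
    using \<delta> by real_asymp
  have ev_r2: "eventually (\<lambda>n. 2 * real n powr (1 - \<delta> + \<epsilon>1) \<le> e / 4 * real n) at_top"
    using \<delta> \<epsilon>1 e(1) by real_asymp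
  have ev_T: "eventually (\<lambda>n. T * real n ^ 3 + 2 \<le> real n ^ 4) at_top"
    using T by real_asymp
  have ev_5: "eventually (\<lambda>n. 2 * real n ^ 5 + 3 \<le> real n ^ 6) at_top"
    by real_asymp
  have ev_C: "eventually (\<lambda>n. sqrt ((1 + 1 / real n) * (1 + \<tau>')) * exp (q\<^sup>2 / (2 * \<tau>') / (real n)\<^sup>2) \<le> 1 + \<tau>') at_top"
    using \<tau>' by (rule eventually_bracket_const_le)
  have ev_\<alpha>: "eventually (\<lambda>n. \<alpha> \<le> real n) at_top"
    by real_asymp
  define Z where "Z = (\<lambda>n D. outer_meas (density (param_meas (Knum p (kn n))) (\<lambda>\<omega>. ennreal (vdens (Knum p (kn n)) (qstar n D) \<omega>)))
                    (space (param_meas (Knum p (kn n))) - Vnbhd p f0 \<sigma>0 (kn n) \<epsilon>'))"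
  show ?thesis unfolding o_P_def Z_def[symmetric]
  proof (intro allI impI)
    fix \<eta> :: real assume \<eta>: "\<eta> > 0"
    define A where "A = (\<lambda>n. {D \<in> space (P0 n). \<bar>Z n D\<bar> > \<eta> * real n powr (\<epsilon> - \<delta>)})"
    have ev_\<eta>: "eventually (\<lambda>n. 2 * (real n powr (1 - \<delta>) + real n powr (1 - \<delta> + \<epsilon>1) + 2) / (e / 4 * real n)
        \<le> \<eta> * real n powr (\<epsilon> - \<delta>)) at_top"
      using \<delta> \<epsilon>1 e(1) \<eta> by real_asymp
    have "eventually (\<lambda>n. outer_meas (P0 n) (A n) \<le> bnd n) at_top"
      using cK(2) ev_k ev_S ev_L ev_ln1 ev_ln2 ev_r2 ev_T ev_5 ev_C ev_\<alpha> ev_\<eta> eventually_ge_at_top[of 1]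
    proof eventually_elim
      case (elim n)
      define k where "k = kn n"
      define K where "K = Knum p k"
      define x where "x = real n"
      \<comment> \<open>Any divergent sequence within the target order would do for the log
        evidence; this one is of the same order as the mean cost.\<close>
      define r1 where "r1 = x powr (1 - \<delta>)"
      define r2 where "r2 = x powr (1 - \<delta> + \<epsilon>1)"
      define \<Lambda> where "\<Lambda> = 1 + real k + real k * x * (real p + 1)"
      have x: "x \<ge> 1" using elim by (simp add: x_def)
      have kx: "real k \<le> cK * x powr a" "real k \<le> x"
        using elim(1,2) by (auto simp: k_def x_def)
      have xa: "1 \<le> x powr a" using x \<open>0 < a\<close> by (intro ge_one_powr_ge_zero) auto
      have Kr: "real K = 1 + real k * (real p + 2)" by (simp add: K_def Knum_def algebra_simps)
      have K1: "real K \<le> P * x powr a"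
      proof -
        have "real k * (real p + 2) \<le> cK * x powr a * (real p + 2)" using kx by (intro mult_right_mono) auto
        then show ?thesis using xa unfolding Kr P_def by (simp add: algebra_simps)
      qed
      have K2: "real K \<le> q * x"
      proof -
        have "real k * (real p + 2) \<le> x * (real p + 2)" using kx by (intro mult_right_mono) auto
        then show ?thesis using x unfolding Kr q_def by (simp add: algebra_simps)
      qed
      have \<Lambda>: "0 \<le> \<Lambda>" "\<Lambda> \<le> q * x\<^sup>2"
      proof -
        have "x \<le> x\<^sup>2" "1 \<le> x\<^sup>2" using x mult_mono[of 1 x 1 x] by (auto simp: power2_eq_square)
        moreover have "real k * x * (real p + 1) \<le> x * x * (real p + 1)"
          using kx x by (intro mult_right_mono) auto
        ultimately show "\<Lambda> \<le> q * x\<^sup>2"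
          using kx unfolding \<Lambda>_def q_def by (simp add: power2_eq_square algebra_simps)
      qed (use x in \<open>simp add: \<Lambda>_def\<close>)
      have S: "(\<Sum>i<K. (\<theta>0 n i)\<^sup>2) \<le> x powr (1 - \<delta>)"
        using elim(3) by (simp add: K_def k_def x_def sum_nonneg)
      \<comment> \<open>The bound on the sum of squares already puts each candidate centre below
        \<open>x\<close>, so the Lipschitz constant in the divergence bound has the same form as the
        one in the sieve.\<close>
      have R: "\<bar>\<theta>0 n i\<bar> \<le> x" if "i < K" for i
      proof -
        have "(\<theta>0 n i)\<^sup>2 \<le> (\<Sum>i<K. (\<theta>0 n i)\<^sup>2)" using that by (intro member_le_sum) auto
        also have "\<dots> \<le> x powr 1" using S powr_mono[of "1 - \<delta>" 1 x] x \<delta> by simp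
        also have "\<dots> \<le> x\<^sup>2" using x by (simp add: power2_eq_square)
        finally show ?thesis using x abs_le_square_iff[of "\<theta>0 n i" x] by simp
      qed
      have C: "sqrt ((1 + 1 / n) * (1 + \<tau>')) * exp ((\<Lambda> / n ^ 4)\<^sup>2 / (2 * \<tau>' * (1 / (real n)\<^sup>2))) \<le> 1 + \<tau>'"
      proof -
        have "(\<Lambda> / n ^ 4)\<^sup>2 / (2 * \<tau>' * (1 / (real n)\<^sup>2)) \<le> (q * x\<^sup>2 / x ^ 4)\<^sup>2 / (2 * \<tau>' * (1 / x\<^sup>2))"
          using \<Lambda> \<tau>' x by (auto intro!: divide_right_mono power_mono simp: x_def)
        also have "\<dots> = q\<^sup>2 / (2 * \<tau>') / (real n)\<^sup>2"
          using x \<tau>' by (simp add: field_simps eval_nat_numeral flip: x_def)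
        finally have "exp ((\<Lambda> / n ^ 4)\<^sup>2 / (2 * \<tau>' * (1 / (real n)\<^sup>2))) \<le> exp (q\<^sup>2 / (2 * \<tau>') / (real n)\<^sup>2)" by simp
        then have "sqrt ((1 + 1 / n) * (1 + \<tau>')) * exp ((\<Lambda> / n ^ 4)\<^sup>2 / (2 * \<tau>' * (1 / (real n)\<^sup>2)))
          \<le> sqrt ((1 + 1 / n) * (1 + \<tau>')) * exp (q\<^sup>2 / (2 * \<tau>') / (real n)\<^sup>2)"
          using \<tau>' by (intro mult_left_mono) auto
        then show ?thesis using elim(10) by linarith
      qed
      have n: "n > 0" "\<alpha> \<le> real n" using elim by auto
      have r: "r2 > 0" "2 * r2 \<le> e / 4 * n" using elim(7) x by (auto simp: r2_def x_def)
      have L: "\<bar>L2norm p (\<lambda>z. fnet p k (\<theta>0 n) z - f0 z)\<bar> \<le> x powr (- \<delta>)"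
        using elim(4) by (simp add: k_def x_def)
      note B = candidate_cost_le[OF x \<delta> _ K1 K2 P _ \<open>\<zeta> > 0\<close> \<open>lam > 0\<close> _ elim(5)[folded x_def] elim(6)[folded x_def]
          _ S L \<Lambda>, of "\<sigma>0\<^sup>2" "\<alpha> * \<bar>ln (\<sigma>0\<^sup>2) + 1\<bar> + ln (Gamma \<alpha>) - \<alpha> * ln lam", folded Cb_def]
      have "outer_meas (P0 n) {D \<in> space (P0 n). 2 * (r1 + r2 + 2) / (e / 4 * n) < \<bar>Z n D\<bar>}
        \<le> exp (- r1) + Cb * x powr (1 - \<delta>) / r2 + (card (grid_set K n (64 * \<sigma>0\<^sup>2)) + 1) * exp (- (e / 4) * n / 2)
      + exp (e / 4 * n) * (2 powr \<alpha> * exp (- lam * (real n)\<^sup>2 / 2) + K * (sqrt 2 * exp (- (real n)\<^sup>2 / (4 * \<zeta>\<^sup>2))))"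
        unfolding Z_def K_def k_def
      proof (rule variational_tail_bound[where R = x and t = "1 / x ^ 4" and \<tau> = "x powr (- \<delta>)" and ?\<theta>0.0 = "\<theta>0 n"])
        show "AE D in P0 n. vvalid (Knum p (kn n)) (qstar n D) \<and>
          (\<forall>w. vvalid (Knum p (kn n)) w \<longrightarrow>
             dKL (param_meas (Knum p (kn n))) (vdens (Knum p (kn n)) (qstar n D)) (post_dens p \<alpha> lam \<zeta> (kn n) n D)
             \<le> dKL (param_meas (Knum p (kn n))) (vdens (Knum p (kn n)) w) (post_dens p \<alpha> lam \<zeta> (kn n) n D))"
          by (rule qstar_min)
        show "sqrt ((1 + 1 / real n) * (1 + (e / 4)\<^sup>2)) *
           exp (((1 + real (kn n) + real (kn n) * real n * (real p + 1)) / real (n ^ 4))\<^sup>2 / (2 * (e / 4)\<^sup>2 * (1 / (real n)\<^sup>2))) \<le> 1 + (e / 4)\<^sup>2"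
          using C by (simp add: \<tau>'_def \<Lambda>_def k_def x_def)
        show "\<bar>real (Knum p (kn n)) * ln (\<zeta> / (1 / x ^ 4)) + (\<Sum>i<Knum p (kn n). (\<theta>0 n i)\<^sup>2) / \<zeta>\<^sup>2 + ln (real n)
            + (\<alpha> * \<bar>ln (\<sigma>0\<^sup>2) + 1\<bar> + ln (Gamma \<alpha>) - \<alpha> * ln lam) + real (Knum p (kn n)) * (1 / x ^ 4)\<^sup>2 / \<zeta>\<^sup>2
            + (real n + 1) / (real n * \<sigma>0\<^sup>2) * (\<sigma>0\<^sup>2 + lam + (1 + 1 / x powr (- \<delta>)) * real n
               * (1 + real (kn n) + real (kn n) * x * (real p + 1))\<^sup>2 * (real (Knum p (kn n)) * (1 / x ^ 4)\<^sup>2))\<bar>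
          + ((real n + 1) / (real n * \<sigma>0\<^sup>2) * (1 + x powr (- \<delta>)) / 2 - 1 / (2 * \<sigma>0\<^sup>2)) * (real n * \<sigma>0\<^sup>2)
          + (real n + 1) / (real n * \<sigma>0\<^sup>2) * (1 + 1 / x powr (- \<delta>)) * (real n * (L2norm p (\<lambda>x. fnet p (kn n) (\<theta>0 n) x - f0 x))\<^sup>2)
          \<le> Cb * x powr (1 - \<delta>)"
          using B \<open>\<sigma>0 > 0\<close> by (simp only: \<Lambda>_def K_def k_def x_def[symmetric]) (simp add: sum_nonneg q_def)
        show "\<bar>\<theta>0 n i\<bar> \<le> x" if "i < Knum p (kn n)" for i using R that by (simp add: K_def k_def)
      qed (use assms e n r x in auto)
      also have "\<dots> \<le> exp (- r1) + Cb * x powr (1 - \<delta>) / r2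
          + (exp (6 * P * x powr a * ln x) * x ^ 4 + 1) * exp (- (e / 4) * n / 2)
          + exp (e / 4 * n) * (2 powr \<alpha> * exp (- lam * (real n)\<^sup>2 / 2) + q * x * (sqrt 2 * exp (- (real n)\<^sup>2 / (4 * \<zeta>\<^sup>2))))"
        using card_grid_set_le[OF x_def x T elim(8)[folded x_def] elim(9)[folded x_def] K1] K2
        by (intro add_mono mult_right_mono mult_left_mono order_refl) (auto simp: T_def)
      also have "\<dots> = bnd n" by (simp add: bnd_def r1_def r2_def x_def)
      finally have 1: "outer_meas (P0 n) {D \<in> space (P0 n). 2 * (r1 + r2 + 2) / (e / 4 * n) < \<bar>Z n D\<bar>} \<le> bnd n" .
      have "outer_meas (P0 n) (A n) \<le> outer_meas (P0 n) {D \<in> space (P0 n). 2 * (r1 + r2 + 2) / (e / 4 * n) < \<bar>Z n D\<bar>}"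
        using elim(12) by (intro outer_meas_mono) (auto simp: A_def r1_def r2_def x_def)
      with 1 show ?case by linarith
    qed
    moreover have "eventually (\<lambda>n. 0 \<le> outer_meas (P0 n) (A n)) at_top"
      by (intro always_eventually allI outer_meas_nonneg) (auto simp: A_def)
    ultimately have "(\<lambda>n. outer_meas (P0 n) (A n)) \<longlonglongrightarrow> 0"
      by (intro tendsto_sandwich[OF _ _ tendsto_const bnd])
    then show "(\<lambda>n. outer_meas (P0 n) {D \<in> space (P0 n). \<eta> * real n powr (\<epsilon> - \<delta>) < \<bar>Z n D\<bar>}) \<longlonglongrightarrow> 0"
      unfolding A_def .
  qed
qed

end
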